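(* Let $\varepsilon>0$ and suppose that $X$ has metabasins of order $\varepsilon$ at level $i$, with connectivity parameters $\eta_1,\eta_2,\eta_3$. Fix $K\in\mathbb N$, $T=\sigma_K$ and $0<\delta\le\big((\eta_1\wedge(\eta_2-1)-1)e^{-2\beta\varepsilon}\big)^K$. Write $Y_k=Y_k^{(i)}$. Then, for each $0\le k<K$ and $m_0\in\mathcal S^{(i)}$, there exists $\beta_0>0$ such that for all $\beta\ge\beta_0$: (a) $\displaystyle\mathbb P_{m_0}\big(V^{(i)}_<(Y_k)\subseteq\mathcal V(Y_k)\big)\ge1-\Big(\max_{m\in\mathcal S^{(i)}\setminus N^{(i)}}|V^{(i)}_<(m)|+2\Big)\max_{m\in\mathcal S^{(i)}\setminus N^{(i)}}\delta(m,\beta)$, where $V^{(i)}_<(s):=\{s\}$ if $s\in N^{(i)}$. (b) $\displaystyle\mathbb P_{m_0}\big(\mathcal V(Y_j)\subseteq V^{(i)}(Y_j),\ 0\le j<k\big)\ge1-k\Big(\max_{m\in\mathcal S^{(i)}\setminus N^{(i)}}\delta(m,\beta)+(1-\delta)\Big).$ (c) If $\eta_2\wedge\eta_3>K-1$, then $$\mathbb P_{m_0}\big(\mathcal V(Y_j)\subseteq V^{(i)}(Y_j),\ 0\le j\le K-1\big)\ge[\eta_2\wedge\eta_3]_K\Big(1-\max_{m\in\mathcal S^{(i)}\setminus N^{(i)}}\delta(m,\beta)\Big)^{K-1}e^{-2K\varepsilon\beta},$$ where $[N]_K:=N(N-1)\cdots(N-K+1)$.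
   Context: **Setting.** $\mathcal S$ is a finite set and $E:\mathcal S\to\mathbb R$ satisfies $E(r)\neq E(s)$ for $r\ne s$. For each $\beta>0$, $X=(X_n)_{n\ge0}$ is a Markov chain on $\mathcal S$ with transition matrix $(p(r,s))_{r,s\in\mathcal S}$ (depending on $\beta$) and stationary distribution $\pi$ such that: (i) the chain is irreducible, $p(s,s)>0$, $p(r,s)>0\iff p(s,r)>0$, and the set of pairs with $p(r,s)>0$ does not depend on $\beta$; (ii) there are $\gamma_\beta>0$ with $\gamma_\beta\to0$, $\beta\gamma_\beta\to\infty$ as $\beta\to\infty$ and $e^{-\beta((E(s)-E(r))^++\gamma_\beta/|\mathcal S|)}\le p(r,s)\le e^{-\beta((E(s)-E(r))^+-\gamma_\beta/|\mathcal S|)}$ for all distinct $r,s$ with $p(r,s)>0$; (iii) $p^*(r,s):=\lim_{\beta\to\infty}p(r,s)$ exists for all $r,s$ and, for pairs with $p(r,s)>0$, is positive if $E(r)\ge E(s)$ and $0$ otherwise; (iv) $\pi(r)p(r,s)=\pi(s)p(s,r)$. Distinct states $r,s$ are neighbours, $r\sim s$, if $p(r,s)>0$; $\mathcal N(r):=\{y\in\mathcal S:p(r,y)>0\}$. $\mathbb P_x$ refers to the chain started at $x$. $a\wedge b=\min(a,b)$. **Essential saddles.** For $r\neq s$, $\Gamma(r,s)$ is the set of self-avoiding paths $(\gamma_0,\dots,\gamma_k)$ with $\gamma_0=r$, $\gamma_k=s$, $p(\gamma_l,\gamma_{l+1})>0$. A path in $\Gamma(r,s)$ is minimal if its maximal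 energy $\max_l E(\gamma_l)$ is minimal within $\Gamma(r,s)$. The essential saddle $z^*(r,s)$ is the state of maximal energy on any minimal path from $r$ to $s$ (well defined since $E$ is injective); $z^*(s,s):=s$. **Metastable states.** $M^{(1)}:=\{s: E(s)<E(r)\text{ for all }r\sim s\}$ is the set of local minima, and $\mathcal S=M^{(0)}\supset M^{(1)}\supset\dots\supset M^{(\mathfrak n)}=\{s_0\}$ is the filtration into metastable states constructed by Scoppola for Markov chains with exponentially small transition probabilities. It starts with $M^{(1)}$ and deletes one local minimum at each step, namely the one with minimal activation energy for a transition to another minimum, the activation energy from $s$ to $m$ being $I(s,m)=\inf_{\gamma\in\Gamma(s,m)}\sum_{l\ge1}(E(\gamma_l)-E(\gamma_{l-1}))^+$ (the elements of the sets $M^{(i)}$ arise from the local minima of $E$ or of certain modifications of it). The local minima are labelled $m^{(1)},\dots,m^{(\mathfrak n)}$ so that $M^{(i)}=\{m^{(i)},\dots,m^{(\mathfrak n)}\}$ for $1\le i\le\mathfrak n$. **Attraction.** For a local minimum $m$ and a level $i$, $V^{(i)}_<(m):=\{s: E(z^*(s,m))<E(z^*(s,m'))\ \forall m'\in M^{(i)}\setminus\{m\}\}$. For $m\in M^{(i)}$, state $s$ is attracted by $m$ at level $i$ ($s\leadsto m$ at level $i$) if $E(z^*(s,m))=\min_{n\in M^{(i)}}E(z^*(s,n))$ and every minimal path from $s$ to any $m'\in M^{(i)}\setminus\{m\}$ with $E(z^*(s,m'))=E(z^*(s,m))$ hits $V^{(i)}_<(m)$. Let $l(i):=\inf\{j: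 i<j\le\mathfrak n,\ m^{(i)}\leadsto m\text{ at level }j\text{ for some }m\in M^{(j)}\}$ ($\inf\emptyset=\infty$). **Valleys.** $V^{(1)}(m):=\{s: s\leadsto m\text{ at level }1\}$ for $m\in M^{(1)}$, $N^{(1)}:=(\bigcup_{j=1}^{\mathfrak n}V^{(1)}(m^{(j)}))^c$. For $2\le i\le\mathfrak n$, $m\in M^{(i)}$: $V^{(i)}(m):=V^{(i-1)}(m)\cup\{s\in N^{(i-1)}: s\leadsto m\text{ at level }i\}\cup\bigcup_{j:\,l(j)=i,\ m^{(j)}\leadsto m\text{ at level }i}V^{(j)}(m^{(j)})$, and $N^{(i)}:=(\bigcup_{j=1}^{\mathfrak n}V^{(i\wedge j)}(m^{(j)}))^c$ (non-assigned states). **Aggregation.** $\mathcal S^{(i)}:=\{m^{(j)}: l(j)>i\}\cup N^{(i)}$. For $s\in\mathcal S^{(i)}$: if $s=m^{(j)}$ with $j\ge i$, $V^{(i)}(s)$ is the valley of order $i$ just defined; if $s=m^{(j)}$ with $j<i$, $V^{(i)}(s):=V^{(j)}(m^{(j)})$; if $s\in N^{(i)}$, $V^{(i)}(s):=\{s\}$. $\overline Y^{(i)}_n$ is the $s\in\mathcal S^{(i)}$ with $X_n\in V^{(i)}(s)$; $\sigma_0:=0$, $\sigma_n:=\inf\{k>\sigma_{n-1}:\overline Y^{(i)}_k\ne\overline Y^{(i)}_{k-1}\}$; $Y^{(i)}_n:=\overline Y^{(i)}_{\sigma_n}$. $\partial^+V$ is the set of states outside $V$ adjacent to a state of $V$;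 for $m\in\mathcal S^{(i)}\setminus N^{(i)}$, $s_m:=\operatorname{argmin}_{s\in\partial^+V^{(i)}(m)}E(s)$. **Metabasins.** A minimal path $\gamma=(\gamma_0,\dots,\gamma_k)$ from $s_m$ to $m'$ is an uphill-downhill-path if $\sum_{l=1}^k(E(\gamma_l)-E(\gamma_{l-1}))^+=E(z^*(s_m,m'))-E(s_m)$. $X$ has metabasins of order $\varepsilon$ at level $i$ if $i<\mathfrak n-1$ and for each $m\in\mathcal S^{(i)}\setminus N^{(i)}$: (MB1) $\sup_{m'\in\mathcal S^{(i)}\setminus(N^{(i)}\cup\{m\})}E(z^*(m,m'))-E(s_m)\le\varepsilon$; (MB2) there are at least two distinct $m_1,m_2\in\mathcal S^{(i)}\setminus(N^{(i)}\cup\{m\})$ with a minimal uphill-downhill-path from $s_m$ to $m_k$ not hitting any other valley but $V^{(i)}(m_k)$, $k=1,2$ (valleys here being the $V^{(i)}(n)$ with $n\in\mathcal S^{(i)}\setminus N^{(i)}$). The metabasins are then the sets $V^{(i)}(m)$, $m\in\mathcal S^{(i)}$. **Connectivity parameters.** $\eta_1:=\min\big|\{s\in\mathcal N(n)\setminus V^{(i)}(r): E(s)\le E(n)+\varepsilon\}\big|$, the minimum over $n\in N^{(i)}$, $r\in\mathcal S^{(i)}$ with $V^{(i)}(r)\cap\mathcal N(n)\ne\emptyset$; $\eta_2:=\min_{m\in\mathcal S^{(i)}\setminus N^{(i)}}|\{s\in\partial^+V^{(i)}(m): E(s)\le E(s_m)+\varepsilon\}|$; $\eta_3:=\min_{n\in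 N^{(i)}}|\{s\in\mathcal S^{(i)}: E(x)\le E(n)+\varepsilon\text{ for some }x\in V^{(i)}(s)\cap\mathcal N(n)\}|$. **Error terms.** $K(\beta):=|\mathcal S|\max_{r\in\mathcal S}|\mathcal N(r)|\big(|\mathcal S|e^{-\beta(\min_{a\ne b:E(a)>E(b)}(E(a)-E(b))-2\gamma_\beta)}+1\big)$ (not to be confused with the integer $K$) and $\varepsilon(x,y,z,\beta):=K(\beta)e^{-\beta(E(z^*(x,z))-E(z^*(x,y))-7\gamma_\beta)}$. With $B:=\{z\in\mathcal S:E(z^*(x,z))>E(z^*(x,m))\}$, $$\tilde\varepsilon(x,m,y,\beta):=\varepsilon(x,m,y,\beta)\mathbf 1_B(y)+\Big(\sum_{z:E(z)>E(z^*(x,y))}\varepsilon(x,y,z,\beta)+\sum_{z\in V^{(i)}_<(m)}\varepsilon(z,m,y,\beta)\Big)\mathbf 1_{B^c}(y).$$ For $m\in\mathcal S^{(i)}\setminus N^{(i)}$: $\delta(m,\beta):=\max_{x\in V^{(i)}(m)}\sum_{z\in\partial^+V^{(i)}(m)}\tilde\varepsilon(x,m,z,\beta)$. **Path-dependent metabasins.** Given $X_0,\dots,X_T$: $\chi_0:=0$, $\chi_n:=\inf\{k>\chi_{n-1}:\{X_k,\dots,X_T\}\cap\{X_0,\dots,X_{k-1}\}=\emptyset\}$ (so that the value after the last $\chi_n\le T$ is $T+1$), $\upsilon:=\sup\{n\ge0:\chi_n\le T\}$, and $\mathcal V_n:=\{X_{\chi_n},\dots,X_{\chi_{n+1}-1}\}$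 for $0\le n\le\upsilon$. For $x\in\mathcal S$, $\mathcal V(x)$ is the $\mathcal V_n$ containing $x$, and $\mathcal V(x):=\emptyset$ if $x\notin\{X_0,\dots,X_T\}$.
   Formalization: Part (b) is stated under the additional condition η₁∧(η₂−1)−1 > 0; for even K and η₂ = 1 the base equals −1, its power is positive by a sign accident, and (b) fails (one saddle joined to three minima, K = 2, k = 1). *)

theory Defs
  imports "HOL-Probability.Probability" "HOL-Library.Extended_Nat"
begin

section \<open>The Markov chains\<close>

text \<open>
  The finite state space is the type \<open>'s\<close>. The relation \<open>adj r s\<close> is \<open>p(r,s) > 0\<close>, which is the
  same for all \<open>\<beta>\<close>; it is reflexive, because \<open>p(s,s) > 0\<close>.
\<close>

locale metastable_chain =
  fixes E :: "'s::finite \<Rightarrow> real"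
    and adj :: "'s \<Rightarrow> 's \<Rightarrow> bool"
    and p :: "real \<Rightarrow> 's \<Rightarrow> 's \<Rightarrow> real"
    and sd :: "real \<Rightarrow> 's \<Rightarrow> real"
    and \<gamma> :: "real \<Rightarrow> real"
  assumes E_inj: "inj E"
    and p_nonneg: "\<And>\<beta> r s. \<beta> > 0 \<Longrightarrow> p \<beta> r s \<ge> 0"
    and p_sum: "\<And>\<beta> r. \<beta> > 0 \<Longrightarrow> (\<Sum>s\<in>UNIV. p \<beta> r s) = 1"
    and sd_nonneg: "\<And>\<beta> s. \<beta> > 0 \<Longrightarrow> sd \<beta> s \<ge> 0"
    and sd_sum: "\<And>\<beta>. \<beta> > 0 \<Longrightarrow> (\<Sum>s\<in>UNIV. sd \<beta> s) = 1"
    and sd_stationary: "\<And>\<beta> s. \<beta> > 0 \<Longrightarrow> (\<Sum>r\<in>UNIV. sd \<beta> r * p \<beta> r s) = sd \<beta> s"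
    and adj_iff: "\<And>\<beta> r s. \<beta> > 0 \<Longrightarrow> adj r s \<longleftrightarrow> p \<beta> r s > 0"
    and irreducible: "\<And>r s. adj\<^sup>*\<^sup>* r s"
    and adj_refl: "\<And>s. adj s s"
    and adj_sym: "\<And>r s. adj r s \<longleftrightarrow> adj s r"
    and \<gamma>_pos: "\<And>\<beta>. \<beta> > 0 \<Longrightarrow> \<gamma> \<beta> > 0"
    and \<gamma>_tendsto: "(\<gamma> \<longlongrightarrow> 0) at_top"
    and \<beta>\<gamma>_tendsto: "filterlim (\<lambda>\<beta>. \<beta> * \<gamma> \<beta>) at_top at_top"
    and p_lower: "\<And>\<beta> r s. \<beta> > 0 \<Longrightarrow> r \<noteq> s \<Longrightarrow> adj r s \<Longrightarrow>
          exp (- \<beta> * (max 0 (E s - E r) + \<gamma> \<beta> / real (card (UNIV :: 's set)))) \<le> p \<beta> r s"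
    and p_upper: "\<And>\<beta> r s. \<beta> > 0 \<Longrightarrow> r \<noteq> s \<Longrightarrow> adj r s \<Longrightarrow>
          p \<beta> r s \<le> exp (- \<beta> * (max 0 (E s - E r) - \<gamma> \<beta> / real (card (UNIV :: 's set))))"
    and p_limit: "\<exists>pstar. \<forall>r s. ((\<lambda>\<beta>. p \<beta> r s) \<longlongrightarrow> pstar r s) at_top \<and>
          (adj r s \<longrightarrow> (if E r \<ge> E s then pstar r s > 0 else pstar r s = 0))"
    and detailed_balance: "\<And>\<beta> r s. \<beta> > 0 \<Longrightarrow> sd \<beta> r * p \<beta> r s = sd \<beta> s * p \<beta> s r"

text \<open>
  Under \<open>M\<close>, the process \<open>X\<close> is a Markov chain with transition matrix \<open>q\<close> started at \<open>a\<close>;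
  the Markov property is stated with the conditional probability multiplied out.
\<close>

definition markov_chain_from ::
  "('s::finite \<Rightarrow> 's \<Rightarrow> real) \<Rightarrow> 's \<Rightarrow> 'w measure \<Rightarrow> (nat \<Rightarrow> 'w \<Rightarrow> 's) \<Rightarrow> bool" where
  "markov_chain_from q a M X \<longleftrightarrow>
     prob_space M \<and>
     (\<forall>n. X n \<in> measurable M (count_space UNIV)) \<and>
     measure M {\<omega> \<in> space M. X 0 \<omega> = a} = 1 \<and>
     (\<forall>n x. measure M {\<omega> \<in> space M. \<forall>l\<le>Suc n. X l \<omega> = x l} =
            measure M {\<omega> \<in> space M. \<forall>l\<le>n. X l \<omega> = x l} * q (x n) (x (Suc n)))"


section \<open>Path-dependent metabasins\<close>

text \<open>
  Here \<open>x\<close> is a trajectory, of which only \<open>x 0, \<dots>, x T\<close> matters. For \<open>k > T\<close> the set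
  \<open>x ` {k..T}\<close> is empty, so the least \<open>k\<close> always exists.
\<close>

primrec chi :: "nat \<Rightarrow> (nat \<Rightarrow> 's) \<Rightarrow> nat \<Rightarrow> nat" where
  "chi T x 0 = 0"
| "chi T x (Suc n) = (LEAST k. k > chi T x n \<and> x ` {k..T} \<inter> x ` {..<k} = {})"

definition upsilon :: "nat \<Rightarrow> (nat \<Rightarrow> 's) \<Rightarrow> nat" where
  "upsilon T x = Sup {n. chi T x n \<le> T}"

definition pd_metabasin :: "nat \<Rightarrow> (nat \<Rightarrow> 's) \<Rightarrow> nat \<Rightarrow> 's set" where
  "pd_metabasin T x n = x ` {chi T x n..<chi T x (Suc n)}"

definition pd_metabasin_of :: "nat \<Rightarrow> (nat \<Rightarrow> 's) \<Rightarrow> 's \<Rightarrow> 's set" where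
  "pd_metabasin_of T x s =
     (if s \<in> x ` {..T}
      then pd_metabasin T x (THE n. n \<le> upsilon T x \<and> s \<in> pd_metabasin T x n)
      else {})"


section \<open>The energy landscape\<close>

text \<open>
  All notions below depend only on the energy, the graph of possible transitions and the labelling
  \<open>lm 1, \<dots>, lm num_min\<close> of the local minima (see \<open>scoppola_labelling\<close>).
  Levels start at 1, except that level 0 of the filtration is the whole state space.
\<close>

locale landscape =
  fixes E :: "'s::finite \<Rightarrow> real"
    and adj :: "'s \<Rightarrow> 's \<Rightarrow> bool"
    and lm :: "nat \<Rightarrow> 's"
begin

definition neighbour :: "'s \<Rightarrow> 's \<Rightarrow> bool" where
  "neighbour r s \<longleftrightarrow> r \<noteq> s \<and> adj r s"

definition nbhd :: "'s \<Rightarrow> 's set" where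
  "nbhd r = {y. adj r y}"

definition outer_boundary :: "'s set \<Rightarrow> 's set" where
  "outer_boundary V = {s. s \<notin> V \<and> (\<exists>v\<in>V. neighbour v s)}"

subsection \<open>Essential saddles\<close>

definition paths :: "'s \<Rightarrow> 's \<Rightarrow> 's list set" where
  "paths r s = {g. g \<noteq> [] \<and> hd g = r \<and> last g = s \<and> distinct g \<and> successively adj g}"

definition minimal_path :: "'s \<Rightarrow> 's \<Rightarrow> 's list \<Rightarrow> bool" where
  "minimal_path r s g \<longleftrightarrow>
     g \<in> paths r s \<and> (\<forall>h\<in>paths r s. Max (E ` set g) \<le> Max (E ` set h))"

definition ess_saddle :: "'s \<Rightarrow> 's \<Rightarrow> 's" where
  "ess_saddle r s =
     (if r = s then s
      else (THE z. \<exists>g. minimal_path r s g \<and> z \<in> set g \<and> E z = Max (E ` set g)))"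

definition climb :: "'s list \<Rightarrow> real" where
  "climb g = (\<Sum>l\<in>{1..<length g}. max 0 (E (g ! l) - E (g ! (l - 1))))"

subsection \<open>Metastable states\<close>

definition local_minima :: "'s set" where
  "local_minima = {s. \<forall>r. neighbour r s \<longrightarrow> E s < E r}"

definition num_min :: nat where
  "num_min = card local_minima"

definition metastable :: "nat \<Rightarrow> 's set" where
  "metastable i = (if i = 0 then UNIV else lm ` {i..num_min})"

definition activation :: "'s \<Rightarrow> 's \<Rightarrow> real" where
  "activation s t = (INF g\<in>paths s t. climb g)"

definition exit_activation :: "nat \<Rightarrow> 's \<Rightarrow> real" where
  "exit_activation i a = Min (activation a ` (metastable i - {a}))"

text \<open>
  The minimum deleted in step \<open>i\<close> is one with minimal activation energy; in the case
  of a tie any of the minimizers may be the deleted one.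
\<close>

definition scoppola_labelling :: bool where
  "scoppola_labelling \<longleftrightarrow>
     bij_betw lm {1..num_min} local_minima \<and>
     (\<forall>i\<in>{1..<num_min}. is_arg_min (exit_activation i) (\<lambda>a. a \<in> metastable i) (lm i))"

subsection \<open>Attraction and valleys\<close>

definition strict_valley :: "nat \<Rightarrow> 's \<Rightarrow> 's set" where
  "strict_valley i a =
     {s. \<forall>b\<in>metastable i - {a}. E (ess_saddle s a) < E (ess_saddle s b)}"

definition attracted :: "nat \<Rightarrow> 's \<Rightarrow> 's \<Rightarrow> bool" where
  "attracted i s a \<longleftrightarrow>
     a \<in> metastable i \<and>
     E (ess_saddle s a) = Min ((\<lambda>b. E (ess_saddle s b)) ` metastable i) \<and>
     (\<forall>b\<in>metastable i - {a}. E (ess_saddle s b) = E (ess_saddle s a) \<longrightarrow>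
        (\<forall>g. minimal_path s b g \<longrightarrow> set g \<inter> strict_valley i a \<noteq> {}))"

definition attr_level :: "nat \<Rightarrow> enat" where
  "attr_level i =
     Inf (enat ` {j. i < j \<and> j \<le> num_min \<and> (\<exists>a\<in>metastable j. attracted j (lm i) a)})"

text \<open>
  \<open>valley i a\<close> is meant for \<open>1 \<le> i\<close> and \<open>a \<in> metastable i\<close>. The complement in the last equation is
  \<open>unassigned (Suc n)\<close> below; the restriction \<open>j < Suc (Suc n)\<close> follows from \<open>j < attr_level j\<close> and
  is spelled out for termination only.
\<close>

fun valley :: "nat \<Rightarrow> 's \<Rightarrow> 's set" where
  "valley 0 a = {}"
| "valley (Suc 0) a = {s. attracted 1 s a}"
| "valley (Suc (Suc n)) a =
     valley (Suc n) a \<union>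
     {s \<in> - (\<Union>j\<in>{1..num_min}. valley (min (Suc n) j) (lm j)). attracted (Suc (Suc n)) s a} \<union>
     (\<Union>j\<in>{j\<in>{1..num_min}. j < Suc (Suc n) \<and> attr_level j = enat (Suc (Suc n)) \<and>
               attracted (Suc (Suc n)) (lm j) a}. valley j (lm j))"

definition unassigned :: "nat \<Rightarrow> 's set" where
  "unassigned i = - (\<Union>j\<in>{1..num_min}. valley (min i j) (lm j))"

subsection \<open>Aggregation\<close>

definition agg_states :: "nat \<Rightarrow> 's set" where
  "agg_states i = {lm j | j. j \<in> {1..num_min} \<and> attr_level j > enat i} \<union> unassigned i"

definition agg_minima :: "nat \<Rightarrow> 's set" where
  "agg_minima i = agg_states i - unassigned i"

definition label :: "'s \<Rightarrow> nat" where
  "label s = (THE j. j \<in> {1..num_min} \<and> lm j = s)"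

text \<open>The set \<open>V\<^sup>(\<^sup>i\<^sup>)(s)\<close> for an arbitrary \<open>s \<in> agg_states i\<close>.\<close>

definition basin :: "nat \<Rightarrow> 's \<Rightarrow> 's set" where
  "basin i s = (if s \<in> unassigned i then {s} else valley (min i (label s)) s)"

definition agg :: "nat \<Rightarrow> 's \<Rightarrow> 's" where
  "agg i x = (THE s. s \<in> agg_states i \<and> x \<in> basin i s)"

text \<open>
  The jump times \<open>\<sigma>\<^sub>n\<close> along a trajectory \<open>x\<close>. For an irreducible chain the set of
  candidates is almost surely nonempty as soon as there are two basins; on the exceptional null set
  the value of \<open>LEAST\<close> is arbitrary.
\<close>

primrec jump_time :: "nat \<Rightarrow> (nat \<Rightarrow> 's) \<Rightarrow> nat \<Rightarrow> nat" where
  "jump_time i x 0 = 0"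
| "jump_time i x (Suc n) =
     (LEAST k. k > jump_time i x n \<and> agg i (x k) \<noteq> agg i (x (k - 1)))"

definition agg_chain :: "nat \<Rightarrow> (nat \<Rightarrow> 's) \<Rightarrow> nat \<Rightarrow> 's" where
  "agg_chain i x n = agg i (x (jump_time i x n))"

definition exit_state :: "nat \<Rightarrow> 's \<Rightarrow> 's" where
  "exit_state i a = arg_min_on E (outer_boundary (basin i a))"

text \<open>The strict valleys of order \<open>i\<close>, extended to the non-assigned states.\<close>

definition strict_basin :: "nat \<Rightarrow> 's \<Rightarrow> 's set" where
  "strict_basin i s = (if s \<in> unassigned i then {s} else strict_valley i s)"

subsection \<open>Metabasins\<close>

definition uphill_downhill_path :: "'s \<Rightarrow> 's \<Rightarrow> 's list \<Rightarrow> bool" where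
  "uphill_downhill_path r s g \<longleftrightarrow>
     minimal_path r s g \<and> climb g = E (ess_saddle r s) - E r"

definition MB1 :: "nat \<Rightarrow> real \<Rightarrow> 's \<Rightarrow> bool" where
  "MB1 i \<epsilon> a \<longleftrightarrow>
     (SUP b\<in>agg_minima i - {a}. E (ess_saddle a b)) - E (exit_state i a) \<le> \<epsilon>"

definition MB2 :: "nat \<Rightarrow> 's \<Rightarrow> bool" where
  "MB2 i a \<longleftrightarrow>
     (\<exists>m1 m2. m1 \<noteq> m2 \<and> {m1, m2} \<subseteq> agg_minima i - {a} \<and>
        (\<forall>b\<in>{m1, m2}. \<exists>g. uphill_downhill_path (exit_state i a) b g \<and>
           (\<forall>n\<in>agg_minima i - {b}. set g \<inter> basin i n = {})))"

definition has_metabasins :: "nat \<Rightarrow> real \<Rightarrow> bool" where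
  "has_metabasins i \<epsilon> \<longleftrightarrow>
     1 \<le> i \<and> i < num_min - 1 \<and> (\<forall>a\<in>agg_minima i. MB1 i \<epsilon> a \<and> MB2 i a)"

text \<open>
  In the presence of metabasins the minima below are over nonempty sets: by MB2 each
  \<open>exit_state i a\<close> is non-assigned.
\<close>

definition eta1 :: "nat \<Rightarrow> real \<Rightarrow> nat" where
  "eta1 i \<epsilon> = Min {card {s \<in> nbhd n - basin i r. E s \<le> E n + \<epsilon>} | n r.
     n \<in> unassigned i \<and> r \<in> agg_states i \<and> basin i r \<inter> nbhd n \<noteq> {}}"

definition eta2 :: "nat \<Rightarrow> real \<Rightarrow> nat" where
  "eta2 i \<epsilon> = Min ((\<lambda>a. card {s \<in> outer_boundary (basin i a). E s \<le> E (exit_state i a) + \<epsilon>})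
     ` agg_minima i)"

definition eta3 :: "nat \<Rightarrow> real \<Rightarrow> nat" where
  "eta3 i \<epsilon> = Min ((\<lambda>n. card {s \<in> agg_states i. \<exists>x\<in>basin i s \<inter> nbhd n. E x \<le> E n + \<epsilon>})
     ` unassigned i)"

subsection \<open>Error terms\<close>

text \<open>The parameter \<open>c\<close> is the function \<open>\<beta> \<mapsto> \<gamma>\<^sub>\<beta>\<close>.\<close>

definition err_const :: "(real \<Rightarrow> real) \<Rightarrow> real \<Rightarrow> real" where
  "err_const c \<beta> =
     real (card (UNIV :: 's set)) * real (MAX r. card (nbhd r)) *
     (real (card (UNIV :: 's set)) *
        exp (- \<beta> * (Min {E a - E b | a b. a \<noteq> b \<and> E a > E b} - 2 * c \<beta>)) + 1)"

definition err :: "(real \<Rightarrow> real) \<Rightarrow> 's \<Rightarrow> 's \<Rightarrow> 's \<Rightarrow> real \<Rightarrow> real" where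
  "err c x y z \<beta> =
     err_const c \<beta> * exp (- \<beta> * (E (ess_saddle x z) - E (ess_saddle x y) - 7 * c \<beta>))"

definition err_tilde :: "(real \<Rightarrow> real) \<Rightarrow> nat \<Rightarrow> 's \<Rightarrow> 's \<Rightarrow> 's \<Rightarrow> real \<Rightarrow> real" where
  "err_tilde c i x a y \<beta> =
     (if E (ess_saddle x y) > E (ess_saddle x a) then err c x a y \<beta>
      else (\<Sum>z\<in>{z. E z > E (ess_saddle x y)}. err c x y z \<beta>) +
           (\<Sum>z\<in>strict_valley i a. err c z a y \<beta>))"

definition delta_err :: "(real \<Rightarrow> real) \<Rightarrow> nat \<Rightarrow> 's \<Rightarrow> real \<Rightarrow> real" where
  "delta_err c i a \<beta> =
     Max ((\<lambda>x. \<Sum>z\<in>outer_boundary (basin i a). err_tilde c i x a z \<beta>) ` basin i a)"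

definition max_delta_err :: "(real \<Rightarrow> real) \<Rightarrow> nat \<Rightarrow> real \<Rightarrow> real" where
  "max_delta_err c i \<beta> = Max ((\<lambda>a. delta_err c i a \<beta>) ` agg_minima i)"

subsection \<open>Path-dependent metabasins up to a jump time\<close>

text \<open>
  The path-dependent metabasin of \<open>Y\<^sub>j\<close> for the time horizon \<open>T = \<sigma>\<^sub>K\<close>, along a trajectory \<open>x\<close>.
\<close>

definition pd_basin :: "nat \<Rightarrow> nat \<Rightarrow> (nat \<Rightarrow> 's) \<Rightarrow> nat \<Rightarrow> 's set" where
  "pd_basin i K x j = pd_metabasin_of (jump_time i x K) x (agg_chain i x j)"

definition covers_strict_basin :: "nat \<Rightarrow> nat \<Rightarrow> nat \<Rightarrow> (nat \<Rightarrow> 's) \<Rightarrow> bool" where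
  "covers_strict_basin i K k x \<longleftrightarrow> strict_basin i (agg_chain i x k) \<subseteq> pd_basin i K x k"

definition stays_in_basins :: "nat \<Rightarrow> nat \<Rightarrow> nat \<Rightarrow> (nat \<Rightarrow> 's) \<Rightarrow> bool" where
  "stays_in_basins i K k x \<longleftrightarrow> (\<forall>j<k. pd_basin i K x j \<subseteq> basin i (agg_chain i x j))"

end

end

theory Submission
  imports Defs
begin

text \<open>
  To leave a basin before visiting its minimum, the chain has to prefer a high saddle to a lower one.
  For a reversible chain, comparing a harmonic function with its truncations bounds the probability
  of this by a ratio of conductances. The constant
  \<open>7\<close> in the error term leaves room for a factor \<open>exp (3 * \<beta> * \<gamma> \<beta>)\<close>, which for large \<open>\<beta>\<close> absorbs all
  combinatorial constants. On a visit to a basin the chain therefore runs from the minimum through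
  the strict valley and back to the minimum with the probability claimed in (a), and these states
  lie in the same path-dependent metabasin.

  The bounds in (b) and (c) are exponentially small in \<open>\<beta>\<close> or trivial, so a single path of the aggregated
  chain suffices for each. An aggregated step costs at most \<open>\<epsilon>\<close> in energy beyond the drop available, while the
  claims allow \<open>2 * \<epsilon>\<close> per step; the difference absorbs all prefactors. For (b) only \<open>k = 1\<close> is not
  trivial, and a path that never returns to the first basin is chosen greedily. For (c) a self-avoiding
  path is needed: it is extended greedily and, where a minimum has one neighbour too few, rotated as
  in Posa's lemma.
\<close>

section \<open>Communication heights\<close>

text \<open>Valleys are defined by recursion over the levels, whereas the estimates need to know
  which states a basin contains and how it can be left. The link is \<open>atr_attractor\<close>: if
  a state has an attractor at one level and another at a later level, then the second attracts the
  first at the later level. Following merged minima therefore leads an assigned state to one owner,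
  whatever level it was attracted at. Saddle heights form an ultrametric, and
  \<open>hgt x y \<le> c\<close> means connectivity inside a sublevel set, so no saddle has to be
  handled as a state. A basin made of several absorbed valleys need not be a ball around its
  minimum, and parts of its boundary may be no higher than the way to the minimum. Comparing two
  heights is then not enough to bound the escape; \<open>basin_rank\<close> orders the absorbed
  valleys so that an induction closes the gap. The stationary distribution is only known to be close
  to a Gibbs measure. The resulting uncertainty of the conductances is a factor
  \<open>exp (2 * \<beta> * \<gamma> \<beta>)\<close>, which enters the hitting estimate squared;
  this is where 4 of the 7 in the error term go.\<close>

locale landscape_graph = landscape E adj lm
  for E :: "'s::finite \<Rightarrow> real" and adj :: "'s \<Rightarrow> 's \<Rightarrow> bool" and lm :: "nat \<Rightarrow> 's" +
  assumes E_inj: "inj E"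
    and irreducible: "adj\<^sup>*\<^sup>* r s"
    and adj_refl: "adj s s"
    and adj_sym: "adj r s \<Longrightarrow> adj s r"
    and lm_bij: "bij_betw lm {1..num_min} local_minima"
begin

text \<open>Minimal paths are self-avoiding lists, which concatenate badly. Connectivity inside a
  set of states is transitive, and the set can be cut and enlarged; statements on paths are moved to
  \<open>conn\<close> and back by \<open>path_conn\<close> and \<open>conn_path\<close>.\<close>

inductive conn :: "'s set \<Rightarrow> 's \<Rightarrow> 's \<Rightarrow> bool" for S where
  conn_base: "x \<in> S \<Longrightarrow> conn S x x"
| conn_step: "conn S x y \<Longrightarrow> adj y z \<Longrightarrow> z \<in> S \<Longrightarrow> conn S x z"

lemma conn_in: "conn S x y \<Longrightarrow> x \<in> S \<and> y \<in> S"
  by (induction rule: conn.induct) auto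

lemma conn_trans: assumes "conn S x y" "conn S y z" shows "conn S x z"
  using assms(2,1) by (induction rule: conn.induct) (auto intro: conn_step)

lemma conn_adj: "x \<in> S \<Longrightarrow> y \<in> S \<Longrightarrow> adj x y \<Longrightarrow> conn S x y"
  by (meson conn_base conn_step)

lemma conn_sym: "conn S x y \<Longrightarrow> conn S y x"
proof (induction rule: conn.induct)
  case (conn_step x y z)
  then show ?case by (meson conn_adj conn_in conn_trans adj_sym)
qed (rule conn_base)

lemma conn_mono: "conn S x y \<Longrightarrow> S \<subseteq> T \<Longrightarrow> conn T x y"
  by (induction rule: conn.induct) (auto intro: conn_base conn_step)

lemma conn_UNIV: "conn UNIV x y"
  using irreducible[of x y] by (induction rule: rtranclp_induct) (auto intro: conn_base conn_step)

text \<open>The predecessor \<open>v\<close> is recorded because the walk up to \<open>v\<close>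
  avoids \<open>A\<close> altogether: the walk to \<open>w\<close> meets \<open>A\<close> in its
  last state only.\<close>

lemma conn_first:
  assumes "conn S x y" "x \<notin> A"
  shows "conn (S - A) x y \<or> (\<exists>v w. conn (S - A) x v \<and> adj v w \<and> w \<in> A \<inter> S \<and> conn S x w)"
  using assms
proof (induction rule: conn.induct)
  case (conn_base x) then show ?case by (auto intro: conn.conn_base)
next
  case (conn_step x y z)
  then show ?case
    by (metis (no_types, lifting) Diff_iff IntI conn.conn_step)
qed

lemma conn_split:
  assumes "conn S x y"
  shows "conn (S - A) x y \<or> (\<exists>w. w \<in> A \<inter> S \<and> conn S x w)"
  using conn_first[OF assms, of A] conn_base conn_in[OF assms] by (cases "x \<in> A") auto

lemma conn_restrict:
  assumes "conn S x y" "\<And>w. conn S x w \<Longrightarrow> w \<in> T"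
  shows "conn (S \<inter> T) x y"
  using assms
proof (induction rule: conn.induct)
  case (conn_base x) then show ?case by (meson Int_iff conn.conn_base)
next
  case (conn_step x y z) then show ?case by (meson Int_iff conn.conn_step)
qed

lemma path_conn:
  assumes "successively adj g" "g \<noteq> []" "set g \<subseteq> S"
  shows "conn S (hd g) (last g)"
  using assms
proof (induction g)
  case (Cons a g)
  show ?case
  proof (cases "g = []")
    case True then show ?thesis using Cons by (auto intro: conn_base)
  next
    case False
    with Cons have "conn S (hd g) (last g)" "adj a (hd g)" "a \<in> S" "hd g \<in> S"
      by (auto simp: successively_Cons)
    then show ?thesis using False by (auto intro: conn_trans conn_adj)
  qed
qed simp

text \<open>Loops are erased while the walk is built: a state that is already on the list cuts the
  list back to that state.\<close>

lemma conn_path: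
  assumes "conn S x y" shows "\<exists>g \<in> paths x y. set g \<subseteq> S"
  using assms
proof (induction rule: conn.induct)
  case (conn_base x) then show ?case by (intro bexI[of _ "[x]"]) (auto simp: paths_def)
next
  case (conn_step x y z)
  then obtain g where g: "g \<in> paths x y" "set g \<subseteq> S" by auto
  show ?case
  proof (cases "z \<in> set g")
    case False
    then have "g @ [z] \<in> paths x z" using g(1) conn_step(2)
      by (auto simp: paths_def successively_append_iff)
    then show ?thesis using g conn_step(3) by (intro bexI[of _ "g @ [z]"]) auto
  next
    case True
    then obtain us vs where e: "g = us @ z # vs" by (meson split_list)
    then have "us @ [z] \<in> paths x z" using g(1)
      by (auto simp: paths_def successively_append_iff hd_append split: if_splits)
    then show ?thesis using g(2) e by (intro bexI[of _ "us @ [z]"]) auto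
  qed
qed

lemma finite_paths: "finite (paths x y)"
proof -
  have "paths x y \<subseteq> {g. set g \<subseteq> UNIV \<and> distinct g}" by (auto simp: paths_def)
  then show ?thesis using finite_subset[OF _ finite_subset_distinct[of "UNIV :: 's set"]] by auto
qed

lemma paths_nonempty: "paths x y \<noteq> {}"
  using conn_path[OF conn_UNIV, of x y] by auto

section \<open>Saddle heights as an ultrametric\<close>

definition hgt :: "'s \<Rightarrow> 's \<Rightarrow> real" where "hgt x y = E (ess_saddle x y)"

lemma paths_self: "g \<in> paths x x \<Longrightarrow> g = [x]"
proof -
  assume g: "g \<in> paths x x"
  then obtain t where t: "g = x # t" by (cases g) (auto simp: paths_def)
  then show ?thesis using g last_in_set[of t] by (auto simp: paths_def split: if_splits)
qed

text \<open>There are finitely many self-avoiding paths, so a minimal one exists; by injectivity of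
  \<open>E\<close> all minimal paths share their highest state, and the \<open>THE\<close> in
  \<open>ess_saddle\<close> denotes it.\<close>

lemma minimal_path_iff:
  "minimal_path x y g \<longleftrightarrow> g \<in> paths x y \<and> Max (E ` set g) = hgt x y"
  and minimal_path_exists: "\<exists>g. minimal_path x y g"
proof -
  have ex: "\<exists>g. minimal_path x y g" for x y
  proof -
    obtain g where "is_arg_min (\<lambda>g. Max (E ` set g)) (\<lambda>g. g \<in> paths x y) g"
      using ex_is_arg_min_if_finite[OF finite_paths paths_nonempty] by blast
    then show ?thesis unfolding minimal_path_def is_arg_min_def by (metis linorder_not_less)
  qed
  show "\<exists>g. minimal_path x y g" by (rule ex)
  have val: "Max (E ` set g) = hgt x y" if g: "minimal_path x y g" for g
  proof (cases "x = y")
    case True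
    then have "g = [y]" using g paths_self unfolding minimal_path_def by blast
    then show ?thesis using True unfolding hgt_def ess_saddle_def by simp
  next
    case False
    have ne: "set h \<noteq> {}" if "minimal_path x y h" for h using that by (auto simp: minimal_path_def paths_def)
    have eq: "Max (E ` set h) = Max (E ` set g)" if "minimal_path x y h" for h
      using that g by (auto simp: minimal_path_def intro: antisym)
    have "Max (E ` set g) \<in> E ` set g" using ne[OF g] by (intro Max_in) auto
    then obtain z where z: "z \<in> set g" "E z = Max (E ` set g)" by force
    have "ess_saddle x y = z"
      unfolding ess_saddle_def using False
    proof (simp, intro the_equality)
      show "\<exists>g. minimal_path x y g \<and> z \<in> set g \<and> E z = Max (E ` set g)" using z g by auto
      show "z' = z" if zz: "\<exists>g. minimal_path x y g \<and> z' \<in> set g \<and> E z' = Max (E ` set g)" for z'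
      proof -
        obtain g' where "minimal_path x y g'" "E z' = Max (E ` set g')" using zz by blast
        then have "E z' = E z" using eq z by simp
        then show ?thesis using E_inj by (simp add: inj_eq)
      qed
    qed
    then show ?thesis using z hgt_def by simp
  qed
  show "minimal_path x y g \<longleftrightarrow> g \<in> paths x y \<and> Max (E ` set g) = hgt x y"
  proof
    assume g: "minimal_path x y g"
    then have "g \<in> paths x y" unfolding minimal_path_def by blast
    then show "g \<in> paths x y \<and> Max (E ` set g) = hgt x y" using val[OF g] by blast
  next
    assume g: "g \<in> paths x y \<and> Max (E ` set g) = hgt x y"
    obtain h where h: "minimal_path x y h" using ex by blast
    have "Max (E ` set g) = Max (E ` set h)" using g val[OF h] by simp
    then show "minimal_path x y g" using g h by (simp add: minimal_path_def)
  qed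
qed

abbreviation sub :: "real \<Rightarrow> 's set" where "sub c \<equiv> {s. E s \<le> c}"

text \<open>The minimax over paths becomes the least level at which a sublevel set joins the two
  states. Heights are mostly handled in this form below.\<close>

lemma hgt_le_iff: "hgt x y \<le> c \<longleftrightarrow> conn (sub c) x y"
proof
  assume c: "hgt x y \<le> c"
  obtain g where "minimal_path x y g" using minimal_path_exists by blast
  then have g: "g \<in> paths x y" "Max (E ` set g) \<le> c" using c by (auto simp: minimal_path_iff)
  then have "set g \<subseteq> sub c" by (auto simp: paths_def)
  then show "conn (sub c) x y" using path_conn[of g "sub c"] g by (auto simp: paths_def)
next
  assume "conn (sub c) x y"
  then obtain g where g: "g \<in> paths x y" "set g \<subseteq> sub c" using conn_path by blast
  obtain h where h: "minimal_path x y h" using minimal_path_exists by blast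
  then have "hgt x y \<le> Max (E ` set g)" using g h minimal_path_iff[of x y h] minimal_path_def[of x y h] by metis
  also have "\<dots> \<le> c" using g by (subst Max_le_iff) (auto simp: paths_def)
  finally show "hgt x y \<le> c" .
qed

lemma conn_hgt: "conn (sub (hgt x y)) x y" using hgt_le_iff by blast

lemma hgt_sym: "hgt x y = hgt y x"
proof (rule antisym)
  show "hgt x y \<le> hgt y x" using conn_sym[OF conn_hgt[of y x]] by (simp only: hgt_le_iff)
  show "hgt y x \<le> hgt x y" using conn_sym[OF conn_hgt[of x y]] by (simp only: hgt_le_iff)
qed

lemma hgt_ultra: "hgt x z \<le> max (hgt x y) (hgt y z)"
proof -
  let ?m = "max (hgt x y) (hgt y z)"
  have "conn (sub ?m) x y" "conn (sub ?m) y z" by (auto simp flip: hgt_le_iff)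
  then show ?thesis using conn_trans hgt_le_iff by blast
qed

lemma hgt_ge: "E x \<le> hgt x y" "E y \<le> hgt x y"
  using conn_in[OF conn_hgt[of x y]] by auto

lemma hgt_self: "hgt x x = E x"
  by (simp add: hgt_def ess_saddle_def)

lemma hgt_adj: "adj x y \<Longrightarrow> hgt x y = max (E x) (E y)"
proof (rule antisym)
  assume "adj x y"
  then show "hgt x y \<le> max (E x) (E y)" by (subst hgt_le_iff) (rule conn_adj, auto)
qed (use hgt_ge in auto)

text \<open>The isosceles property of an ultrametric: the two largest sides of a triangle are
  equal.\<close>

lemma hgt_less_trans: "hgt x y < hgt y z \<Longrightarrow> hgt x z = hgt y z"
  using hgt_ultra[of x z y] hgt_ultra[of y z x] hgt_sym[of x y] by auto

section \<open>Attraction relative to a set of minima\<close>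

definition strict :: "'s set \<Rightarrow> 's \<Rightarrow> 's set" where
  "strict M a = {s. \<forall>b\<in>M - {a}. hgt s a < hgt s b}"

text \<open>A level enters only through the set \<open>M\<close>, so that attraction at different
  levels can be compared for nested sets. The restriction to ties disappears because a minimum
  \<open>b\<close> at a greater height is not joined to \<open>s\<close> inside the sublevel set
  anyway.\<close>

definition atr :: "'s set \<Rightarrow> 's \<Rightarrow> 's \<Rightarrow> bool" where
  "atr M s a \<longleftrightarrow> a \<in> M \<and> (\<forall>b\<in>M. hgt s a \<le> hgt s b) \<and>
     (\<forall>b\<in>M - {a}. \<not> conn (sub (hgt s a) - strict M a) s b)"

lemma strict_valley_eq: "strict_valley l a = strict (metastable l) a"
  by (simp add: strict_valley_def strict_def hgt_def)

lemma attracted_iff: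
  assumes "metastable l \<noteq> {}"
  shows "attracted l s a \<longleftrightarrow> atr (metastable l) s a"
proof -
  let ?M = "metastable l"
  have min: "hgt s a = Min ((\<lambda>b. hgt s b) ` ?M) \<longleftrightarrow> (\<forall>b\<in>?M. hgt s a \<le> hgt s b)" if "a \<in> ?M"
    using that by (subst eq_Min_iff) auto
  have path: "(\<forall>g. minimal_path s b g \<longrightarrow> set g \<inter> strict ?M a \<noteq> {}) \<longleftrightarrow>
     \<not> conn (sub (hgt s a) - strict ?M a) s b" if e: "hgt s b = hgt s a" for b
  proof -
    have "(\<exists>g. minimal_path s b g \<and> set g \<inter> strict ?M a = {}) \<longleftrightarrow> conn (sub (hgt s a) - strict ?M a) s b"
    proof
      assume "\<exists>g. minimal_path s b g \<and> set g \<inter> strict ?M a = {}"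
      then obtain g where g: "g \<in> paths s b" "Max (E ` set g) = hgt s a" "set g \<inter> strict ?M a = {}"
        using e minimal_path_iff by auto
      then have "E v \<le> hgt s a" if "v \<in> set g" for v
        using that Max_ge[of "E ` set g" "E v"] by auto
      then have "set g \<subseteq> sub (hgt s a) - strict ?M a" using g by auto
      then show "conn (sub (hgt s a) - strict ?M a) s b"
        using path_conn[of g] g by (auto simp: paths_def)
    next
      assume "conn (sub (hgt s a) - strict ?M a) s b"
      then obtain g where g: "g \<in> paths s b" "set g \<subseteq> sub (hgt s a) - strict ?M a" using conn_path by blast
      then have "Max (E ` set g) \<le> hgt s b" using e by (subst Max_le_iff) (auto simp: paths_def)
      moreover have "hgt s b \<le> Max (E ` set g)"
        using g(1) minimal_path_exists[of s b] minimal_path_iff[of s b] minimal_path_def[of s b] by metis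
      ultimately show "\<exists>g. minimal_path s b g \<and> set g \<inter> strict ?M a = {}"
        using g minimal_path_iff[of s b g] by (intro exI[of _ g]) auto
    qed
    then show ?thesis by blast
  qed
  show ?thesis
  proof (cases "a \<in> ?M")
    case True
    have far: "\<not> conn (sub (hgt s a) - strict ?M a) s b" if "hgt s a < hgt s b" for b
      using that conn_mono[of _ s b "sub (hgt s a)"] hgt_le_iff[of s b "hgt s a"] by (meson Diff_subset leD)
    have "attracted l s a \<longleftrightarrow> (\<forall>b\<in>?M. hgt s a \<le> hgt s b) \<and>
     (\<forall>b\<in>?M - {a}. hgt s b = hgt s a \<longrightarrow> \<not> conn (sub (hgt s a) - strict ?M a) s b)"
      unfolding attracted_def hgt_def[symmetric] strict_valley_eq using True min path by auto
    then show ?thesis unfolding atr_def using True far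
      by (metis Diff_iff antisym_conv2)
  qed (simp add: attracted_def atr_def)
qed

text \<open>By the isosceles property the heights to the other minima may be measured from
  \<open>a\<close> instead of \<open>s\<close>. The strict valley is thus a ball around
  \<open>a\<close>, which yields \<open>strict_closed\<close> and
  \<open>strict_conn\<close>.\<close>

lemma strict_iff: "s \<in> strict M a \<longleftrightarrow> (\<forall>b\<in>M - {a}. hgt s a < hgt a b)"
proof -
  have "hgt s a < hgt s b \<longleftrightarrow> hgt s a < hgt a b" for b
    using hgt_less_trans[of s a b] hgt_less_trans[of a s b] hgt_sym[of s a] by fastforce
  then show ?thesis by (simp add: strict_def)
qed

lemma strict_antimono: "M' \<subseteq> M \<Longrightarrow> strict M a \<subseteq> strict M' a"
  by (auto simp: strict_def)

lemma strict_closed: "w \<in> strict M a \<Longrightarrow> hgt v a \<le> hgt w a \<Longrightarrow> v \<in> strict M a"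
  unfolding strict_iff by (meson le_less_trans)

lemma strict_conn: assumes "w \<in> strict M a" shows "conn (sub (hgt w a) \<inter> strict M a) w a"
proof (rule conn_restrict[OF conn_hgt])
  fix v assume "conn (sub (hgt w a)) w v"
  then have "hgt w v \<le> hgt w a" by (simp add: hgt_le_iff)
  then have "hgt v a \<le> hgt w a" using hgt_ultra[of v a w] hgt_sym[of v w] by simp
  then show "v \<in> strict M a" using assms strict_closed by blast
qed

lemma strict_imp_atr:
  assumes "a \<in> M" "s \<in> strict M a" shows "atr M s a"
  unfolding atr_def
proof (intro conjI ballI)
  show "hgt s a \<le> hgt s b" if "b \<in> M" for b
    using that assms(2) by (cases "b = a") (auto simp: strict_def intro: less_imp_le)
  show "\<not> conn (sub (hgt s a) - strict M a) s b" for b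
    using conn_in assms(2) by blast
qed (rule assms)

lemma local_minima_hgt:
  assumes "a \<in> local_minima" "b \<noteq> a" shows "E a < hgt a b"
proof (rule ccontr)
  assume "\<not> ?thesis"
  then have "conn (sub (E a)) a b" by (simp flip: hgt_le_iff)
  moreover have "y = x" if "conn S x y" "S = sub (E x)" "x \<in> local_minima" for S x y
    using that
  proof (induction rule: conn.induct)
    case (conn_step x y z)
    then have "y = x" "z \<in> sub (E x)" by blast+
    then have "adj x z" "E z \<le> E x" using conn_step by auto
    moreover have "E x < E z" if "x \<noteq> z" "adj x z"
      using conn_step that adj_sym by (simp add: local_minima_def neighbour_def)
    ultimately show ?case by force
  qed simp
  ultimately show False using assms by blast
qed

lemma local_min_strict: "M \<subseteq> local_minima \<Longrightarrow> a \<in> M \<Longrightarrow> a \<in> strict M a"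
  unfolding strict_iff hgt_self using local_minima_hgt by blast

lemma atr_self: "M \<subseteq> local_minima \<Longrightarrow> a \<in> M \<Longrightarrow> atr M a a"
  by (simp add: local_min_strict strict_imp_atr)

lemma atr_min_self:
  assumes "M \<subseteq> local_minima" "a \<in> M" "atr M a c" shows "c = a"
proof (rule ccontr)
  assume "c \<noteq> a"
  then have "E a < hgt a c" using assms local_minima_hgt by blast
  moreover have "hgt a c \<le> hgt a a" using assms by (simp add: atr_def)
  ultimately show False by (simp add: hgt_self)
qed

text \<open>A state of the strict valley of \<open>c\<close> on an optimal way from \<open>x\<close>
  to \<open>b\<close> would be nearer to \<open>c\<close> than to \<open>b\<close>, and then
  \<open>c\<close> would be no farther from \<open>x\<close> than \<open>b\<close> is.\<close>

lemma conn_avoids_strict: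
  assumes "hgt x b < hgt x c" "b \<in> M - {c}"
  shows "conn (sub (hgt x b) - strict M c) x b"
proof (rule ccontr)
  assume "\<not> ?thesis"
  then obtain w where w: "w \<in> strict M c" "conn (sub (hgt x b)) x w"
    using conn_split[OF conn_hgt] by blast
  then have "conn (sub (hgt x b)) w b" using conn_trans conn_sym conn_hgt by blast
  then have "hgt w b \<le> hgt x b" "hgt x w \<le> hgt x b" using w by (simp_all add: hgt_le_iff)
  moreover have "hgt w c < hgt w b" using w assms by (auto simp: strict_def)
  ultimately show False using hgt_ultra[of x c w] assms by simp
qed

text \<open>The states \<open>x\<close> and \<open>c\<close> are joined strictly below the height of
  \<open>c'\<close>. If this junction avoids the strict valley of \<open>c'\<close>, an escape of
  \<open>x\<close> becomes an escape of \<open>c\<close>; if it meets the valley, the ball property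
  puts \<open>x\<close> into the valley. Here \<open>c\<close> may be any state, for instance a
  minimum that is no longer in \<open>M\<close>.\<close>

lemma atr_transfer:
  assumes "atr M c c'" "hgt x c < hgt x c'"
  shows "atr M x c'"
proof -
  let ?\<mu> = "hgt x c'"
  have eq: "hgt c c' = ?\<mu>" using hgt_less_trans[of c x c'] assms(2) hgt_sym[of c x] by simp
  have c': "c' \<in> M" using assms by (simp add: atr_def)
  have le: "?\<mu> \<le> hgt x b" if "b \<in> M" for b
  proof -
    have "?\<mu> \<le> hgt c b" using that assms(1) eq by (auto simp: atr_def)
    then show ?thesis using hgt_ultra[of c b x] assms(2) hgt_sym[of c x] by simp
  qed
  have "\<not> conn (sub ?\<mu> - strict M c') x b" if b: "b \<in> M - {c'}" for b
  proof
    assume xb: "conn (sub ?\<mu> - strict M c') x b"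
    have "\<not> conn (sub (hgt x c) - strict M c') c x"
    proof
      assume "conn (sub (hgt x c) - strict M c') c x"
      then have "conn (sub ?\<mu> - strict M c') c x"
        by (rule conn_mono) (use assms(2) in auto)
      then have "conn (sub ?\<mu> - strict M c') c b" using xb by (rule conn_trans)
      then show False using assms(1) eq b by (auto simp: atr_def)
    qed
    moreover have "conn (sub (hgt x c)) c x" by (metis conn_hgt conn_sym)
    ultimately obtain v where v: "v \<in> strict M c'" "conn (sub (hgt x c)) c v"
      using conn_split by blast
    then have cv: "hgt c v < ?\<mu>" using assms(2) hgt_le_iff[of c v "hgt x c"] by simp
    then have "?\<mu> \<le> hgt v c'" using hgt_ultra[of c c' v] eq by simp
    then have "x \<in> strict M c'" using v(1) strict_closed by blast
    then show False using conn_in[OF xb] by simp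
  qed
  then show ?thesis using c' le by (simp add: atr_def)
qed

text \<open>If \<open>c\<close> is strictly nearer to \<open>x\<close> than \<open>c'\<close> is,
  \<open>atr_transfer\<close> applies. At equal heights the two strict valleys are disjoint unless
  the claim is immediate. Suppose that \<open>c\<close> escapes past \<open>c'\<close>. A walk from
  \<open>x\<close> to \<open>c'\<close> enters one of the valleys first: through that of
  \<open>c\<close> the state \<open>x\<close> escapes along with \<open>c\<close>, and through that
  of \<open>c'\<close> it reaches \<open>c'\<close> around the valley of \<open>c\<close>. Each
  contradicts one of the two attractions.\<close>

lemma atr_attractor:
  assumes M: "M' \<subseteq> M" "M \<subseteq> local_minima" and xc: "atr M x c" and xc': "atr M' x c'"
  shows "atr M' c c'"
proof -
  let ?e = "hgt x c'"
  have c: "c \<in> M" and c': "c' \<in> M'" "c' \<in> M" using assms by (auto simp: atr_def)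
  have le: "hgt x c \<le> ?e" using xc c' by (simp add: atr_def)
  show ?thesis
  proof (cases "hgt x c < ?e")
    case True
    then have "hgt c c' = ?e" using hgt_less_trans[of c x c'] hgt_sym[of c x] by simp
    then show ?thesis using atr_transfer[OF xc'] True hgt_sym[of c x] by simp
  next
    case False
    then have e: "hgt x c = ?e" using le by simp
    consider "c = c'" | "c \<in> strict M' c'" | "c \<noteq> c'" "c \<notin> strict M' c'" by blast
    then show ?thesis
    proof cases
      case 1 then show ?thesis using atr_self c' M by blast
    next
      case 2 then show ?thesis using strict_imp_atr c' by blast
    next
      case 3
      have disj: "strict M c \<inter> strict M' c' = {}"
      proof (rule ccontr)
        assume "strict M c \<inter> strict M' c' \<noteq> {}"
        then obtain v where v: "v \<in> strict M c" "v \<in> strict M' c'" by blast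
        have "hgt v c < hgt v c'" using v(1) c' 3 by (auto simp: strict_def)
        then have "hgt c c' = hgt v c'" using hgt_less_trans[of c v c'] hgt_sym[of c v] by simp
        then show False using strict_closed[OF v(2)] 3 by simp
      qed
      have "hgt c c' \<le> ?e" using hgt_ultra[of c c' x] e hgt_sym[of c x] by simp
      have key: "\<not> conn (sub ?e - strict M' c') c b" if b: "b \<in> M' - {c'}" for b
      proof
        assume cb: "conn (sub ?e - strict M' c') c b"
        have no1: "\<not> conn (sub ?e - strict M c) x c'"
          using xc e c' 3 by (auto simp: atr_def)
        have no2: "\<not> conn (sub ?e - strict M' c') x b"
          using xc' b by (auto simp: atr_def)
        let ?A = "strict M c \<union> strict M' c'"
        have "\<not> conn (sub ?e - ?A) x c'"
          using conn_mono[of _ x c' "sub ?e - strict M c"] no1 by blast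
        \<comment> \<open>The third fact encodes that \<open>w\<close> is the first state of
          \<open>?A\<close> on the walk: for \<open>T = {w}\<close> it joins \<open>x\<close> to
          \<open>w\<close> through states outside \<open>?A\<close> and \<open>w\<close> itself. If
          \<open>x\<close> is in \<open>?A\<close> already, \<open>w\<close> is
          \<open>x\<close>.\<close>
        then obtain w where w: "w \<in> ?A" "conn (sub ?e) x w"
             "\<And>T. conn (sub ?e - ?A \<union> T) x w \<or> w \<notin> T"
        proof (cases "x \<in> ?A")
          case True
          then show ?thesis using conn_base that conn_in[OF conn_hgt[of x c']]
            by (metis (no_types, lifting) UnI2)
        next
          case False
          then obtain v w where vw: "conn (sub ?e - ?A) x v" "adj v w" "w \<in> ?A" "conn (sub ?e) x w"
            using conn_first[OF conn_hgt[of x c'], of ?A] \<open>\<not> conn (sub ?e - ?A) x c'\<close> by blast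
          have "conn (sub ?e - ?A \<union> T) x w" if "w \<in> T" for T
          proof (rule conn_step[OF conn_mono[OF vw(1)] vw(2)])
          qed (use that in auto)
          then show ?thesis using that vw by blast
        qed
        have xw: "hgt x w \<le> ?e" using w(2) by (simp add: hgt_le_iff)
        from w(1) show False
        proof
          assume w1: "w \<in> strict M c"
          have "conn (sub (hgt w c) \<inter> strict M c) w c" by (rule strict_conn[OF w1])
          moreover have "hgt w c \<le> ?e" using hgt_ultra[of w c x] xw e hgt_sym[of w x] by simp
          ultimately have "conn (sub ?e - strict M' c') w c"
            using disj by (elim conn_mono) auto
          moreover have "conn (sub ?e - strict M' c') x w"
          proof (rule conn_mono)
            show "conn (sub ?e - ?A \<union> {w}) x w" using w(3) by blast
            show "sub ?e - ?A \<union> {w} \<subseteq> sub ?e - strict M' c'"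
              using w1 disj conn_in[OF w(2)] by auto
          qed
          ultimately show False using cb no2 conn_trans by blast
        next
          assume w1: "w \<in> strict M' c'"
          have "conn (sub (hgt w c') \<inter> strict M' c') w c'" by (rule strict_conn[OF w1])
          moreover have "hgt w c' \<le> ?e" using hgt_ultra[of w c' x] xw hgt_sym[of w x] by simp
          ultimately have "conn (sub ?e - strict M c) w c'"
            using disj by (elim conn_mono) auto
          moreover have "conn (sub ?e - strict M c) x w"
          proof (rule conn_mono)
            show "conn (sub ?e - ?A \<union> {w}) x w" using w(3) by blast
            show "sub ?e - ?A \<union> {w} \<subseteq> sub ?e - strict M c"
              using w1 disj conn_in[OF w(2)] by auto
          qed
          ultimately show False using no1 conn_trans by blast
        qed
      qed
      have "hgt c c' \<le> hgt c b" if "b \<in> M'" for b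
      proof (rule ccontr)
        assume less: "\<not> ?thesis"
        then have b: "b \<in> M' - {c'}" using that by auto
        have "conn (sub (hgt c b) - strict M' c') c b"
          by (rule conn_avoids_strict) (use less b in auto)
        then have "conn (sub ?e - strict M' c') c b"
          by (rule conn_mono) (use less \<open>hgt c c' \<le> ?e\<close> in auto)
        then show False using key b by blast
      qed
      moreover have "\<not> conn (sub (hgt c c') - strict M' c') c b" if "b \<in> M' - {c'}" for b
        using key[OF that] conn_mono[of _ c b "sub ?e - strict M' c'"] \<open>hgt c c' \<le> ?e\<close> by force
      ultimately show ?thesis using c' by (simp add: atr_def)
    qed
  qed
qed

lemma atr_unique:
  assumes "M \<subseteq> local_minima" "atr M x c" "atr M x c'" shows "c = c'"
  using atr_attractor[OF subset_refl assms] atr_min_self[of M c c'] assms by (simp add: atr_def)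

text \<open>Heights seen from \<open>y\<close> dominate those seen from \<open>x\<close>, because
  the edge between them is passed at height \<open>E y\<close>. A way from \<open>x\<close> around
  the strict valley of \<open>c\<close>, prolonged by this edge, is therefore one from
  \<open>y\<close>.\<close>

lemma atr_downhill:
  assumes "adj x y" "E x < E y" "atr M y c"
  shows "atr M x c"
proof -
  have c: "c \<in> M" using assms by (simp add: atr_def)
  have xy: "hgt x y = E y" using hgt_adj[OF assms(1)] assms(2) by simp
  have ineq: "hgt x b \<le> hgt y b" for b
    using hgt_ultra[of x b y] hgt_ge(1)[of y b] xy by simp
  have st: "x \<in> strict M c" if "y \<in> strict M c" using strict_closed[OF that] ineq by simp
  have no: "\<not> conn (sub (hgt x c) - strict M c) x b" if b: "b \<in> M - {c}" for b
  proof
    assume xb: "conn (sub (hgt x c) - strict M c) x b"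
    then have x: "x \<notin> strict M c" using conn_in by blast
    have "conn (sub (hgt y c) - strict M c) y x"
      by (rule conn_adj) (use x st hgt_ge(1)[of x c] hgt_ge(1)[of y c] ineq[of c] assms adj_sym in auto)
    moreover have "conn (sub (hgt y c) - strict M c) x b"
      using xb by (rule conn_mono) (use ineq[of c] in auto)
    ultimately have "conn (sub (hgt y c) - strict M c) y b" by (rule conn_trans)
    then show False using assms b by (simp add: atr_def)
  qed
  have "hgt x c \<le> hgt x b" if "b \<in> M" for b
  proof (rule ccontr)
    assume less: "\<not> ?thesis"
    then have b: "b \<in> M - {c}" using that by auto
    have "conn (sub (hgt x b) - strict M c) x b"
      by (rule conn_avoids_strict) (use less b in auto)
    then have "conn (sub (hgt x c) - strict M c) x b"
      by (rule conn_mono) (use less in auto)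
    then show False using no b by blast
  qed
  then show ?thesis using c no by (simp add: atr_def)
qed

text \<open>What non-attraction provides: a way to a second minimum at the level of \<open>n\<close>
  itself and around the strict valley of \<open>c\<close>. If \<open>c\<close> is above that level,
  the optimal way to \<open>b\<close> serves by \<open>conn_avoids_strict\<close>.\<close>

lemma not_atr_conn:
  assumes "\<not> atr M n c" "c \<in> M" "b \<in> M" "hgt n b \<le> E n"
  shows "\<exists>b\<in>M - {c}. conn (sub (E n) - strict M c) n b"
proof (cases "hgt n c \<le> E n")
  case True
  then have "hgt n c = E n" using hgt_ge(1)[of n c] by simp
  moreover have "E n \<le> hgt n b'" for b' by (rule hgt_ge)
  ultimately show ?thesis using assms by (auto simp: atr_def)
next
  case False
  then have b: "hgt n b < hgt n c" "b \<in> M - {c}" using assms by auto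
  have "conn (sub (E n) - strict M c) n b"
    using conn_avoids_strict[OF b] by (rule conn_mono) (use assms in auto)
  then show ?thesis using b by blast
qed

section \<open>Valleys and merging minima\<close>

lemma lm_inj: "j \<in> {1..num_min} \<Longrightarrow> k \<in> {1..num_min} \<Longrightarrow> lm j = lm k \<longleftrightarrow> j = k"
  using lm_bij by (auto simp: bij_betw_def inj_on_eq_iff)

lemma metastable_eq: "1 \<le> l \<Longrightarrow> metastable l = lm ` {l..num_min}"
  by (simp add: metastable_def)

lemma metastable_local_minima: "1 \<le> l \<Longrightarrow> metastable l \<subseteq> local_minima"
  using lm_bij by (auto simp: metastable_eq bij_betw_def)

lemma metastable_antimono: "1 \<le> l \<Longrightarrow> l \<le> l' \<Longrightarrow> metastable l' \<subseteq> metastable l"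
  by (auto simp: metastable_eq)

lemma lm_in_metastable: "1 \<le> l \<Longrightarrow> j \<in> {1..num_min} \<Longrightarrow> lm j \<in> metastable l \<longleftrightarrow> l \<le> j"
  using lm_inj by (fastforce simp: metastable_eq)

lemma in_metastableE:
  assumes "a \<in> metastable l" "1 \<le> l"
  obtains k where "a = lm k" "k \<in> {l..num_min}"
  using assms by (auto simp: metastable_eq)

lemma attracted_atr: "1 \<le> l \<Longrightarrow> l \<le> num_min \<Longrightarrow> attracted l s a \<longleftrightarrow> atr (metastable l) s a"
  by (rule attracted_iff) (auto simp: metastable_eq)

lemma attr_level_gt: "enat j < attr_level j"
proof -
  have "enat (Suc j) \<le> attr_level j"
    unfolding attr_level_def by (rule Inf_greatest) auto
  then show ?thesis by (metis enat_ord_simps(2) lessI less_le_trans)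
qed

lemma attr_level_enat:
  assumes "attr_level j = enat t"
  shows "j < t" "t \<le> num_min" "\<exists>k\<in>{t..num_min}. attracted t (lm j) (lm k)"
proof -
  let ?A = "enat ` {t. j < t \<and> t \<le> num_min \<and> (\<exists>a\<in>metastable t. attracted t (lm j) a)}"
  have "?A \<noteq> {}"
  proof
    assume "?A = {}"
    then have "attr_level j = top" unfolding attr_level_def by (metis Inf_empty)
    then show False using assms by (simp add: top_enat_def)
  qed
  then obtain u where "u \<in> ?A" by blast
  then have "Inf ?A \<in> ?A" using LeastI[of "\<lambda>u. u \<in> ?A" u] by (auto simp: Inf_enat_def)
  then have "enat t \<in> ?A" using assms by (simp add: attr_level_def)
  then have *: "j < t \<and> t \<le> num_min \<and> (\<exists>a\<in>metastable t. attracted t (lm j) a)" by auto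
  then show "j < t" "t \<le> num_min" by auto
  show "\<exists>k\<in>{t..num_min}. attracted t (lm j) (lm k)"
    using * metastable_eq[of t] by auto
qed

lemma attr_level_le:
  "j < t \<Longrightarrow> t \<le> num_min \<Longrightarrow> attracted t (lm j) a \<Longrightarrow> attr_level j \<le> enat t"
  unfolding attr_level_def by (rule Inf_lower) (auto simp: attracted_def)

text \<open>Successive merges up to level \<open>l\<close>: each step leads from \<open>k\<close> to
  its attractor at the level \<open>attr_level k\<close> at which it is absorbed. The end
  \<open>j\<close> is left free; it is an owner at level \<open>l\<close> when its own merge level
  exceeds \<open>l\<close>.\<close>

inductive chain :: "nat \<Rightarrow> nat \<Rightarrow> nat \<Rightarrow> bool" for l where
  chain_refl: "chain l k k"
| chain_step: "attr_level k = enat s \<Longrightarrow> s \<le> l \<Longrightarrow> attracted s (lm k) (lm k1) \<Longrightarrow>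
     k1 \<in> {s..num_min} \<Longrightarrow> chain l k1 j \<Longrightarrow> chain l k j"

lemma chain_trans: "chain l k q \<Longrightarrow> chain l q j \<Longrightarrow> chain l k j"
  by (induction rule: chain.induct) (auto intro: chain_step)

lemma chain_mono: "chain l k q \<Longrightarrow> l \<le> l' \<Longrightarrow> chain l' k q"
  by (induction rule: chain.induct) (auto intro: chain_refl chain_step)

lemma chain_root: "chain l k j \<Longrightarrow> enat l < attr_level k \<Longrightarrow> j = k"
  by (erule chain.cases) auto

definition assigned :: "nat \<Rightarrow> 's \<Rightarrow> nat \<Rightarrow> nat \<Rightarrow> bool" where
  "assigned l x t k \<longleftrightarrow> 1 \<le> t \<and> t \<le> l \<and> k \<in> {t..num_min} \<and> attracted t x (lm k)"

lemma valley_assigned: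
  assumes "1 \<le> l" "l \<le> j" "j \<in> {1..num_min}" "x \<in> valley l (lm j)"
  shows "\<exists>t k. assigned l x t k \<and> chain l k j"
  using assms
proof (induction l arbitrary: j rule: less_induct)
  case (less l)
  show ?case
  proof (cases "l = 1")
    case True
    then have "assigned l x 1 j" using less.prems by (simp add: assigned_def)
    then show ?thesis using chain_refl by blast
  next
    case False
    define n where "n = l - 2"
    then have l: "l = Suc (Suc n)" using False less.prems(1) by arith
    have "x \<in> valley (Suc n) (lm j) \<or> attracted (Suc (Suc n)) x (lm j) \<or>
      (\<exists>q. q \<in> {1..num_min} \<and> q < l \<and> attr_level q = enat l \<and> attracted l (lm q) (lm j) \<and> x \<in> valley q (lm q))"
    proof -
      note x = less.prems(4)[unfolded l valley.simps(3)]
      from x show ?thesis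
      proof (elim UnE)
        assume "x \<in> (\<Union>j'\<in>{j' \<in> {1..num_min}. j' < Suc (Suc n) \<and> attr_level j' = enat (Suc (Suc n)) \<and>
          attracted (Suc (Suc n)) (lm j') (lm j)}. valley j' (lm j'))"
        then have "\<exists>j'\<in>{j' \<in> {1..num_min}. j' < l \<and> attr_level j' = enat l \<and>
          attracted l (lm j') (lm j)}. x \<in> valley j' (lm j')" unfolding l by (simp only: UN_iff)
        then show ?thesis by blast
      qed simp_all
    qed
    then show ?thesis
    proof (elim disjE exE conjE)
      assume 1: "x \<in> valley (Suc n) (lm j)"
      have n: "Suc n < l" "1 \<le> Suc n" "Suc n \<le> j" using l less.prems(2) by simp_all
      obtain t k where "assigned (Suc n) x t k" "chain (Suc n) k j"
        using less.IH[OF n less.prems(3) 1] by blast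
      moreover have "Suc n \<le> l" using l by simp
      ultimately show ?thesis using chain_mono[of "Suc n" k j l] unfolding assigned_def by (meson le_trans)
    next
      assume "attracted (Suc (Suc n)) x (lm j)"
      then have "assigned l x l j" using less.prems(1,2,3) l by (simp add: assigned_def)
      then show ?thesis using chain_refl by blast
    next
      fix q assume q: "q \<in> {1..num_min}" "q < l" "attr_level q = enat l" "attracted l (lm q) (lm j)" "x \<in> valley q (lm q)"
      then obtain t k where tk: "assigned q x t k" "chain q k q"
        using less.IH[OF q(2) _ order_refl q(1,5)] by auto
      have "j \<in> {l..num_min}" using less.prems(2,3) by simp
      then have "chain l q j" using chain_step[OF q(3) order_refl q(4) _ chain_refl] by blast
      moreover have "chain l k q" using chain_mono[OF tk(2), of l] q(2) by simp
      ultimately have "chain l k j" by (rule chain_trans[rotated])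
      moreover have "assigned l x t k" using tk q(2) by (simp add: assigned_def)
      ultimately show ?thesis by blast
    qed
  qed
qed

lemma valley_mono: "1 \<le> l \<Longrightarrow> valley l a \<subseteq> valley (Suc l) a"
  by (cases l) auto

text \<open>The owner at the previous level remains the owner unless its merge level is the new one.
  Then its whole valley passes to its attractor, which is the last part of the recursion for
  \<open>valley\<close>.\<close>

lemma assigned_valley_exists:
  assumes "1 \<le> l" "l \<le> num_min" "assigned l x t k"
  shows "\<exists>j\<in>{1..num_min}. enat l < attr_level j \<and> x \<in> valley (min l j) (lm j)"
  using assms
proof (induction l arbitrary: t k rule: nat_induct_at_least)
  case base
  then have "k \<in> {1..num_min}" "attracted 1 x (lm k)" by (auto simp: assigned_def)
  moreover have "enat 1 < attr_level k"
    using attr_level_gt[of k] calculation by (metis atLeastAtMost_iff enat_ord_simps(1) le_less_trans)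
  ultimately show ?case by (intro bexI[of _ k]) (auto simp: min_def)
next
  case (Suc l)
  have gtI: "enat (Suc l) < attr_level j" if "Suc l \<le> j" for j
    using attr_level_gt[of j] that by (metis enat_ord_simps(1) le_less_trans)
  obtain n where n: "l = Suc n" using Suc.hyps by (metis One_nat_def Suc_le_D)
  show ?case
  proof (cases "\<exists>t k. assigned l x t k")
    case True
    then obtain j where j: "j \<in> {1..num_min}" "enat l < attr_level j" "x \<in> valley (min l j) (lm j)"
      using Suc.IH Suc_leD[OF Suc.prems(1)] by blast
    show ?thesis
    proof (cases "attr_level j = enat (Suc l)")
      case False
      then have gt: "enat (Suc l) < attr_level j"
        using j(2) by (cases "attr_level j") auto
      moreover have "x \<in> valley (min (Suc l) j) (lm j)"
        using j Suc.hyps valley_mono[of l "lm j"] by (cases "j \<le> l") (auto simp: min_def split: if_splits)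
      ultimately show ?thesis using j by auto
    next
      case True
      note t = attr_level_enat[OF True]
      then obtain q where q: "q \<in> {Suc l..num_min}" "attracted (Suc l) (lm j) (lm q)" by auto
      have "x \<in> valley j (lm j)" using j(3) t(1) by (cases "j = l") (auto simp: min_def)
      then have "x \<in> valley (Suc l) (lm q)" using j t(1) True q(2) unfolding n by auto
      then show ?thesis using q gtI[of q] by (intro bexI[of _ q]) (auto simp: min_def)
    qed
  next
    case False
    then have tk: "t = Suc l" "k \<in> {Suc l..num_min}" "attracted (Suc l) x (lm k)"
      using Suc.prems(2) by (auto simp: assigned_def le_Suc_eq)
    have "x \<notin> valley (min l j) (lm j)" if j: "j \<in> {1..num_min}" for j
    proof
      assume "x \<in> valley (min l j) (lm j)"
      moreover have "1 \<le> min l j" "min l j \<le> j" using j Suc.hyps by auto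
      ultimately obtain t k where "assigned (min l j) x t k"
        using valley_assigned[of "min l j" j x] j by blast
      then show False using False by (auto simp: assigned_def)
    qed
    then have "x \<in> valley (Suc l) (lm k)" using tk unfolding n by auto
    then show ?thesis using tk gtI[of k] by (intro bexI[of _ k]) (auto simp: min_def)
  qed
qed

lemma unassigned_iff:
  assumes "1 \<le> l" "l \<le> num_min"
  shows "x \<in> unassigned l \<longleftrightarrow> (\<forall>t k. \<not> assigned l x t k)"
proof
  assume "x \<in> unassigned l"
  then show "\<forall>t k. \<not> assigned l x t k"
    using assigned_valley_exists[OF assms] unfolding unassigned_def by blast
next
  assume no: "\<forall>t k. \<not> assigned l x t k"
  have "x \<notin> valley (min l j) (lm j)" if j: "j \<in> {1..num_min}" for j
  proof
    assume "x \<in> valley (min l j) (lm j)"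
    moreover have "1 \<le> min l j" "min l j \<le> j" using j assms by auto
    ultimately obtain t k where "assigned (min l j) x t k"
      using valley_assigned[of "min l j" j x] j by blast
    then show False using no by (auto simp: assigned_def)
  qed
  then show "x \<in> unassigned l" by (auto simp: unassigned_def)
qed

lemma attracted_attractor:
  assumes "1 \<le> t" "t \<le> t'" "t' \<le> num_min" "attracted t x c" "attracted t' x c'"
  shows "attracted t' c c'"
  using atr_attractor[of "metastable t'" "metastable t" x c c'] assms
    metastable_antimono metastable_local_minima by (simp add: attracted_atr)

lemma attracted_lm_eq:
  assumes "1 \<le> t" "t \<le> k" "k \<le> num_min" "k' \<in> {1..num_min}" "attracted t (lm k) (lm k')"
  shows "k' = k"
proof -
  have "lm k' = lm k"
    using atr_min_self[of "metastable t" "lm k" "lm k'"] assms metastable_local_minima[of t]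
      lm_in_metastable[of t k] by (simp add: attracted_atr)
  then show ?thesis using lm_inj assms by simp
qed

lemma attracted_unique:
  assumes "1 \<le> t" "t \<le> num_min" "attracted t x (lm k)" "attracted t x (lm k')"
     "k \<in> {1..num_min}" "k' \<in> {1..num_min}"
  shows "k = k'"
  using atr_unique[of "metastable t" x "lm k" "lm k'"] assms metastable_local_minima[of t] lm_inj
  by (simp add: attracted_atr)

lemma attracted_self: "1 \<le> t \<Longrightarrow> k \<in> {t..num_min} \<Longrightarrow> attracted t (lm k) (lm k)"
  using atr_self[of "metastable t" "lm k"] metastable_local_minima[of t] lm_in_metastable[of t k]
  by (simp add: attracted_atr)

text \<open>If \<open>k\<close> still exists at level \<open>t'\<close>, it is attracted by itself
  only, and both chains take the same step. Otherwise it has been absorbed by then, and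
  \<open>attracted_attractor\<close> hands the attraction on to the next minimum of the
  chain.\<close>

lemma chain_same_root:
  assumes "chain l k j" "enat l < attr_level j" "enat l < attr_level j'" "l \<le> num_min"
    "1 \<le> t'" "t' \<le> l" "k \<in> {1..num_min}"
    "k' \<in> {t'..num_min}" "attracted t' (lm k) (lm k')" "chain l k' j'"
  shows "j = j'"
  using assms
proof (induction arbitrary: k' t' rule: chain.induct)
  case (chain_refl k)
  have "\<not> k < t'"
  proof
    assume "k < t'"
    then have "attr_level k \<le> enat t'" using chain_refl attr_level_le[of k t'] by auto
    then show False using chain_refl
      by (metis enat_ord_simps(1) leD order_trans)
  qed
  then have "k' = k" using attracted_lm_eq[of t' k k'] chain_refl by auto
  then show ?case using chain_root chain_refl by metis
next
  case (chain_step k s k1 j)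
  have s: "k < s" "s \<le> num_min" using attr_level_enat chain_step(1) by auto
  show ?case
  proof (cases "k < t'")
    case False
    then have k': "k' = k" using attracted_lm_eq[of t' k k'] chain_step.prems by auto
    from chain_step.prems(9)[unfolded k'] obtain k1' where k1': "attracted s (lm k) (lm k1')"
        "k1' \<in> {s..num_min}" "chain l k1' j'"
    proof (cases rule: chain.cases)
      case chain_refl
      then show ?thesis using chain_step.prems(2) chain_step.hyps by simp
    next
      case (chain_step s' k1')
      then show ?thesis using that \<open>attr_level k = enat s\<close> by auto
    qed
    then have "k1' = k1" using attracted_unique[of s "lm k" k1' k1] chain_step.hyps s by auto
    then show ?thesis
      using chain_step.IH[OF chain_step.prems(1-3), of s k1] k1' chain_step.hyps s attracted_self[of s k1] by auto
  next
    case True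
    have "attr_level k \<le> enat t'" using attr_level_le[of k t'] True chain_step.prems by auto
    then have st: "s \<le> t'" using chain_step(1) by simp
    have "attracted t' (lm k1) (lm k')"
      using attracted_attractor[of s t' "lm k" "lm k1" "lm k'"] st s chain_step by auto
    then show ?thesis using chain_step.IH[of t' k'] chain_step.prems chain_step.hyps s by auto
  qed
qed

text \<open>For attraction at two levels, the attractor of the earlier level is itself attracted, at
  the later level, by the attractor of that level; \<open>chain_same_root\<close> then joins the two
  chains.\<close>

lemma owner_unique:
  assumes "l \<le> num_min" "assigned l x t k" "chain l k j" "assigned l x t' k'" "chain l k' j'"
    "enat l < attr_level j" "enat l < attr_level j'"
  shows "j = j'"
proof -
  have *: "j = j'" if "assigned l x t k" "chain l k j" "assigned l x t' k'" "chain l k' j'"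
    "enat l < attr_level j" "enat l < attr_level j'" "t \<le> t'" for t t' k k' j j'
  proof -
    from that have "1 \<le> t" "t' \<le> l" "k \<in> {1..num_min}" "k' \<in> {t'..num_min}"
      "attracted t x (lm k)" "attracted t' x (lm k')" by (auto simp: assigned_def)
    moreover from this have "attracted t' (lm k) (lm k')" "1 \<le> t'"
      using attracted_attractor[of t t' x "lm k" "lm k'"] \<open>t \<le> t'\<close> assms(1) by auto
    ultimately show ?thesis
      using chain_same_root[of l k j j' t' k'] that(2,4,5,6) assms(1) by blast
  qed
  show ?thesis
  proof (cases "t \<le> t'")
    case True then show ?thesis using *[of t k j t' k' j'] assms by blast
  next
    case False then show ?thesis using *[of t' k' j' t k j] assms by simp
  qed
qed

lemma valley_root_assigned:
  assumes "1 \<le> l" "j \<in> {1..num_min}" "x \<in> valley (min l j) (lm j)"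
  obtains t k where "assigned (min l j) x t k" "chain (min l j) k j"
  using valley_assigned[of "min l j" j x] assms by auto

lemma assigned_mono: "assigned l x t k \<Longrightarrow> l \<le> l' \<Longrightarrow> assigned l' x t k"
  by (auto simp: assigned_def)

lemma assigned_valley:
  assumes "1 \<le> l" "l \<le> num_min" "assigned l x t k" "chain l k j" "enat l < attr_level j"
  shows "x \<in> valley (min l j) (lm j)"
proof -
  obtain j' where j': "j' \<in> {1..num_min}" "enat l < attr_level j'" "x \<in> valley (min l j') (lm j')"
    using assigned_valley_exists assms by blast
  then obtain t' k' where "assigned (min l j') x t' k'" "chain (min l j') k' j'"
    using valley_root_assigned assms by metis
  then have "assigned l x t' k'" "chain l k' j'" by (auto intro: assigned_mono chain_mono)
  then have "j = j'" using owner_unique assms j' by blast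
  then show ?thesis using j' by simp
qed

section \<open>Heights of owners and of non-assigned states\<close>

lemma local_minimaE:
  assumes "a \<in> local_minima" obtains j where "j \<in> {1..num_min}" "a = lm j"
  using assms lm_bij unfolding bij_betw_def by blast

text \<open>A merge leads to a minimum that is no farther from the absorbed one than any survivor
  is; the ultrametric inequality keeps this true when seen from \<open>x\<close>.\<close>

lemma owner_hgt:
  assumes "chain l k j" "\<And>b. b \<in> metastable l \<Longrightarrow> hgt x (lm k) \<le> hgt x b" "b \<in> metastable l"
    "l \<le> num_min"
  shows "hgt x (lm j) \<le> hgt x b"
  using assms
proof (induction arbitrary: b rule: chain.induct)
  case (chain_step k s k1 j)
  have s: "1 \<le> s" "s \<le> num_min" using attr_level_enat[OF chain_step(1)] by auto
  have "hgt x (lm k1) \<le> hgt x b" if b: "b \<in> metastable l" for b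
  proof -
    have "b \<in> metastable s" using b metastable_antimono s chain_step(2) by blast
    then have "hgt (lm k) (lm k1) \<le> hgt (lm k) b"
      using chain_step(3) s by (simp add: attracted_atr atr_def)
    also have "\<dots> \<le> max (hgt x (lm k)) (hgt x b)"
      using hgt_ultra[of "lm k" b x] hgt_sym[of x "lm k"] by simp
    also have "\<dots> = hgt x b" using chain_step.prems(1) b by simp
    finally show ?thesis using hgt_ultra[of x "lm k1" "lm k"] chain_step.prems(1)[OF b] by simp
  qed
  then show ?case using chain_step by blast
qed simp

lemma assigned_hgt:
  assumes "assigned l x t k" "b \<in> metastable l" "l \<le> num_min"
  shows "hgt x (lm k) \<le> hgt x b"
proof -
  have t: "1 \<le> t" "t \<le> l" "t \<le> num_min" "attracted t x (lm k)" using assms by (auto simp: assigned_def)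
  moreover have "b \<in> metastable t" using assms(2) t metastable_antimono by blast
  ultimately show ?thesis by (simp add: attracted_atr atr_def)
qed

lemma chain_hgt:
  assumes "assigned l x t k" "chain l k j" "b \<in> metastable l" "l \<le> num_min"
  shows "hgt x (lm j) \<le> hgt x b"
  using owner_hgt[OF assms(2) _ assms(3,4)] assigned_hgt[OF assms(1) _ assms(4)] by blast

text \<open>If no attractor lay below \<open>E n\<close>, the last surviving minimum below the saddle would attract \<open>n\<close>.\<close>

lemma unassigned_hgt:
  assumes "n \<in> unassigned l" "1 \<le> l" "l \<le> num_min"
  shows "\<exists>b\<in>metastable l. hgt n b \<le> E n"
proof (rule ccontr)
  assume no: "\<not> ?thesis"
  define e where "e = Min (hgt n ` metastable l)"
  have ne: "metastable l \<noteq> {}" using assms by (auto simp: metastable_eq)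
  have e_le: "e \<le> hgt n b" if "b \<in> metastable l" for b using that by (simp add: e_def)
  have "e \<in> hgt n ` metastable l" unfolding e_def using ne by (intro Min_in) auto
  then have e: "E n < e" using no by auto
  define D where "D = {s. hgt n s < e}"
  have "n \<in> D" using e by (simp add: D_def hgt_self)
  then obtain d where d: "is_arg_min E (\<lambda>s. s \<in> D) d"
    using ex_is_arg_min_if_finite[of D E] by auto
  have "d \<in> local_minima"
    unfolding local_minima_def neighbour_def
  proof (intro CollectI allI impI, elim conjE)
    fix r assume r: "r \<noteq> d" "adj r d"
    then have ne: "E r \<noteq> E d" using E_inj by (auto dest: injD)
    show "E d < E r"
    proof (cases "r \<in> D")
      case True
      then have "E d \<le> E r" using d by (auto simp: is_arg_min_def not_less)
      then show ?thesis using ne by simp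
    next
      case False
      have dD: "hgt n d < e" using d by (simp add: is_arg_min_def D_def)
      then have "E d < e" using hgt_ge(2)[of d n] by simp
      moreover have "e \<le> max (hgt n d) (max (E d) (E r))"
        using False hgt_ultra[of n r d] hgt_adj[of d r] adj_sym[OF r(2)] by (simp add: D_def)
      ultimately show ?thesis using dD by simp
    qed
  qed
  then obtain k0 where k0: "k0 \<in> {1..num_min}" "d = lm k0" by (rule local_minimaE)
  define Ks where "Ks = {k \<in> {1..num_min}. lm k \<in> D}"
  have Ks: "finite Ks" "Ks \<noteq> {}" using k0 d by (auto simp: Ks_def is_arg_min_def)
  define k where "k = Max Ks"
  have k: "k \<in> {1..num_min}" "hgt n (lm k) < e" using Max_in[OF Ks] by (auto simp: k_def Ks_def D_def)
  have kl: "k < l"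
  proof (rule ccontr)
    assume "\<not> k < l"
    then have "lm k \<in> metastable l" using k assms lm_in_metastable by simp
    then show False using e_le k by fastforce
  qed
  have "n \<in> strict (metastable k) (lm k)"
    unfolding strict_def
  proof (intro CollectI ballI)
    fix b assume b: "b \<in> metastable k - {lm k}"
    then obtain q where q: "b = lm q" "q \<in> {k..num_min}" using in_metastableE[of b k] k by auto
    then have "k < q" using b by (cases "q = k") auto
    then have "q \<notin> Ks" using Max_ge[OF Ks(1), of q] by (auto simp: k_def)
    then have "e \<le> hgt n b" using q k by (auto simp: Ks_def D_def)
    then show "hgt n (lm k) < hgt n b" using k by simp
  qed
  then have "attracted k n (lm k)"
    using strict_imp_atr[of "lm k" "metastable k"] lm_in_metastable[of k k] k by (simp add: attracted_atr)
  then have "assigned l n k k" using k kl by (simp add: assigned_def)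
  then show False using assms by (simp add: unassigned_iff)
qed

lemma unassigned_antimono:
  "1 \<le> l \<Longrightarrow> l \<le> l' \<Longrightarrow> l' \<le> num_min \<Longrightarrow> unassigned l' \<subseteq> unassigned l"
  using unassigned_iff[of l] unassigned_iff[of l'] assigned_mono[of l _ _ _ l'] by fastforce

text \<open>The form in which non-assigned states are used later: some survivor is reached without
  climbing, and none captures the state.\<close>

lemma unassigned_conn:
  assumes "n \<in> unassigned l" "1 \<le> l" "l \<le> num_min" "k \<in> {l..num_min}"
  shows "\<exists>b\<in>metastable l - {lm k}. conn (sub (E n) - strict (metastable l) (lm k)) n b"
proof -
  obtain b where b: "b \<in> metastable l" "hgt n b \<le> E n" using unassigned_hgt assms by blast
  have "\<not> attracted l n (lm k)" using assms by (auto simp: unassigned_iff assigned_def)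
  then have "\<not> atr (metastable l) n (lm k)" using assms by (simp add: attracted_atr)
  moreover have "lm k \<in> metastable l" using assms lm_in_metastable by auto
  ultimately show ?thesis using not_atr_conn b by blast
qed

text \<open>Were \<open>n\<close> below \<open>x\<close>, its way around the strict valley would be
  open to \<open>x\<close> as well, against the attraction of \<open>x\<close>. A basin can thus be
  left only uphill.\<close>

lemma unassigned_above:
  assumes n: "n \<in> unassigned l" and l: "l \<le> num_min" and x: "assigned l x t k" and a: "adj x n"
  shows "E x < E n"
proof (rule ccontr)
  assume nt: "\<not> ?thesis"
  have t: "1 \<le> t" "t \<le> l" "t \<le> num_min" "k \<in> {t..num_min}" "attracted t x (lm k)"
    using x l by (auto simp: assigned_def)
  have "x \<noteq> n" using n x t l unassigned_iff[of l n] by auto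
  then have less: "E n < E x" using nt E_inj by (metis injD linorder_less_linear)
  let ?S = "strict (metastable t) (lm k)"
  obtain b where b: "b \<in> metastable t - {lm k}" "conn (sub (E n) - ?S) n b"
    using unassigned_conn[of n t k] unassigned_antimono[of t l] n t l by blast
  have nb: "conn (sub (E x) - ?S) n b" using b(2) by (rule conn_mono) (use less in auto)
  have atr: "atr (metastable t) x (lm k)" using t by (simp add: attracted_atr)
  have "x \<notin> ?S"
  proof
    assume "x \<in> ?S"
    then have "hgt x (lm k) < hgt x b" using b by (auto simp: strict_def)
    moreover have "hgt x b \<le> max (hgt x n) (hgt n b)" by (rule hgt_ultra)
    moreover have "hgt n b \<le> E n" using b(2) conn_mono[of _ n b "sub (E n)"] by (auto simp: hgt_le_iff)
    moreover have "hgt x n = E x" using hgt_adj[OF a] less by simp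
    ultimately show False using hgt_ge(1)[of x "lm k"] less by simp
  qed
  then have "conn (sub (E x) - ?S) x n"
    by (intro conn_adj) (use a less conn_in[OF nb] in auto)
  then have "conn (sub (E x) - ?S) x b" using nb by (rule conn_trans)
  then have "conn (sub (hgt x (lm k)) - ?S) x b"
    by (rule conn_mono) (use hgt_ge(1)[of x "lm k"] in auto)
  then show False using atr b by (simp add: atr_def)
qed

text \<open>Where the height of the minimum, seen from \<open>x\<close>, first grows along the
  chain, \<open>atr_transfer\<close> makes the next minimum attract \<open>x\<close> itself. Applied
  to the largest possible \<open>k\<close>, this shows that the owner is no farther from
  \<open>x\<close> than \<open>lm k\<close>.\<close>

lemma chain_climb:
  assumes "chain l k j" "1 \<le> u" "u \<le> k" "k \<in> {1..num_min}" "l \<le> num_min"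
    "\<And>b. b \<in> metastable u \<Longrightarrow> hgt x (lm k) \<le> hgt x b" "hgt x (lm k) < hgt x (lm j)"
  shows "\<exists>t k'. k < k' \<and> assigned l x t k' \<and> chain l k' j"
  using assms
proof (induction arbitrary: u rule: chain.induct)
  case (chain_step k s k1 j)
  have s: "k < s" "s \<le> num_min" using attr_level_enat[OF chain_step(1)] by auto
  have k1: "lm k1 \<in> metastable s" using lm_in_metastable[of s k1] s chain_step(4) by auto
  then have "lm k1 \<in> metastable u" using metastable_antimono[of u s] s chain_step by auto
  then have le: "hgt x (lm k) \<le> hgt x (lm k1)" using chain_step.prems by blast
  show ?case
  proof (cases "hgt x (lm k) < hgt x (lm k1)")
    case True
    have "atr (metastable s) (lm k) (lm k1)" using chain_step(3) s by (simp add: attracted_atr)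
    then have "attracted s x (lm k1)" using atr_transfer True s by (simp add: attracted_atr)
    then have "assigned l x s k1" using chain_step s by (auto simp: assigned_def)
    moreover have "k < k1" using chain_step(4) s by simp
    ultimately show ?thesis using chain_step(5) by blast
  next
    case False
    then have eq: "hgt x (lm k1) = hgt x (lm k)" using le by simp
    have "\<exists>t k'. k1 < k' \<and> assigned l x t k' \<and> chain l k' j"
    proof (rule chain_step.IH[of s])
      show "hgt x (lm k1) \<le> hgt x b" if "b \<in> metastable s" for b
        using that chain_step.prems(5)[of b] eq metastable_antimono[of u s] s chain_step.prems by auto
    qed (use chain_step s eq in auto)
    then show ?thesis using chain_step(4) s by (meson atLeastAtMost_iff le_less_trans less_imp_le_nat less_le_trans)
  qed
qed simp

end

section \<open>Basins of the aggregation\<close>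

locale landscape_level = landscape_graph E adj lm
  for E :: "'s::finite \<Rightarrow> real" and adj :: "'s \<Rightarrow> 's \<Rightarrow> bool" and lm :: "nat \<Rightarrow> 's" +
  fixes i :: nat
  assumes i_ge: "1 \<le> i" and i_less: "i < num_min"
begin

text \<open>The labels of the minima that own a basin. A label below \<open>i\<close> belongs to a
  minimum that has left the filtration without having been absorbed.\<close>

definition roots :: "nat set" where "roots = {j \<in> {1..num_min}. enat i < attr_level j}"

lemma rootsD: "j \<in> roots \<Longrightarrow> j \<in> {1..num_min}" "j \<in> roots \<Longrightarrow> enat i < attr_level j"
  by (auto simp: roots_def)

lemma label_lm: "j \<in> {1..num_min} \<Longrightarrow> label (lm j) = j"
  unfolding label_def by (rule the_equality) (auto simp: lm_inj)

lemma lm_not_unassigned: "j \<in> {1..num_min} \<Longrightarrow> lm j \<notin> unassigned i"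
  using attracted_self[of 1 j] i_ge i_less unassigned_iff[of i "lm j"]
  by (auto simp: assigned_def)

lemma agg_minima_eq: "agg_minima i = lm ` roots"
  using lm_not_unassigned by (auto simp: agg_minima_def agg_states_def roots_def)

lemma agg_states_eq: "agg_states i = agg_minima i \<union> unassigned i"
  by (auto simp: agg_minima_def agg_states_def)

lemma basin_lm: "j \<in> roots \<Longrightarrow> basin i (lm j) = valley (min i j) (lm j)"
  using lm_not_unassigned label_lm by (simp add: basin_def roots_def)

lemma basin_unassigned: "n \<in> unassigned i \<Longrightarrow> basin i n = {n}"
  by (simp add: basin_def)

lemma basin_assigned:
  assumes "j \<in> roots" "x \<in> basin i (lm j)"
  obtains t k where "assigned (min i j) x t k" "chain (min i j) k j"
  using valley_root_assigned[of i j x] assms i_ge by (auto simp: basin_lm roots_def)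

lemma basinI: "j \<in> roots \<Longrightarrow> assigned i x t k \<Longrightarrow> chain i k j \<Longrightarrow> x \<in> basin i (lm j)"
  using assigned_valley[of i x t k j] i_ge i_less by (simp add: basin_lm roots_def)

lemma basin_assigned_iff:
  assumes "j \<in> roots"
  shows "x \<in> basin i (lm j) \<longleftrightarrow> (\<exists>t k. assigned i x t k \<and> chain i k j)"
proof
  assume "x \<in> basin i (lm j)"
  then obtain t k where "assigned (min i j) x t k" "chain (min i j) k j" using basin_assigned assms by blast
  then have "assigned i x t k" "chain i k j" by (auto intro: assigned_mono chain_mono)
  then show "\<exists>t k. assigned i x t k \<and> chain i k j" by blast
qed (use basinI assms in blast)

lemma unassigned_not_basin: "n \<in> unassigned i \<Longrightarrow> a \<in> agg_minima i \<Longrightarrow> n \<notin> basin i a"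
  using basin_assigned_iff unassigned_iff[of i n] i_ge i_less by (auto simp: agg_minima_eq)

lemma basin_disjoint:
  assumes "s \<in> agg_states i" "s' \<in> agg_states i" "x \<in> basin i s" "x \<in> basin i s'"
  shows "s = s'"
proof (cases "s \<in> unassigned i \<or> s' \<in> unassigned i")
  case True
  then show ?thesis using assms basin_unassigned unassigned_not_basin by (auto simp: agg_states_eq)
next
  case False
  then obtain j j' where j: "j \<in> roots" "s = lm j" "j' \<in> roots" "s' = lm j'"
    using assms by (auto simp: agg_states_eq agg_minima_eq)
  then obtain t k t' k' where "assigned i x t k" "chain i k j" "assigned i x t' k'" "chain i k' j'"
    using assms basin_assigned_iff by metis
  then have "j = j'" using owner_unique[of i x t k j t' k' j'] i_less j by (simp add: roots_def)
  then show ?thesis using j by simp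
qed

lemma basin_cover: "\<exists>s\<in>agg_states i. x \<in> basin i s"
proof (cases "x \<in> unassigned i")
  case True then show ?thesis using basin_unassigned by (auto simp: agg_states_eq)
next
  case False
  then obtain t k where "assigned i x t k" using unassigned_iff[of i x] i_ge i_less by auto
  then obtain j where j: "j \<in> {1..num_min}" "enat i < attr_level j" "x \<in> valley (min i j) (lm j)"
    using assigned_valley_exists[of i x t k] i_ge i_less by auto
  then have "j \<in> roots" by (simp add: roots_def)
  then show ?thesis using j basin_lm by (auto simp: agg_states_eq agg_minima_eq)
qed

lemma self_in_basin: "s \<in> agg_states i \<Longrightarrow> s \<in> basin i s"
proof -
  assume "s \<in> agg_states i"
  moreover have "lm j \<in> basin i (lm j)" if "j \<in> roots" for j
    using basinI[OF that _ chain_refl, of "lm j" 1] attracted_self[of 1 j] that i_ge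
    by (auto simp: assigned_def roots_def)
  ultimately show ?thesis using basin_unassigned by (auto simp: agg_states_eq agg_minima_eq)
qed

lemma agg_eq: "s \<in> agg_states i \<Longrightarrow> x \<in> basin i s \<Longrightarrow> agg i x = s"
  unfolding agg_def using basin_disjoint by blast

lemma agg_in: "agg i x \<in> agg_states i" "x \<in> basin i (agg i x)"
  using basin_cover[of x] agg_eq by auto

lemma unassigned_above_basin:
  assumes "n \<in> unassigned i" "a \<in> agg_minima i" "x \<in> basin i a" "adj x n"
  shows "E x < E n"
  using assms basin_assigned_iff unassigned_above[of n i x] i_less by (auto simp: agg_minima_eq)

text \<open>Of two adjacent states in different basins the lower one would inherit the attraction of
  the higher one by \<open>atr_downhill\<close>, against the uniqueness of the owner.\<close>

lemma boundary_unassigned: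
  assumes a: "a \<in> agg_minima i" shows "outer_boundary (basin i a) \<subseteq> unassigned i"
proof
  fix y assume "y \<in> outer_boundary (basin i a)"
  then obtain x where xy: "y \<notin> basin i a" "x \<in> basin i a" "adj x y" by (auto simp: outer_boundary_def neighbour_def)
  have same: "b = c" if uv: "b \<in> agg_minima i" "c \<in> agg_minima i" "u \<in> basin i b" "v \<in> basin i c"
    "adj u v" "E u < E v" for b c u v
  proof -
    from uv(1,2) obtain j j' where j: "j \<in> roots" "b = lm j" "j' \<in> roots" "c = lm j'"
      unfolding agg_minima_eq by blast
    obtain t k where tk: "assigned i v t k" "chain i k j'"
      using uv(4) basin_assigned_iff[OF j(3)] j(4) by blast
    then have t: "1 \<le> t" "t \<le> i" "k \<in> {t..num_min}" "attracted t v (lm k)" by (auto simp: assigned_def)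
    then have "attracted t u (lm k)"
      using atr_downhill[OF that(5,6), of "metastable t"] i_less by (simp add: attracted_atr)
    then have "assigned i u t k" using t by (simp add: assigned_def)
    then have "u \<in> basin i c" using basinI tk j by blast
    moreover have "b \<in> agg_states i" "c \<in> agg_states i" using that(1,2) by (simp_all add: agg_states_eq)
    ultimately show ?thesis using basin_disjoint that(3) by blast
  qed
  show "y \<in> unassigned i"
  proof (rule ccontr)
    assume "y \<notin> unassigned i"
    then obtain c where c: "c \<in> agg_minima i" "y \<in> basin i c"
      using basin_cover[of y] basin_unassigned by (auto simp: agg_states_eq)
    have "x \<noteq> y" using xy by auto
    then have "E x \<noteq> E y" using E_inj by (auto dest: injD)
    then have "E x < E y \<or> E y < E x" by auto
    then show False using same[OF a c(1) xy(2) c(2) xy(3)] same[OF c(1) a c(2) xy(2)] adj_sym[OF xy(3)] xy c by auto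
  qed
qed

lemma boundary_above:
  assumes "a \<in> agg_minima i" "y \<in> outer_boundary (basin i a)"
  shows "\<exists>x\<in>basin i a. adj x y \<and> E x < E y"
  using assms unassigned_above_basin[of y a] boundary_unassigned by (fastforce simp: outer_boundary_def neighbour_def)

text \<open>From a neighbour \<open>x\<close> inside, the owner is no farther than any survivor, and
  one survivor is reached from \<open>y\<close> without climbing. The argument runs at level
  \<open>min i j\<close>, where the basin of \<open>lm j\<close> was completed and
  \<open>lm j\<close> is still metastable.\<close>

lemma boundary_hgt:
  assumes a: "a \<in> agg_minima i" and y: "y \<in> outer_boundary (basin i a)"
  shows "hgt y a = E y"
proof -
  obtain x where x: "x \<in> basin i a" "adj x y" "E x < E y" using boundary_above assms by blast
  obtain j where j: "j \<in> roots" "a = lm j" using a by (auto simp: agg_minima_eq)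
  let ?l = "min i j"
  have l: "1 \<le> ?l" "?l \<le> num_min" "?l \<le> i" "j \<in> {?l..num_min}" using i_ge i_less j by (auto simp: roots_def)
  obtain t k where tk: "assigned ?l x t k" "chain ?l k j" using basin_assigned x j by metis
  have "y \<in> unassigned ?l" using boundary_unassigned a y unassigned_antimono[of ?l i] l i_less by auto
  then obtain b where b: "b \<in> metastable ?l" "conn (sub (E y) - strict (metastable ?l) (lm j)) y b"
    using unassigned_conn[of y ?l j] l by auto
  then have "hgt y b \<le> E y" using conn_mono[of _ y b "sub (E y)"] by (auto simp: hgt_le_iff)
  moreover have xy: "hgt x y = E y" using hgt_adj x by simp
  ultimately have "hgt x b \<le> E y" using hgt_ultra[of x b y] by simp
  then have "hgt x a \<le> E y" using chain_hgt[OF tk b(1) l(2)] j by simp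
  then have "hgt y a \<le> E y" using hgt_ultra[of y a x] hgt_sym[of y x] xy by simp
  then show ?thesis using hgt_ge(1)[of y a] by simp
qed

text \<open>Only \<open>j < i\<close> is at stake. If the ball at level \<open>i\<close> were
  larger, consider the last minimum within the height of \<open>s\<close> from \<open>lm j\<close>.
  It precedes level \<open>i\<close> and attracts \<open>lm j\<close> at its own level, so that
  \<open>lm j\<close> would have been absorbed.\<close>

lemma strict_valley_root:
  assumes j: "j \<in> roots"
  shows "strict_valley i (lm j) = strict_valley (min i j) (lm j)"
proof (cases "j < i")
  case True
  have j1: "1 \<le> j" using j by (simp add: roots_def)
  have "strict (metastable i) (lm j) \<subseteq> strict (metastable j) (lm j)"
  proof
    fix s assume s: "s \<in> strict (metastable i) (lm j)"
    show "s \<in> strict (metastable j) (lm j)"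
    proof (rule ccontr)
      assume "\<not> ?thesis"
      then obtain b where b: "b \<in> metastable j - {lm j}" "hgt (lm j) b \<le> hgt s (lm j)"
        by (force simp: strict_iff)
      then obtain q0 where q0: "b = lm q0" "q0 \<in> {j..num_min}" using in_metastableE[of b j] j1 by auto
      define Q where "Q = {q \<in> {1..num_min}. j < q \<and> hgt (lm j) (lm q) \<le> hgt s (lm j)}"
      have "q0 \<noteq> j" using b q0 by auto
      then have "q0 \<in> Q" using b q0 j1 by (simp add: Q_def)
      then have Q: "finite Q" "Q \<noteq> {}" by (auto simp: Q_def)
      define q where "q = Max Q"
      have q: "q \<in> {1..num_min}" "j < q" "hgt (lm j) (lm q) \<le> hgt s (lm j)"
        using Max_in[OF Q] by (auto simp: q_def Q_def)
      have "q < i"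
      proof (rule ccontr)
        assume "\<not> q < i"
        then have "lm q \<in> metastable i - {lm j}" using q lm_inj[of q j] j i_ge lm_in_metastable by (auto simp: roots_def)
        then show False using s q by (force simp: strict_iff)
      qed
      have "lm j \<in> strict (metastable q) (lm q)"
        unfolding strict_def
      proof (intro CollectI ballI)
        fix c assume c: "c \<in> metastable q - {lm q}"
        then obtain p where p: "c = lm p" "p \<in> {q..num_min}" using in_metastableE[of c q] q by auto
        then have "p \<noteq> q" using c by auto
        then have "p \<notin> Q" using Max_ge[OF Q(1), of p] p by (auto simp: q_def)
        then show "hgt (lm j) (lm q) < hgt (lm j) c" using p q \<open>p \<noteq> q\<close> by (auto simp: Q_def)
      qed
      then have "attracted q (lm j) (lm q)"
        using strict_imp_atr[of "lm q" "metastable q"] lm_in_metastable[of q q] q by (simp add: attracted_atr)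
      then have "attr_level j \<le> enat q" using attr_level_le q by simp
      moreover have "enat q < attr_level j" using \<open>q < i\<close> rootsD(2)[OF j]
        by (metis enat_ord_simps(2) less_trans)
      ultimately show False by simp
    qed
  qed
  then show ?thesis using True strict_antimono[OF metastable_antimono[of j i]] j1
    by (auto simp: strict_valley_eq min_def)
qed (simp add: min_def)

lemma strict_valley_basin:
  assumes "a \<in> agg_minima i" shows "strict_valley i a \<subseteq> basin i a"
proof
  fix s assume s: "s \<in> strict_valley i a"
  obtain j where j: "j \<in> roots" "a = lm j" using assms by (auto simp: agg_minima_eq)
  let ?l = "min i j"
  have l: "1 \<le> ?l" "?l \<le> num_min" "?l \<le> i" "j \<in> {?l..num_min}" using i_ge i_less j by (auto simp: roots_def)
  have "s \<in> strict (metastable ?l) (lm j)" using s j strict_valley_root by (simp add: strict_valley_eq)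
  then have "attracted ?l s (lm j)"
    using strict_imp_atr[of "lm j" "metastable ?l" s] l lm_in_metastable[of ?l j] by (simp add: attracted_atr)
  then have "assigned i s ?l j" using l by (simp add: assigned_def)
  then show "s \<in> basin i a" using basinI chain_refl j by blast
qed

lemma strict_valley_less:
  assumes "a \<in> agg_minima i" "w \<in> strict_valley i a" "y \<notin> basin i a"
  shows "hgt w a < hgt w y"
proof (rule ccontr)
  assume "\<not> ?thesis"
  then have "hgt y a \<le> hgt w a" using hgt_ultra[of y a w] hgt_sym[of y w] by simp
  then have "y \<in> strict_valley i a" using assms(2) strict_closed by (simp add: strict_valley_eq)
  then show False using strict_valley_basin assms by blast
qed

lemma self_strict_valley: "a \<in> agg_minima i \<Longrightarrow> a \<in> strict_valley i a"
proof -
  assume "a \<in> agg_minima i"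
  then obtain j where j: "j \<in> roots" "a = lm j" by (auto simp: agg_minima_eq)
  then have "a \<in> local_minima" using lm_bij by (auto simp: roots_def bij_betw_def)
  then show ?thesis using local_minima_hgt metastable_local_minima[OF i_ge]
    unfolding strict_valley_eq strict_iff hgt_self by blast
qed

text \<open>A state is ranked by the largest label \<open>k\<close> that attracts it on a chain to
  the owner, and \<open>R\<close> is the strict valley of \<open>lm k\<close> at that level. A low
  path to the boundary must meet \<open>R\<close>: from the non-assigned end another minimum could
  be reached around \<open>R\<close>, against the attraction of \<open>x\<close>. If
  \<open>k\<close> is the owner, \<open>R\<close> lies in the strict valley of \<open>a\<close>. If
  not, every state of \<open>R\<close> is also attracted by the minimum that absorbs
  \<open>lm k\<close>, and this one has a larger label.\<close>

lemma basin_rank: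
  assumes a: "a \<in> agg_minima i"
  shows "\<exists>rk :: 's \<Rightarrow> nat. (\<forall>x. rk x \<le> num_min) \<and> (\<forall>x\<in>basin i a. \<exists>R\<subseteq>basin i a.
     (R \<subseteq> strict_valley i a \<or> (\<forall>w\<in>R. rk x < rk w)) \<and>
     (\<forall>y\<in>outer_boundary (basin i a). hgt x y \<le> hgt x a \<longrightarrow> \<not> conn (sub (hgt x y) - R) x y))"
proof -
  obtain j where j: "j \<in> roots" "a = lm j" using a by (auto simp: agg_minima_eq)
  define l where "l = min i j"
  have l: "1 \<le> l" "l \<le> num_min" "l \<le> i" "j \<in> {l..num_min}" using i_ge i_less j by (auto simp: roots_def l_def)
  define Ks where "Ks x = {k. \<exists>t. assigned l x t k \<and> chain l k j}" for x
  have Ks_sub: "Ks x \<subseteq> {..num_min}" for x by (auto simp: Ks_def assigned_def)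
  have fin: "finite (Ks x)" for x using Ks_sub finite_subset by blast
  define rk where "rk x = (if Ks x = {} then 0 else Max (Ks x))" for x
  have rk_le: "rk x \<le> num_min" for x using Max_in[OF fin, of x] Ks_sub[of x] by (auto simp: rk_def)
  have basin: "x \<in> basin i a \<longleftrightarrow> Ks x \<noteq> {}" for x
  proof
    assume "x \<in> basin i a"
    then obtain t k where "assigned l x t k" "chain l k j" using basin_assigned j unfolding l_def by blast
    then show "Ks x \<noteq> {}" by (auto simp: Ks_def)
  next
    assume "Ks x \<noteq> {}"
    then obtain t k where "assigned l x t k" "chain l k j" by (auto simp: Ks_def)
    then have "assigned i x t k" "chain i k j" using l by (auto intro: assigned_mono chain_mono)
    then show "x \<in> basin i a" using basinI j by blast
  qed
  have "\<exists>R\<subseteq>basin i a.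
     (R \<subseteq> strict_valley i a \<or> (\<forall>w\<in>R. rk x < rk w)) \<and>
     (\<forall>y\<in>outer_boundary (basin i a). hgt x y \<le> hgt x a \<longrightarrow> \<not> conn (sub (hgt x y) - R) x y)"
    if x: "x \<in> basin i a" for x
  proof -
    have ne: "Ks x \<noteq> {}" using basin x by simp
    define k where "k = Max (Ks x)"
    have k: "k \<in> Ks x" using Max_in[OF fin ne] k_def by simp
    then obtain t where tk: "assigned l x t k" "chain l k j" by (auto simp: Ks_def)
    have kmax: "k' \<le> k" if "assigned l x t' k'" "chain l k' j" for t' k'
      using Max_ge[OF fin, of k' x] that unfolding k_def Ks_def by blast
    have t: "1 \<le> t" "t \<le> l" "t \<le> num_min" "k \<in> {t..num_min}" "attracted t x (lm k)"
      using tk l by (auto simp: assigned_def)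
    have atr: "atr (metastable t) x (lm k)" using t by (simp add: attracted_atr)
    define R where "R = strict (metastable t) (lm k)"
    \<comment> \<open>The maximality of \<open>k\<close> enters here. It places low paths to the
      boundary below the height of \<open>lm k\<close>, where the attraction of \<open>x\<close> can
      be used.\<close>
    have hk: "hgt x a \<le> hgt x (lm k)"
    proof (rule ccontr)
      assume "\<not> ?thesis"
      then have "\<exists>t k'. k < k' \<and> assigned l x t k' \<and> chain l k' j"
        using chain_climb[OF tk(2) t(1), of x] t l atr j by (auto simp: atr_def)
      then show False using kmax by fastforce
    qed
    have hits: "\<not> conn (sub (hgt x y) - R) x y" if y: "y \<in> outer_boundary (basin i a)" "hgt x y \<le> hgt x a" for y
    proof
      assume xy: "conn (sub (hgt x y) - R) x y"
      have "y \<in> unassigned t" using boundary_unassigned[OF a] y unassigned_antimono[of t i] t l i_less by auto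
      then obtain b where b: "b \<in> metastable t - {lm k}" "conn (sub (E y) - R) y b"
        using unassigned_conn[of y t k] t unfolding R_def by blast
      have "conn (sub (hgt x (lm k)) - R) y b" using b(2)
        by (rule conn_mono) (use hgt_ge(2)[of y x] y hk in auto)
      moreover have "conn (sub (hgt x (lm k)) - R) x y" using xy by (rule conn_mono) (use y hk in auto)
      ultimately have "conn (sub (hgt x (lm k)) - R) x b" by (metis conn_trans)
      then show False using atr b(1) unfolding R_def atr_def by blast
    qed
    show ?thesis
    proof (cases "k = j")
      case True
      have "R \<subseteq> strict (metastable l) (lm j)" unfolding R_def True
        by (rule strict_antimono[OF metastable_antimono]) (use t in auto)
      also have "\<dots> = strict_valley i a" using strict_valley_root[OF j(1)] j by (simp add: strict_valley_eq l_def)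
      finally show ?thesis using hits strict_valley_basin[OF a] by blast
    next
      case False
      from tk(2) obtain s k1 where s: "attr_level k = enat s" "s \<le> l" "attracted s (lm k) (lm k1)"
         "k1 \<in> {s..num_min}" "chain l k1 j"
        using False by (cases rule: chain.cases) auto
      have ks: "k < s" "s \<le> num_min" using attr_level_enat[OF s(1)] by auto
      have w: "k1 \<in> Ks w" if w: "w \<in> R" for w
      proof -
        have "lm k1 \<in> metastable t - {lm k}"
          using lm_in_metastable[of t k1] lm_inj[of k k1] s ks t by auto
        then have "hgt w (lm k) < hgt w (lm k1)" using w unfolding R_def strict_def by blast
        moreover have "atr (metastable s) (lm k) (lm k1)" using s ks by (simp add: attracted_atr)
        ultimately have "atr (metastable s) w (lm k1)" using atr_transfer by blast
        then have "assigned l w s k1" using s ks by (simp add: assigned_def attracted_atr)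
        then show ?thesis using s by (auto simp: Ks_def)
      qed
      have "rk x < rk w" if "w \<in> R" for w
      proof -
        have "k1 \<le> rk w" using w[OF that] Max_ge[OF fin] by (auto simp: rk_def)
        then show ?thesis using ks s(4) ne by (simp add: rk_def k_def[symmetric])
      qed
      moreover have "R \<subseteq> basin i a" using w basin by blast
      ultimately show ?thesis using hits by blast
    qed
  qed
  then show ?thesis using rk_le by (intro exI[of _ rk] conjI allI ballI)
qed

lemma unassigned_downhill: "n \<in> unassigned i \<Longrightarrow> \<exists>y. adj n y \<and> E y < E n"
proof (rule ccontr)
  assume n: "n \<in> unassigned i" "\<nexists>y. adj n y \<and> E y < E n"
  have "n \<in> local_minima" unfolding local_minima_def neighbour_def
  proof (intro CollectI allI impI, elim conjE)
    fix r assume "r \<noteq> n" "adj r n"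
    then show "E n < E r" using n adj_sym[of r n] E_inj by (metis injD linorder_less_linear)
  qed
  then obtain j where "j \<in> {1..num_min}" "n = lm j" by (rule local_minimaE)
  then show False using lm_not_unassigned n by auto
qed

lemma root_ge: "i \<le> q \<Longrightarrow> q \<le> num_min \<Longrightarrow> q \<in> roots"
  using attr_level_gt[of q] i_ge unfolding roots_def by (simp add: le_less_trans[OF _ attr_level_gt])

lemma two_agg_minima: "\<exists>b\<in>agg_minima i. b \<noteq> a"
proof -
  have "lm i \<in> agg_minima i" "lm num_min \<in> agg_minima i" "lm i \<noteq> lm num_min"
    using root_ge[of i] root_ge[of num_min] i_less i_ge lm_inj[of i num_min] by (auto simp: agg_minima_eq)
  then show ?thesis by metis
qed

end

section \<open>Hitting probabilities of reversible chains\<close>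

locale rev_chain =
  fixes q :: "'s::finite \<Rightarrow> 's \<Rightarrow> real" and \<mu> :: "'s \<Rightarrow> real"
  assumes q_nonneg: "q x y \<ge> 0"
    and q_sum: "(\<Sum>y\<in>UNIV. q x y) = 1"
    and q_irreducible: "(\<lambda>x y. q x y > 0)\<^sup>*\<^sup>* x y"
    and \<mu>_pos: "\<mu> x > 0"
    and balance: "\<mu> x * q x y = \<mu> y * q y x"
begin

definition avg :: "('s \<Rightarrow> real) \<Rightarrow> 's \<Rightarrow> real" where
  "avg f x = (\<Sum>y\<in>UNIV. q x y * f y)"

definition cond :: "'s \<Rightarrow> 's \<Rightarrow> real" where "cond x y = \<mu> x * q x y"

definition lap :: "('s \<Rightarrow> real) \<Rightarrow> 's \<Rightarrow> real" where
  "lap f x = (\<Sum>y\<in>UNIV. cond x y * (f x - f y))"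

lemma cond_nonneg: "cond x y \<ge> 0"
  using \<mu>_pos[of x] q_nonneg[of x y] by (simp add: cond_def)

lemma cond_sym: "cond x y = cond y x"
  using balance by (simp add: cond_def)

lemma lap_eq: "lap f x = \<mu> x * (f x - avg f x)"
proof -
  have "lap f x = (\<Sum>y\<in>UNIV. \<mu> x * (f x * q x y - q x y * f y))"
    by (simp add: lap_def cond_def algebra_simps)
  also have "\<dots> = \<mu> x * (f x * (\<Sum>y\<in>UNIV. q x y) - avg f x)"
    by (simp add: avg_def sum_subtractf flip: sum_distrib_left)
  finally show ?thesis by (simp add: q_sum)
qed

lemma lap_zero: "f x = avg f x \<Longrightarrow> lap f x = 0"
  by (simp add: lap_eq)

text \<open>Irreducibility carries a positive maximum to all states, hence out of \<open>D\<close>.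
  Questions of recurrence are settled through this principle.\<close>

lemma max_principle:
  assumes sub: "\<And>x. x \<in> D \<Longrightarrow> f x \<le> avg f x" and off: "\<And>x. x \<notin> D \<Longrightarrow> f x \<le> 0" and D: "D \<noteq> UNIV"
  shows "f x \<le> 0"
proof (rule ccontr)
  assume fx: "\<not> f x \<le> 0"
  define m where "m = Max (range f)"
  have le: "f y \<le> m" for y by (simp add: m_def)
  have "m \<in> range f" unfolding m_def by (intro Max_in) auto
  then obtain z where z: "f z = m" by auto
  have "m > 0" using le[of x] fx by simp
  have step: "f y' = m" if "f y = m" "q y y' > 0" for y y'
  proof (rule ccontr)
    assume "f y' \<noteq> m"
    then have "f y' < m" using le[of y'] by simp
    have "y \<in> D" using off[of y] that \<open>m > 0\<close> by force
    then have "m \<le> avg f y" using sub that by force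
    also have "\<dots> < (\<Sum>u\<in>UNIV. q y u * m)" unfolding avg_def
    proof (rule sum_strict_mono_ex1)
      show "\<exists>u\<in>UNIV. q y u * f u < q y u * m" using \<open>f y' < m\<close> that by (intro bexI[of _ y']) auto
    qed (use le q_nonneg in \<open>auto intro: mult_left_mono\<close>)
    also have "\<dots> = m" using q_sum[of y] by (simp flip: sum_distrib_right)
    finally show False by simp
  qed
  have "f y = m" for y
    using q_irreducible[of z y] by (induction rule: rtranclp_induct) (use z step in auto)
  moreover obtain y where "y \<notin> D" using D by auto
  ultimately show False using off[of y] \<open>m > 0\<close> by simp
qed

lemma avg_diff: "avg (\<lambda>x. f x - g x) x = avg f x - avg g x"
  by (simp add: avg_def algebra_simps sum_subtractf)

lemma avg_add: "avg (\<lambda>x. f x + g x) x = avg f x + avg g x"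
  by (simp add: avg_def algebra_simps sum.distrib)

lemma avg_cmult: "avg (\<lambda>x. f x * c) x = avg f x * c"
  by (simp add: avg_def sum_distrib_right mult.assoc)

lemma avg_const: "avg (\<lambda>x. c) x = c"
  using q_sum[of x] by (simp add: avg_def flip: sum_distrib_right)

lemma comparison:
  assumes "\<And>x. x \<in> D \<Longrightarrow> f x \<le> avg f x" "\<And>x. x \<in> D \<Longrightarrow> avg g x \<le> g x"
    "\<And>x. x \<notin> D \<Longrightarrow> f x \<le> g x" "D \<noteq> UNIV"
  shows "f x \<le> g x"
  using max_principle[of D "\<lambda>x. f x - g x" x] assms by (fastforce simp: avg_diff)

text \<open>The sum runs over ordered pairs, so this is twice the usual Dirichlet form; hence the
  factor 2 in \<open>dform_lap\<close>.\<close>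

definition dform :: "('s \<Rightarrow> real) \<Rightarrow> ('s \<Rightarrow> real) \<Rightarrow> real" where
  "dform f g = (\<Sum>x\<in>UNIV. \<Sum>y\<in>UNIV. cond x y * ((f x - f y) * (g x - g y)))"

lemma dform_lap: "dform f g = 2 * (\<Sum>x\<in>UNIV. g x * lap f x)"
proof -
  have a: "(\<Sum>x\<in>UNIV. \<Sum>y\<in>UNIV. cond x y * ((f x - f y) * g x)) = (\<Sum>x\<in>UNIV. g x * lap f x)"
    by (simp add: lap_def sum_distrib_left algebra_simps)
  have b: "(\<Sum>x\<in>UNIV. \<Sum>y\<in>UNIV. cond x y * ((f x - f y) * - g y)) = (\<Sum>x\<in>UNIV. g x * lap f x)"
    by (subst sum.swap, subst a[symmetric], intro sum.cong refl) (simp add: cond_sym algebra_simps)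
  have "dform f g = (\<Sum>x\<in>UNIV. \<Sum>y\<in>UNIV. cond x y * ((f x - f y) * g x) + cond x y * ((f x - f y) * - g y))"
    by (simp add: dform_def algebra_simps)
  also have "\<dots> = 2 * (\<Sum>x\<in>UNIV. g x * lap f x)"
    using a b by (simp only: sum.distrib)
  finally show ?thesis .
qed

lemma dform_sym: "dform f g = dform g f"
  by (simp add: dform_def mult.commute)

lemma green: "(\<Sum>x\<in>UNIV. g x * lap f x) = (\<Sum>x\<in>UNIV. f x * lap g x)"
  using dform_lap[of f g] dform_lap[of g f] dform_sym[of f g] by simp

text \<open>Truncating the potential at its value in \<open>x\<close> makes the Dirichlet form linear in that
  value; a plain Cauchy--Schwarz estimate would lose a square root.\<close>

lemma hitting_bound:
  assumes z: "u z = 0" and B: "\<And>b. b \<in> B \<Longrightarrow> u b = 1"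
    and harm: "\<And>x. x \<notin> B \<Longrightarrow> x \<noteq> z \<Longrightarrow> u x = avg u x"
    and range: "\<And>x. 0 \<le> u x" "\<And>x. u x \<le> 1"
    and G: "z \<in> G" "G \<inter> B = {}" and cut: "\<And>a b. a \<in> G \<Longrightarrow> b \<notin> G \<Longrightarrow> cond a b \<le> c1" and c1: "0 \<le> c1"
    and path: "(\<lambda>a b. c0 \<le> cond a b)\<^sup>*\<^sup>* x z" and c0: "0 < c0"
  shows "u x * c0 \<le> real (card (UNIV :: 's set)) ^ 6 * c1"
proof -
  let ?N = "real (card (UNIV :: 's set))"
  define t where "t = u x"
  have t: "0 \<le> t" "t \<le> 1" using range by (auto simp: t_def)
  define v where "v = (\<lambda>a. min (u a) t)"
  \<comment> \<open>The total current leaving \<open>B\<close>. Testing with the indicator of the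
    complement of \<open>G\<close> shows that it all crosses the boundary of \<open>G\<close>, where
    every conductance is at most \<open>c1\<close>.\<close>
  define I where "I = (\<Sum>b\<in>B. lap u b)"
  have lap0: "lap u a = 0" if "a \<notin> B" "a \<noteq> z" for a using harm that lap_zero by blast
  have zB: "z \<notin> B" using G by auto
  have "dform u (\<lambda>a. if a \<in> G then 0 else 1) = 2 * (\<Sum>a\<in>UNIV. (if a \<in> G then 0 else 1) * lap u a)"
    by (rule dform_lap)
  also have "(\<Sum>a\<in>UNIV. (if a \<in> G then 0 else 1) * lap u a) = I"
    unfolding I_def by (rule sum.mono_neutral_cong_right) (use G lap0 in auto)
  finally have I: "2 * I = dform u (\<lambda>a. if a \<in> G then 0 else 1)" by simp
  also have "\<dots> \<le> (\<Sum>a\<in>(UNIV :: 's set). \<Sum>b\<in>(UNIV :: 's set). c1)" unfolding dform_def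
  proof (intro sum_mono)
    fix a b
    have d: "\<bar>u a - u b\<bar> \<le> 1" using range[of a] range[of b] by linarith
    show "cond a b * ((u a - u b) * ((if a \<in> G then 0 else 1) - (if b \<in> G then 0 else 1))) \<le> c1"
    proof (cases "(a \<in> G) = (b \<in> G)")
      case True then show ?thesis using c1 by auto
    next
      case False
      then have "cond a b \<le> c1" using cut cond_sym by metis
      moreover have "(u a - u b) * ((if a \<in> G then 0 else 1) - (if b \<in> G then 0 else 1)) \<le> 1"
        using d False by auto
      ultimately show ?thesis using cond_nonneg[of a b] c1
        by (smt (verit) mult_left_le mult_left_mono)
    qed
  qed
  also have "\<dots> = ?N\<^sup>2 * c1" by (simp add: power2_eq_square)
  finally have I_le: "2 * I \<le> ?N\<^sup>2 * c1" .
  have "dform v v \<le> dform u v" unfolding dform_def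
  proof (intro sum_mono mult_left_mono cond_nonneg)
    fix a b show "(v a - v b) * (v a - v b) \<le> (u a - u b) * (v a - v b)"
      unfolding v_def min_def by (auto simp: mult_right_mono mult_right_mono_neg)
  qed
  also have "\<dots> = 2 * (\<Sum>a\<in>UNIV. v a * lap u a)" by (rule dform_lap)
  also have "(\<Sum>a\<in>UNIV. v a * lap u a) = (\<Sum>b\<in>B. t * lap u b)"
  proof (rule sum.mono_neutral_cong_right)
    show "\<forall>a\<in>UNIV - B. v a * lap u a = 0"
    proof
      fix a assume "a \<in> UNIV - B"
      then show "v a * lap u a = 0" using lap0[of a] z t by (cases "a = z") (auto simp: v_def)
    qed
  qed (use t B in \<open>auto simp: v_def\<close>)
  also have "2 * \<dots> = t * (2 * I)" by (simp add: I_def sum_distrib_left ac_simps)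
  also have "\<dots> \<le> t * (?N\<^sup>2 * c1)" using I_le t by (intro mult_left_mono) auto
  finally have vv: "dform v v \<le> t * (?N\<^sup>2 * c1)" .
  have sq: "0 \<le> cond a b * ((v a - v b) * (v a - v b))" for a b
    by (rule mult_nonneg_nonneg[OF cond_nonneg]) simp
  have edge: "c0 * (v a - v b)\<^sup>2 \<le> t * (?N\<^sup>2 * c1)" if "c0 \<le> cond a b" for a b
  proof -
    have "c0 * (v a - v b)\<^sup>2 \<le> cond a b * ((v a - v b) * (v a - v b))"
      using that by (simp add: power2_eq_square mult_right_mono)
    also have "\<dots> \<le> (\<Sum>b\<in>UNIV. cond a b * ((v a - v b) * (v a - v b)))"
      by (rule member_le_sum) (auto intro: sq)
    also have "\<dots> \<le> dform v v" unfolding dform_def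
      by (rule member_le_sum[of a UNIV "\<lambda>a. \<Sum>b\<in>UNIV. cond a b * ((v a - v b) * (v a - v b))"])
        (auto intro!: sum_nonneg sq)
    finally show ?thesis using vv by simp
  qed
  define R where "R = {(a, b). c0 \<le> cond a b}"
  define s where "s = sqrt (t * (?N\<^sup>2 * c1) / c0)"
  have s: "s \<ge> 0" "c0 * s\<^sup>2 = t * (?N\<^sup>2 * c1)" using t c1 c0 by (auto simp: s_def)
  have diff: "v a - v b \<le> s" if "(a, b) \<in> R" for a b
  proof -
    have "c0 * (v a - v b)\<^sup>2 \<le> c0 * s\<^sup>2" using edge[of a b] that s by (simp add: R_def)
    then have "(v a - v b)\<^sup>2 \<le> s\<^sup>2" using c0 by simp
    then show ?thesis using s(1) by (rule power2_le_imp_le)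
  qed
  have walk: "v a - v b \<le> real k * s" if "(a, b) \<in> R ^^ k" for a b k
    using that
  proof (induction k arbitrary: b)
    case (Suc k)
    then obtain d where "(a, d) \<in> R ^^ k" "(d, b) \<in> R" by auto
    then show ?case using Suc.IH[of d] diff[of d b] by (simp add: algebra_simps)
  qed simp
  have "(x, z) \<in> R\<^sup>*" using path by (simp add: R_def rtrancl_def)
  then obtain k where k: "(x, z) \<in> R ^^ k" using rtrancl_imp_relpow by blast
  \<comment> \<open>The walk can be shortened to \<open>card R\<close> steps, at most
    \<open>?N\<^sup>2\<close>. Squared, and multiplied by the \<open>?N\<^sup>2\<close> of the
    current bound, this gives the exponent 6.\<close>
  have "\<exists>k\<le>card R. (x, z) \<in> R ^^ k"
  proof (cases "k = 0")
    case True then show ?thesis using k by blast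
  next
    case False
    then show ?thesis using k relpow_finite_bounded1[of R k] by fastforce
  qed
  then obtain k where k: "k \<le> card R" "(x, z) \<in> R ^^ k" by blast
  have "card R \<le> card (UNIV :: ('s \<times> 's) set)" by (rule card_mono) auto
  also have "\<dots> = card (UNIV :: 's set) ^ 2"
    using card_cartesian_product[of "UNIV :: 's set" "UNIV :: 's set"] by (simp add: power2_eq_square)
  finally have "real k \<le> ?N\<^sup>2" using k(1) by (metis of_nat_le_iff of_nat_power order_trans)
  then have "t \<le> ?N\<^sup>2 * s" using walk[OF k(2)] s z t mult_right_mono[of "real k" "?N\<^sup>2" s]
    by (simp add: v_def t_def)
  then have "t\<^sup>2 \<le> (?N\<^sup>2 * s)\<^sup>2" using t by (intro power_mono) auto
  then have "c0 * t\<^sup>2 \<le> c0 * (?N\<^sup>2 * s)\<^sup>2" using c0 by simp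
  also have "\<dots> = ?N ^ 4 * (c0 * s\<^sup>2)" by (simp add: power_mult_distrib)
  also have "\<dots> = t * (?N ^ 6 * c1)" unfolding s(2) by (simp add: algebra_simps flip: power_add)
  finally have "t * (t * c0) \<le> t * (?N ^ 6 * c1)" by (simp add: power2_eq_square algebra_simps)
  then show ?thesis using t c1 by (cases "t = 0") (auto simp: t_def)
qed

text \<open>Here \<open>f\<close> is the potential of reaching \<open>m\<close> before leaving
  \<open>V\<close>, and \<open>g\<close> that of leaving at \<open>y\<close>. Green's formula
  expresses \<open>g m\<close> as the current of \<open>f\<close> into \<open>y\<close> divided by
  its total current out of \<open>V\<close>. The single edge from \<open>w\<close> to
  \<open>y\<close> bounds the numerator from below, the cut bounds the denominator from above, and
  \<open>comparison\<close> transfers the bound from \<open>m\<close> to \<open>x\<close>.\<close>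

lemma exit_bound:
  assumes V: "m \<in> V" "y \<notin> V" "w \<in> V"
    and f: "f m = 1" "\<And>a. a \<notin> V \<Longrightarrow> f a = 0" "\<And>a. a \<in> V \<Longrightarrow> a \<noteq> m \<Longrightarrow> f a = avg f a" "\<And>a. 0 \<le> f a" "\<And>a. f a \<le> 1"
    and g: "g y = 1" "\<And>a. a \<notin> V \<Longrightarrow> a \<noteq> y \<Longrightarrow> g a = 0" "\<And>a. a \<in> V \<Longrightarrow> g a = avg g a" "\<And>a. 0 \<le> g a"
    and cut: "\<And>a b. a \<in> V \<Longrightarrow> b \<notin> V \<Longrightarrow> cond a b \<le> c1" and c1: "0 \<le> c1"
  shows "cond w y * f w * f x \<le> g x * (real (card (UNIV :: 's set)) ^ 2 * c1)"
proof -
  let ?N = "real (card (UNIV :: 's set))"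
  have lapf: "lap f a = 0" if "a \<in> V" "a \<noteq> m" for a using f that lap_zero by blast
  have lapg: "lap g a = 0" if "a \<in> V" for a using g that lap_zero by blast
  have my: "m \<noteq> y" using V by auto
  have "(\<Sum>a\<in>UNIV. f a * lap g a) = 0"
  proof (rule sum.neutral, rule ballI)
    fix a show "f a * lap g a = 0" using f(2)[of a] lapg[of a] by (cases "a \<in> V") auto
  qed
  then have "0 = (\<Sum>a\<in>UNIV. g a * lap f a)" using green[of g f] by simp
  also have "\<dots> = (\<Sum>a\<in>{m, y}. g a * lap f a)"
    by (rule sum.mono_neutral_right) (use g lapf in auto)
  finally have bal: "g m * lap f m = - lap f y" using my g by simp
  have "cond w y * f w \<le> (\<Sum>b\<in>UNIV. cond y b * f b)"
    using member_le_sum[of w UNIV "\<lambda>b. cond y b * f b"] cond_nonneg f cond_sym by simp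
  also have "\<dots> = - lap f y" using f V by (simp add: lap_def sum_negf)
  finally have 1: "cond w y * f w \<le> g m * lap f m" using bal by simp
  have "lap f m + (\<Sum>a\<in>-V. lap f a) = (\<Sum>a\<in>insert m (-V). lap f a)"
    using V by (subst sum.insert) auto
  also have "\<dots> = (\<Sum>a\<in>UNIV. 1 * lap f a)"
    by (rule sum.mono_neutral_cong_left) (use lapf in auto)
  also have "\<dots> = (\<Sum>a\<in>UNIV. f a * lap (\<lambda>_. 1) a)" by (rule green)
  also have "\<dots> = 0" by (simp add: lap_def)
  finally have "lap f m = - (\<Sum>a\<in>-V. lap f a)" by simp
  also have "\<dots> = (\<Sum>a\<in>-V. \<Sum>b\<in>UNIV. cond a b * f b)"
    using f by (simp add: lap_def sum_negf)
  also have "\<dots> \<le> (\<Sum>a\<in>-V. \<Sum>b\<in>(UNIV :: 's set). c1)"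
  proof (intro sum_mono)
    fix a b assume a: "a \<in> -V"
    show "cond a b * f b \<le> c1"
    proof (cases "b \<in> V")
      case True
      have "cond a b * f b \<le> cond a b" using f cond_nonneg by (simp add: mult_left_le)
      then show ?thesis using cut[OF True, of a] a cond_sym[of a b] by simp
    qed (use f c1 in auto)
  qed
  also have "\<dots> \<le> (\<Sum>a\<in>(UNIV :: 's set). \<Sum>b\<in>(UNIV :: 's set). c1)"
    by (rule sum_mono2) (use c1 in auto)
  also have "\<dots> = ?N\<^sup>2 * c1" by (simp add: power2_eq_square)
  finally have 2: "g m * lap f m \<le> g m * (?N\<^sup>2 * c1)" using g by (simp add: mult_left_mono)
  have gx: "f x * g m \<le> g x"
  proof (rule comparison[of "V - {m}"])
    show "f x * g m \<le> avg (\<lambda>x. f x * g m) x" if "x \<in> V - {m}" for x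
      using that f(3)[of x] by (simp add: avg_cmult)
    show "avg g x \<le> g x" if "x \<in> V - {m}" for x using that g(3)[of x] by simp
    show "f x * g m \<le> g x" if "x \<notin> V - {m}" for x using that f g by auto
  qed auto
  have "cond w y * f w * f x \<le> (g m * (?N\<^sup>2 * c1)) * f x"
    using 1 2 f by (intro mult_right_mono) auto
  also have "\<dots> = f x * g m * (?N\<^sup>2 * c1)" by simp
  also have "\<dots> \<le> g x * (?N\<^sup>2 * c1)" using gx c1 by (intro mult_right_mono) auto
  finally show ?thesis .
qed

end

section \<open>The law of the trajectory\<close>

text \<open>All events are moved to the space of trajectories, where the chains for all starting
  states live together and can be shifted and concatenated.\<close>

definition TS :: "(nat \<Rightarrow> 's::finite) measure" where
  "TS = Pi\<^sub>M UNIV (\<lambda>_. count_space UNIV)"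

lemma space_TS: "space TS = UNIV"
  by (simp add: TS_def space_PiM PiE_def)

lemma measurable_coord: "(\<lambda>\<omega>. \<omega> n) \<in> measurable TS (count_space UNIV)"
  unfolding TS_def by (rule measurable_component_singleton) simp

abbreviation event :: "((nat \<Rightarrow> 's::finite) \<Rightarrow> bool) \<Rightarrow> bool" where
  "event \<Phi> \<equiv> {\<omega>. \<Phi> \<omega>} \<in> sets TS"

lemma event_conj: "event \<Phi> \<Longrightarrow> event \<Psi> \<Longrightarrow> event (\<lambda>\<omega>. \<Phi> \<omega> \<and> \<Psi> \<omega>)"
  by (metis Collect_conj_eq sets.Int)

lemma event_disj: "event \<Phi> \<Longrightarrow> event \<Psi> \<Longrightarrow> event (\<lambda>\<omega>. \<Phi> \<omega> \<or> \<Psi> \<omega>)"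
  by (metis Collect_disj_eq sets.Un)

lemma event_not: assumes "event \<Phi>" shows "event (\<lambda>\<omega>. \<not> \<Phi> \<omega>)"
proof -
  have "{\<omega>. \<not> \<Phi> \<omega>} = space TS - {\<omega>. \<Phi> \<omega>}" by (auto simp: space_TS)
  then show ?thesis using sets.compl_sets[OF assms] by simp
qed

lemma event_ex:
  fixes \<Phi> :: "'i::countable \<Rightarrow> (nat \<Rightarrow> 's::finite) \<Rightarrow> bool"
  assumes "\<And>n. event (\<Phi> n)" shows "event (\<lambda>\<omega>. \<exists>n. \<Phi> n \<omega>)"
proof -
  have "{\<omega>. \<exists>n. \<Phi> n \<omega>} = (\<Union>n. {\<omega>. \<Phi> n \<omega>})" by auto
  then show ?thesis using assms by auto
qed

lemma event_all:
  fixes \<Phi> :: "'i::countable \<Rightarrow> (nat \<Rightarrow> 's::finite) \<Rightarrow> bool"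
  assumes "\<And>n. event (\<Phi> n)" shows "event (\<lambda>\<omega>. \<forall>n. \<Phi> n \<omega>)"
  using event_not[OF event_ex[of "\<lambda>n \<omega>. \<not> \<Phi> n \<omega>"]] event_not[OF assms] by simp

lemma event_coord: "event (\<lambda>\<omega>. \<omega> n = a)"
  using measurable_sets[OF measurable_coord[of n], of "{a}"] by (simp add: vimage_def space_TS)

definition cyl :: "nat \<Rightarrow> (nat \<Rightarrow> 's) \<Rightarrow> (nat \<Rightarrow> 's) set" where
  "cyl n w = {\<omega>. \<forall>l\<le>n. \<omega> l = w l}"

lemma sets_cyl: "cyl n w \<in> sets TS"
proof -
  have "cyl n w = (\<Inter>l\<in>{..n}. {\<omega>. \<omega> l = w l})" by (auto simp: cyl_def)
  then show ?thesis by (simp only:) (intro sets.finite_INT event_coord, auto)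
qed

lemma prefix_union:
  fixes \<Phi> :: "(nat \<Rightarrow> 's::finite) \<Rightarrow> bool"
  assumes "\<And>\<omega> \<omega>'. (\<And>l. l \<le> n \<Longrightarrow> \<omega> l = \<omega>' l) \<Longrightarrow> \<Phi> \<omega> = \<Phi> \<omega>'"
  shows "\<exists>F. finite F \<and> {\<omega>. \<Phi> \<omega>} = (\<Union>w\<in>F. cyl n w)"
proof (intro exI conjI)
  let ?F = "{w \<in> {..n} \<rightarrow>\<^sub>E UNIV. \<Phi> w}"
  show "finite ?F" using finite_PiE[of "{..n}" "\<lambda>_. UNIV :: 's set"] by simp
  show "{\<omega>. \<Phi> \<omega>} = (\<Union>w\<in>?F. cyl n w)"
  proof safe
    fix \<omega> assume "\<Phi> \<omega>"
    then have "restrict \<omega> {..n} \<in> ?F" using assms[of \<omega> "restrict \<omega> {..n}"] by auto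
    moreover have "\<omega> \<in> cyl n (restrict \<omega> {..n})" by (simp add: cyl_def)
    ultimately show "\<omega> \<in> (\<Union>w\<in>?F. cyl n w)" by blast
  next
    fix \<omega> w assume "\<Phi> w" "\<omega> \<in> cyl n w"
    then show "\<Phi> \<omega>" using assms[of \<omega> w] by (simp add: cyl_def)
  qed
qed

lemma event_prefix:
  fixes \<Phi> :: "(nat \<Rightarrow> 's::finite) \<Rightarrow> bool"
  assumes "\<And>\<omega> \<omega>'. (\<And>l. l \<le> n \<Longrightarrow> \<omega> l = \<omega>' l) \<Longrightarrow> \<Phi> \<omega> = \<Phi> \<omega>'"
  shows "event \<Phi>"
proof -
  obtain F where "finite F" "{\<omega>. \<Phi> \<omega>} = (\<Union>w\<in>F. cyl n w)" using prefix_union[of n \<Phi>] assms by blast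
  then show ?thesis by (simp only:) (intro sets.finite_UN sets_cyl)
qed

definition cylinders :: "(nat \<Rightarrow> 's::finite) set set" where
  "cylinders = insert {} (range (\<lambda>(n, w). cyl n w))"

lemma Int_stable_cylinders: "Int_stable (cylinders :: (nat \<Rightarrow> 's::finite) set set)"
proof (rule Int_stableI)
  fix A B :: "(nat \<Rightarrow> 's) set" assume A: "A \<in> cylinders" and B: "B \<in> cylinders"
  have *: "cyl n w \<inter> cyl n' w' \<in> cylinders" if "n \<le> n'" for n n' and w w' :: "nat \<Rightarrow> 's"
  proof (cases "\<forall>l\<le>n. w l = w' l")
    case True
    then have "cyl n w \<inter> cyl n' w' = cyl n' w'" using that by (auto simp: cyl_def)
    then show ?thesis by (auto simp: cylinders_def)
  next
    case False
    then obtain l where l: "l \<le> n" "w l \<noteq> w' l" by auto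
    have "\<omega> \<notin> cyl n w \<inter> cyl n' w'" for \<omega>
    proof
      assume "\<omega> \<in> cyl n w \<inter> cyl n' w'"
      then have "\<omega> l = w l" "\<omega> l = w' l" using l that by (auto simp: cyl_def)
      then show False using l by simp
    qed
    then have "cyl n w \<inter> cyl n' w' = {}" by blast
    then show ?thesis by (simp add: cylinders_def)
  qed
  consider "A = {} \<or> B = {}" | n w n' w' where "A = cyl n w" "B = cyl n' w'"
    using A B by (auto simp: cylinders_def)
  then show "A \<inter> B \<in> cylinders"
  proof cases
    case 1 then show ?thesis by (auto simp: cylinders_def)
  next
    case 2
    then show ?thesis using *[of n n' w w'] *[of n' n w' w] by (cases "n \<le> n'") (auto simp: Int_commute)
  qed
qed

lemma sets_TS_sigma: "sets (TS :: (nat \<Rightarrow> 's::finite) measure) = sigma_sets UNIV cylinders"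
proof
  show "sigma_sets UNIV cylinders \<subseteq> sets (TS :: (nat \<Rightarrow> 's) measure)"
  proof -
    have "cylinders \<subseteq> sets (TS :: (nat \<Rightarrow> 's) measure)" using sets_cyl by (auto simp: cylinders_def)
    then show ?thesis using sets.sigma_sets_subset[of cylinders "TS :: (nat \<Rightarrow> 's) measure"]
      by (simp only: space_TS)
  qed
  have "{f. f i \<in> A} \<in> sigma_sets UNIV (cylinders :: (nat \<Rightarrow> 's) set set)" for i and A :: "'s set"
  proof -
    obtain F where F: "finite F" "{f. f i \<in> A} = (\<Union>w\<in>F. cyl i w)"
      using prefix_union[of i "\<lambda>f. f i \<in> A"] by auto
    interpret sigma_algebra UNIV "sigma_sets UNIV (cylinders :: (nat \<Rightarrow> 's) set set)"
      by (rule sigma_algebra_sigma_sets) simp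
    show ?thesis unfolding F(2)
      by (rule finite_UN[OF F(1)]) (auto intro!: sigma_sets.Basic simp: cylinders_def)
  qed
  then have "sigma_sets UNIV {{f. f i \<in> A} |i A. True} \<subseteq> sigma_sets UNIV (cylinders :: (nat \<Rightarrow> 's) set set)"
    by (intro sigma_sets_mono) auto
  then show "sets (TS :: (nat \<Rightarrow> 's) measure) \<subseteq> sigma_sets UNIV cylinders"
    by (simp add: TS_def sets_PiM_single PiE_def)
qed

section \<open>Shifted and concatenated trajectories\<close>

lemma measurable_case_nat_TS: "case_nat x \<in> measurable TS TS"
proof -
  have "(\<lambda>\<omega>. case_nat x \<omega> n) \<in> measurable TS (count_space UNIV)" for n
    by (cases n) (simp_all add: measurable_coord)
  then show ?thesis
    by (subst (2) TS_def, intro measurable_PiM_single') auto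
qed

lemma event_case_nat: "event \<Phi> \<Longrightarrow> event (\<lambda>\<omega>. \<Phi> (case_nat x \<omega>))"
  using measurable_sets[OF measurable_case_nat_TS, of "{\<omega>. \<Phi> \<omega>}" x] by (simp add: vimage_def space_TS)

text \<open>The strong Markov property prepends \<open>butlast l\<close> rather than
  \<open>l\<close>, since the continuation itself begins in \<open>last l\<close>.\<close>

primrec app :: "'s list \<Rightarrow> (nat \<Rightarrow> 's) \<Rightarrow> nat \<Rightarrow> 's" where
  "app [] \<omega> = \<omega>"
| "app (x # l) \<omega> = case_nat x (app l \<omega>)"

lemma app_nth: "app l \<omega> n = (if n < length l then l ! n else \<omega> (n - length l))"
  by (induction l arbitrary: n) (auto split: nat.split simp: nth_Cons)

lemma event_app: "event \<Phi> \<Longrightarrow> event (\<lambda>\<omega>. \<Phi> (app l \<omega>))"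
proof (induction l arbitrary: \<Phi>)
  case (Cons x l)
  show ?case using Cons.IH[OF event_case_nat[OF Cons.prems, of x]] by simp
qed simp

abbreviation pre :: "nat \<Rightarrow> (nat \<Rightarrow> 's) \<Rightarrow> 's list" where
  "pre k \<omega> \<equiv> map \<omega> [0..<Suc k]"

lemma pre_case_nat: "pre (Suc k) (case_nat x \<omega>) = x # pre k \<omega>"
  by (subst map_upt_Suc) simp

lemma event_pre: "event (\<lambda>\<omega>. stop (pre k \<omega>))"
proof (rule event_prefix[of k])
  fix \<omega> \<omega>' :: "nat \<Rightarrow> 'a" assume "\<And>l. l \<le> k \<Longrightarrow> \<omega> l = \<omega>' l"
  then have "pre k \<omega> = pre k \<omega>'" by (intro map_cong) auto
  then show "stop (pre k \<omega>) = stop (pre k \<omega>')" by (rule arg_cong)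
qed

locale markov_law = rev_chain q \<mu> for q :: "'s::finite \<Rightarrow> 's \<Rightarrow> real" and \<mu> +
  fixes P :: "'s \<Rightarrow> 'w measure" and X :: "nat \<Rightarrow> 'w \<Rightarrow> 's"
  assumes markov: "markov_chain_from q x (P x) X"
begin

definition law :: "'s \<Rightarrow> (nat \<Rightarrow> 's) measure" where
  "law x = distr (P x) TS (\<lambda>\<omega> n. X n \<omega>)"

lemma prob_P: "prob_space (P x)"
  using markov[of x] by (simp add: markov_chain_from_def)

lemma measurable_traj: "(\<lambda>\<omega> n. X n \<omega>) \<in> measurable (P x) TS"
  using markov[of x] unfolding markov_chain_from_def TS_def
  by (intro measurable_PiM_single') auto

lemma prob_law: "prob_space (law x)"
  unfolding law_def using prob_P measurable_traj by (rule prob_space.prob_space_distr)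

lemma sets_law: "sets (law x) = sets TS" and space_law: "space (law x) = UNIV"
  by (simp_all add: law_def space_TS)

definition Pr :: "'s \<Rightarrow> ((nat \<Rightarrow> 's) \<Rightarrow> bool) \<Rightarrow> real" where
  "Pr x \<Phi> = measure (law x) {\<omega>. \<Phi> \<omega>}"

lemma Pr_eq: "event \<Phi> \<Longrightarrow> Pr x \<Phi> = measure (P x) {\<omega> \<in> space (P x). \<Phi> (\<lambda>n. X n \<omega>)}"
  unfolding Pr_def law_def using measure_distr[OF measurable_traj]
  by (simp add: vimage_def Int_def conj_commute)

lemma Pr_range: "0 \<le> Pr x \<Phi>" "Pr x \<Phi> \<le> 1"
  unfolding Pr_def using prob_space.prob_le_1[OF prob_law] by simp_all

lemma Pr_mono: "event \<Psi> \<Longrightarrow> (\<And>\<omega>. \<Phi> \<omega> \<Longrightarrow> \<Psi> \<omega>) \<Longrightarrow> Pr x \<Phi> \<le> Pr x \<Psi>"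
  unfolding Pr_def using prob_law[of x]
  by (intro finite_measure.finite_measure_mono) (auto simp: sets_law prob_space_def)

lemma Pr_True: "Pr x (\<lambda>_. True) = 1"
  using prob_space.prob_space[OF prob_law[of x]] by (simp add: Pr_def space_law)

lemma Pr_False: "Pr x (\<lambda>_. False) = 0"
  by (simp add: Pr_def)

lemma Pr_not: "event \<Phi> \<Longrightarrow> Pr x (\<lambda>\<omega>. \<not> \<Phi> \<omega>) = 1 - Pr x \<Phi>"
  using prob_space.prob_compl[OF prob_law[of x], of "{\<omega>. \<Phi> \<omega>}"]
  by (simp add: Pr_def sets_law space_law Collect_neg_eq Compl_eq_Diff_UNIV)

lemma Pr_disj_le: "event \<Phi> \<Longrightarrow> event \<Psi> \<Longrightarrow> Pr x (\<lambda>\<omega>. \<Phi> \<omega> \<or> \<Psi> \<omega>) \<le> Pr x \<Phi> + Pr x \<Psi>"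
  using measure_Un_le[of "{\<omega>. \<Phi> \<omega>}" "law x" "{\<omega>. \<Psi> \<omega>}"] by (simp add: Pr_def sets_law Collect_disj_eq)

lemma Pr_Bex_le:
  assumes "finite I" "\<And>i. i \<in> I \<Longrightarrow> event (\<Phi> i)"
  shows "Pr x (\<lambda>\<omega>. \<exists>i\<in>I. \<Phi> i \<omega>) \<le> (\<Sum>i\<in>I. Pr x (\<Phi> i))"
proof -
  have "{\<omega>. \<exists>i\<in>I. \<Phi> i \<omega>} = (\<Union>i\<in>I. {\<omega>. \<Phi> i \<omega>})" by auto
  then show ?thesis unfolding Pr_def using assms
    by (simp add: measure_UNION_le sets_law)
qed

lemma cyl_measure:
  "measure (law x) (cyl n w) = (if w 0 = x then (\<Prod>l<n. q (w l) (w (Suc l))) else 0)"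
proof -
  interpret prob_space "P x" by (rule prob_P)
  have e: "measure (law x) (cyl n w) = measure (P x) {\<omega> \<in> space (P x). \<forall>l\<le>n. X l \<omega> = w l}" for n
    using Pr_eq[of "\<lambda>\<omega>. \<forall>l\<le>n. \<omega> l = w l" x] sets_cyl[of n w] by (simp add: Pr_def cyl_def)
  have start: "measure (P x) {\<omega> \<in> space (P x). X 0 \<omega> = x} = 1"
    and step: "measure (P x) {\<omega> \<in> space (P x). \<forall>l\<le>Suc n. X l \<omega> = w l} =
            measure (P x) {\<omega> \<in> space (P x). \<forall>l\<le>n. X l \<omega> = w l} * q (w n) (w (Suc n))" for n
    using markov[of x] unfolding markov_chain_from_def by blast+
  have m: "{\<omega> \<in> space (P x). X 0 \<omega> = a} \<in> sets (P x)" for a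
    using markov[of x] measurable_sets[of "X 0" "P x" "count_space UNIV" "{a}"]
    by (simp add: markov_chain_from_def vimage_def Int_def conj_commute)
  show ?thesis
  proof (induction n)
    case 0
    show ?case
    proof (cases "w 0 = x")
      case True then show ?thesis using start by (simp add: e)
    next
      case False
      have "prob ({\<omega> \<in> space (P x). X 0 \<omega> = x} \<union> {\<omega> \<in> space (P x). X 0 \<omega> = w 0})
        = prob {\<omega> \<in> space (P x). X 0 \<omega> = x} + prob {\<omega> \<in> space (P x). X 0 \<omega> = w 0}"
        by (rule finite_measure_Union[OF m m]) (use False in auto)
      then have "prob {\<omega> \<in> space (P x). X 0 \<omega> = w 0} \<le> 0"
        using start prob_le_1[of "{\<omega> \<in> space (P x). X 0 \<omega> = x} \<union> {\<omega> \<in> space (P x). X 0 \<omega> = w 0}"] by linarith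
      then show ?thesis using False by (simp add: e measure_le_0_iff)
    qed
  next
    case (Suc n)
    then show ?case using step[of n] by (simp add: e)
  qed
qed

text \<open>A Dynkin argument: both sides are countably additive in \<open>A\<close> with total mass
  1, and they agree on the cylinders, which are stable under intersection.\<close>

lemma first_step_measure:
  assumes "A \<in> sets TS"
  shows "measure (law x) A = (\<Sum>y\<in>UNIV. q x y * measure (law y) (case_nat x -` A))"
proof -
  interpret L: prob_space "law y" for y by (rule prob_law)
  have m: "case_nat x -` A \<in> sets TS" if "A \<in> sets TS" for A
    using measurable_sets[OF measurable_case_nat_TS that] by (simp add: space_TS)
  have C: "cylinders \<subseteq> Pow (UNIV :: (nat \<Rightarrow> 's) set)" by simp
  have A: "A \<in> sigma_sets UNIV cylinders" using assms by (simp add: sets_TS_sigma)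
  show ?thesis using Int_stable_cylinders C A
  proof (induction A rule: sigma_sets_induct_disjoint)
    case (basic A)
    show ?case
    proof (cases "A = {}")
      case False
      then obtain n w where A: "A = cyl n w" using basic by (auto simp: cylinders_def)
      show ?thesis
      proof (cases n)
        case 0
        have "case_nat x -` A = (if w 0 = x then UNIV else {})" using A 0 by (auto simp: cyl_def)
        then show ?thesis using A 0 q_sum[of x] L.prob_space by (simp add: cyl_measure space_law)
      next
        case (Suc n')
        have "case_nat x -` A = (if w 0 = x then cyl n' (\<lambda>l. w (Suc l)) else {})"
          unfolding A Suc cyl_def by (auto split: nat.splits simp: less_Suc_eq_0_disj All_less_Suc2 less_Suc_eq_le[symmetric])
        moreover have "(\<Sum>y\<in>UNIV. q x y * measure (law y) (cyl n' (\<lambda>l. w (Suc l)))) =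
           q x (w 1) * (\<Prod>l<n'. q (w (Suc l)) (w (Suc (Suc l))))"
          by (subst sum.remove[of _ "w 1"]) (auto simp: cyl_measure intro!: sum.neutral)
        ultimately show ?thesis unfolding A Suc
          by (simp add: cyl_measure prod.lessThan_Suc_shift del: prod.lessThan_Suc)
      qed
    qed simp
  next
    case empty then show ?case by simp
  next
    case (compl A)
    then have A: "A \<in> sets TS" by (simp add: sets_TS_sigma)
    have "case_nat x -` (UNIV - A) = UNIV - case_nat x -` A" by auto
    then have "(\<Sum>y\<in>UNIV. q x y * measure (law y) (case_nat x -` (UNIV - A))) =
      (\<Sum>y\<in>UNIV. q x y * (1 - measure (law y) (case_nat x -` A)))"
      using L.prob_compl[of "case_nat x -` A"] m[OF A] by (simp add: sets_law space_law)
    also have "\<dots> = 1 - measure (law x) A"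
      using compl(2) q_sum[of x] by (simp add: algebra_simps sum_subtractf)
    also have "\<dots> = measure (law x) (UNIV - A)"
      using L.prob_compl[of A x] A by (simp add: sets_law space_law)
    finally show ?case by simp
  next
    case (union A)
    then have A: "range A \<subseteq> sets TS" by (simp add: sets_TS_sigma)
    have "(\<lambda>i. q x y * measure (law y) (case_nat x -` A i)) sums
      (q x y * measure (law y) (\<Union>i. case_nat x -` A i))" for y
    proof (intro sums_mult L.finite_measure_UNION)
      show "range (\<lambda>i. case_nat x -` A i) \<subseteq> L.events y" using A m by (auto simp: sets_law)
      show "disjoint_family (\<lambda>i. case_nat x -` A i)"
        using union(1) unfolding disjoint_family_on_def by blast
    qed
    then have "(\<lambda>i. \<Sum>y\<in>UNIV. q x y * measure (law y) (case_nat x -` A i)) sums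
      (\<Sum>y\<in>UNIV. q x y * measure (law y) (\<Union>i. case_nat x -` A i))" by (rule sums_sum)
    then have "(\<lambda>i. measure (law x) (A i)) sums
      (\<Sum>y\<in>UNIV. q x y * measure (law y) (\<Union>i. case_nat x -` A i))" using union(3) by simp
    moreover have "(\<lambda>i. measure (law x) (A i)) sums measure (law x) (\<Union>i. A i)"
      by (intro L.finite_measure_UNION) (use A union(1) in \<open>auto simp: sets_law\<close>)
    ultimately show ?case using sums_unique2 by (simp add: vimage_UN)
  qed
qed

lemma first_step:
  assumes "event \<Phi>" shows "Pr x \<Phi> = (\<Sum>y\<in>UNIV. q x y * Pr y (\<lambda>\<omega>. \<Phi> (case_nat x \<omega>)))"
  using first_step_measure[OF assms, of x] by (simp add: Pr_def vimage_def)

lemma Pr_start: "Pr x (\<lambda>\<omega>. \<omega> 0 = x) = 1"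
  using cyl_measure[of x 0 "\<lambda>_. x"] by (simp add: Pr_def cyl_def)

lemma Pr_start_mono:
  assumes "event \<Phi>" "event \<Psi>" "\<And>\<omega>. \<omega> 0 = x \<Longrightarrow> \<Phi> \<omega> \<Longrightarrow> \<Psi> \<omega>"
  shows "Pr x \<Phi> \<le> Pr x \<Psi>"
proof -
  have "Pr x \<Phi> \<le> Pr x (\<lambda>\<omega>. \<Psi> \<omega> \<or> \<not> \<omega> 0 = x)"
    using assms by (intro Pr_mono event_disj event_not event_coord) auto
  also have "\<dots> \<le> Pr x \<Psi> + Pr x (\<lambda>\<omega>. \<not> \<omega> 0 = x)"
    using assms by (intro Pr_disj_le event_not event_coord)
  also have "Pr x (\<lambda>\<omega>. \<not> \<omega> 0 = x) = 0" using Pr_not[OF event_coord] Pr_start by simp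
  finally show ?thesis by simp
qed

lemma Pr_conj_sure:
  assumes "event \<Phi>" "event \<Psi>" "Pr x \<Psi> = 1"
  shows "Pr x (\<lambda>\<omega>. \<Phi> \<omega> \<and> \<Psi> \<omega>) = Pr x \<Phi>"
proof (rule antisym)
  show "Pr x (\<lambda>\<omega>. \<Phi> \<omega> \<and> \<Psi> \<omega>) \<le> Pr x \<Phi>" using assms by (intro Pr_mono) auto
  have "Pr x \<Phi> \<le> Pr x (\<lambda>\<omega>. (\<Phi> \<omega> \<and> \<Psi> \<omega>) \<or> \<not> \<Psi> \<omega>)"
    using assms by (intro Pr_mono event_disj event_conj event_not) auto
  also have "\<dots> \<le> Pr x (\<lambda>\<omega>. \<Phi> \<omega> \<and> \<Psi> \<omega>) + Pr x (\<lambda>\<omega>. \<not> \<Psi> \<omega>)"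
    using assms by (intro Pr_disj_le event_conj event_not)
  finally show "Pr x \<Phi> \<le> Pr x (\<lambda>\<omega>. \<Phi> \<omega> \<and> \<Psi> \<omega>)" using assms by (simp add: Pr_not)
qed

text \<open>The strong Markov property as an inequality: \<open>stop\<close> is a stopping rule for initial segments.\<close>

lemma strong_markov_bounded:
  assumes "event \<Phi>" "0 \<le> c"
    "\<And>l. l \<noteq> [] \<Longrightarrow> stop l \<Longrightarrow> c \<le> Pr (last l) (\<lambda>\<omega>. \<Phi> (app (butlast l) \<omega>))"
  shows "c * Pr x (\<lambda>\<omega>. \<exists>k\<le>n. stop (pre k \<omega>)) \<le> Pr x \<Phi>"
  using assms
proof (induction n arbitrary: x \<Phi> stop)
  have now: "c * Pr x (\<lambda>\<omega>. \<exists>k\<le>n. stop (pre k \<omega>)) \<le> Pr x \<Phi>"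
    if "stop [x]" "0 \<le> c" "\<And>l. l \<noteq> [] \<Longrightarrow> stop l \<Longrightarrow> c \<le> Pr (last l) (\<lambda>\<omega>. \<Phi> (app (butlast l) \<omega>))"
    for x \<Phi> stop n
  proof -
    have "c * Pr x (\<lambda>\<omega>. \<exists>k\<le>n. stop (pre k \<omega>)) \<le> c" using that(2) Pr_range by (intro mult_left_le)
    also have "\<dots> \<le> Pr x \<Phi>" using that(3)[of "[x]"] that(1) by simp
    finally show ?thesis .
  qed
  have ev: "event (\<lambda>\<omega>. \<exists>k\<le>n. stop (pre k \<omega>))" for n and stop :: "'s list \<Rightarrow> bool"
    using event_ex[of "\<lambda>k \<omega>. k \<le> n \<and> stop (pre k \<omega>)"] event_pre
      event_pre[of "\<lambda>l. k \<le> n \<and> stop l" k for k] by simp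
  {
    case 0
    show ?case
    proof (cases "stop [x]")
      case True then show ?thesis using now 0 by blast
    next
      case False
      have "Pr x (\<lambda>\<omega>. \<exists>k\<le>0. stop (pre k \<omega>)) \<le> Pr x (\<lambda>_. False)"
        by (rule Pr_start_mono[OF ev]) (use False in auto)
      then have "Pr x (\<lambda>\<omega>. \<exists>k\<le>0. stop (pre k \<omega>)) = 0" using Pr_range(1) by (simp add: Pr_False antisym)
      then show ?thesis using Pr_range by simp
    qed
  next
    case (Suc n)
    show ?case
    proof (cases "stop [x]")
      case True then show ?thesis using now Suc.prems by blast
    next
      case False
      let ?stop = "\<lambda>l. stop (x # l)" and ?\<Phi> = "\<lambda>\<omega>. \<Phi> (case_nat x \<omega>)"
      have shift: "(\<exists>k\<le>Suc n. stop (pre k (case_nat x \<omega>))) \<longleftrightarrow> (\<exists>k\<le>n. ?stop (pre k \<omega>))" for \<omega>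
      proof -
        have "(\<exists>k\<le>Suc n. stop (pre k (case_nat x \<omega>))) \<longleftrightarrow> stop (pre 0 (case_nat x \<omega>)) \<or> (\<exists>k\<le>n. stop (pre (Suc k) (case_nat x \<omega>)))"
          by (metis Suc_le_mono bot_nat_0.extremum not0_implies_Suc)
        then show ?thesis using False by (simp add: pre_case_nat del: upt_Suc) simp
      qed
      have "c * Pr x (\<lambda>\<omega>. \<exists>k\<le>Suc n. stop (pre k \<omega>)) =
        (\<Sum>y\<in>UNIV. q x y * (c * Pr y (\<lambda>\<omega>. \<exists>k\<le>n. ?stop (pre k \<omega>))))"
        using first_step[OF ev[where n = "Suc n" and stop = stop], of x] unfolding shift
        by (simp add: sum_distrib_left algebra_simps del: upt_Suc)
      also have "\<dots> \<le> (\<Sum>y\<in>UNIV. q x y * Pr y ?\<Phi>)"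
      proof (intro sum_mono mult_left_mono q_nonneg)
        fix y
        show "c * Pr y (\<lambda>\<omega>. \<exists>k\<le>n. ?stop (pre k \<omega>)) \<le> Pr y ?\<Phi>"
        proof (rule Suc.IH)
          show "event ?\<Phi>" using Suc.prems by (intro event_case_nat)
          show "c \<le> Pr (last l) (\<lambda>\<omega>. ?\<Phi> (app (butlast l) \<omega>))" if "l \<noteq> []" "?stop l" for l
            using Suc.prems(3)[of "x # l"] that by simp
        qed (rule Suc.prems)
      qed
      also have "\<dots> = Pr x \<Phi>" using first_step[OF Suc.prems(1)] by simp
      finally show ?thesis .
    qed
  }
qed

text \<open>The stopping events up to time \<open>n\<close> increase to the unbounded one, so the
  bounded version passes to the limit.\<close>

lemma strong_markov:
  assumes "event \<Phi>" "0 \<le> c"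
    "\<And>l. l \<noteq> [] \<Longrightarrow> stop l \<Longrightarrow> c \<le> Pr (last l) (\<lambda>\<omega>. \<Phi> (app (butlast l) \<omega>))"
  shows "c * Pr x (\<lambda>\<omega>. \<exists>k. stop (pre k \<omega>)) \<le> Pr x \<Phi>"
proof -
  interpret L: prob_space "law x" by (rule prob_law)
  let ?A = "\<lambda>n. {\<omega>. \<exists>k\<le>n. stop (pre k \<omega>)}"
  have A: "?A n \<in> sets TS" for n
    using event_ex[of "\<lambda>k \<omega>. k \<le> n \<and> stop (pre k \<omega>)"] event_pre[of "\<lambda>l. k \<le> n \<and> stop l" k for k] by simp
  have "(\<lambda>n. measure (law x) (?A n)) \<longlonglongrightarrow> measure (law x) (\<Union>n. ?A n)"
    by (rule L.finite_Lim_measure_incseq) (use A in \<open>auto simp: sets_law incseq_def intro: order_trans\<close>)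
  moreover have "(\<Union>n. ?A n) = {\<omega>. \<exists>k. stop (pre k \<omega>)}" by auto
  ultimately have "(\<lambda>n. c * Pr x (\<lambda>\<omega>. \<exists>k\<le>n. stop (pre k \<omega>))) \<longlonglongrightarrow> c * Pr x (\<lambda>\<omega>. \<exists>k. stop (pre k \<omega>))"
    unfolding Pr_def by (intro tendsto_mult_left) simp
  then show ?thesis by (rule LIMSEQ_le_const2) (use strong_markov_bounded[OF assms] in blast)
qed

end

section \<open>Hitting probabilities as harmonic functions\<close>

lemma UNIV_TS [simp]: "UNIV \<in> sets TS"
  using sets.top[of TS] by (simp only: space_TS)

context markov_law begin

text \<open>\<open>B\<close> has to be avoided also at the time of the visit, so starting in
  \<open>B\<close> excludes the event even if the two sets meet.\<close>

definition reach :: "'s set \<Rightarrow> 's set \<Rightarrow> (nat \<Rightarrow> 's) \<Rightarrow> bool" where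
  "reach A B \<omega> \<longleftrightarrow> (\<exists>n. \<omega> n \<in> A \<and> (\<forall>k\<le>n. \<omega> k \<notin> B))"

definition hit :: "'s set \<Rightarrow> 's set \<Rightarrow> 's \<Rightarrow> real" where
  "hit A B x = Pr x (reach A B)"

lemma event_reach: "event (reach A B)"
  unfolding reach_def
proof (rule event_ex)
  fix n show "event (\<lambda>\<omega>. \<omega> n \<in> A \<and> (\<forall>k\<le>n. \<omega> k \<notin> B))" by (rule event_prefix[of n]) simp
qed

lemma hit_range: "0 \<le> hit A B x" "hit A B x \<le> 1"
  by (simp_all add: hit_def Pr_range)

lemma hit_avoided: assumes "x \<in> B" shows "hit A B x = 0"
proof -
  have "hit A B x \<le> Pr x (\<lambda>_. False)" unfolding hit_def
    by (rule Pr_start_mono[OF event_reach]) (use assms in \<open>auto simp: reach_def\<close>)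
  then show ?thesis using hit_range(1)[of A B x] by (simp add: Pr_False)
qed

lemma hit_here: assumes "x \<in> A" "x \<notin> B" shows "hit A B x = 1"
proof -
  have "Pr x (\<lambda>_. True) \<le> hit A B x" unfolding hit_def
    by (rule Pr_start_mono[OF _ event_reach]) (use assms in \<open>auto simp: reach_def\<close>)
  then show ?thesis using hit_range(2)[of A B x] by (simp add: Pr_True)
qed

lemma hit_harmonic: assumes "x \<notin> A" "x \<notin> B" shows "hit A B x = avg (hit A B) x"
proof -
  have "reach A B (case_nat x \<omega>) = reach A B \<omega>" for \<omega>
  proof
    assume "reach A B (case_nat x \<omega>)"
    then obtain n where n: "case_nat x \<omega> n \<in> A" "\<forall>k\<le>n. case_nat x \<omega> k \<notin> B" by (auto simp: reach_def)
    then obtain n' where "n = Suc n'" using assms by (cases n) auto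
    then show "reach A B \<omega>" using n by (force simp: reach_def)
  next
    assume "reach A B \<omega>"
    then obtain n where n: "\<omega> n \<in> A" "\<forall>k\<le>n. \<omega> k \<notin> B" by (auto simp: reach_def)
    then have "\<forall>k\<le>Suc n. case_nat x \<omega> k \<notin> B" using assms by (auto split: nat.split)
    then show "reach A B (case_nat x \<omega>)" using n unfolding reach_def by (intro exI[of _ "Suc n"]) simp
  qed
  then show ?thesis using first_step[OF event_reach, of x A B] by (simp add: hit_def avg_def)
qed

lemma event_edges: "event (\<lambda>\<omega>. \<forall>n. q (\<omega> n) (\<omega> (Suc n)) > 0)"
proof (rule event_all)
  fix n show "event (\<lambda>\<omega>. q (\<omega> n) (\<omega> (Suc n)) > 0)" by (rule event_prefix[of "Suc n"]) simp
qed

text \<open>A trajectory follows the graph only almost surely. Through \<open>Pr_sure_mono\<close>,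
  arguments on paths of the graph apply to single trajectories.\<close>

lemma sure_edges: "Pr x (\<lambda>\<omega>. \<forall>n. q (\<omega> n) (\<omega> (Suc n)) > 0) = 1"
proof -
  interpret L: prob_space "law x" by (rule prob_law)
  have ev: "event (\<lambda>\<omega>. q (\<omega> n) (\<omega> (Suc n)) > 0)" for n by (rule event_prefix[of "Suc n"]) simp
  have one: "Pr x (\<lambda>\<omega>. q (\<omega> n) (\<omega> (Suc n)) > 0) = 1" for n x
  proof (induction n arbitrary: x)
    case 0
    have "Pr x (\<lambda>\<omega>. q (\<omega> 0) (\<omega> (Suc 0)) > 0) = (\<Sum>y\<in>UNIV. q x y * Pr y (\<lambda>\<omega>. q x (\<omega> 0) > 0))"
      using first_step[OF ev[of 0], of x] by simp
    also have "\<dots> = (\<Sum>y\<in>UNIV. q x y)"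
    proof (intro sum.cong refl)
      fix y
      show "q x y * Pr y (\<lambda>\<omega>. q x (\<omega> 0) > 0) = q x y"
      proof (cases "q x y > 0")
        case True
        have "Pr y (\<lambda>_. True) \<le> Pr y (\<lambda>\<omega>. q x (\<omega> 0) > 0)"
          by (rule Pr_start_mono) (use True in \<open>auto intro: event_prefix[of 0]\<close>)
        then show ?thesis using Pr_range(2)[of y] by (simp add: Pr_True antisym)
      next
        case False then show ?thesis using q_nonneg[of x y] by simp
      qed
    qed
    finally show ?case by (simp add: q_sum)
  next
    case (Suc n)
    then show ?case using first_step[OF ev[of "Suc n"], of x] by (simp add: q_sum)
  qed
  have "AE \<omega> in law x. q (\<omega> n) (\<omega> (Suc n)) > 0" for n
    using L.prob_eq_1[of "{\<omega>. q (\<omega> n) (\<omega> (Suc n)) > 0}"] one[of x n] ev[of n] by (simp add: Pr_def sets_law)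
  then have "AE \<omega> in law x. \<forall>n. q (\<omega> n) (\<omega> (Suc n)) > 0" by (simp add: AE_all_countable)
  moreover note event_edges
  ultimately show ?thesis
    using L.prob_eq_1[of "{\<omega>. \<forall>n. q (\<omega> n) (\<omega> (Suc n)) > 0}"] by (simp add: Pr_def sets_law)
qed

lemma Pr_sure_mono:
  assumes "event \<Phi>" "event \<Psi>"
    "\<And>\<omega>. \<omega> 0 = x \<Longrightarrow> (\<And>n. q (\<omega> n) (\<omega> (Suc n)) > 0) \<Longrightarrow> \<Phi> \<omega> \<Longrightarrow> \<Psi> \<omega>"
  shows "Pr x \<Phi> \<le> Pr x \<Psi>"
proof -
  note ev = event_edges
  have "Pr x \<Phi> = Pr x (\<lambda>\<omega>. \<Phi> \<omega> \<and> (\<forall>n. q (\<omega> n) (\<omega> (Suc n)) > 0))"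
    using Pr_conj_sure[OF assms(1) ev sure_edges] by simp
  also have "\<dots> \<le> Pr x \<Psi>" by (rule Pr_start_mono[OF event_conj[OF assms(1) ev] assms(2)]) (use assms(3) in auto)
  finally show ?thesis .
qed

lemma hit_mono: "A \<subseteq> A' \<Longrightarrow> B' \<subseteq> B \<Longrightarrow> hit A B x \<le> hit A' B' x"
  unfolding hit_def by (rule Pr_mono[OF event_reach]) (auto simp: reach_def subset_iff)

text \<open>The sum is harmonic off \<open>A \<union> B\<close> with boundary value 1. That the
  union is reached almost surely is contained in the maximum principle.\<close>

lemma hit_one_of:
  assumes "A \<union> B \<noteq> {}" "A \<inter> B = {}" shows "hit A B x + hit B A x = 1"
proof (rule antisym)
  let ?f = "\<lambda>x. hit A B x + hit B A x"
  have off: "?f x = 1" if "x \<in> A \<union> B" for x using that assms hit_here hit_avoided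
    by (cases "x \<in> A") (auto simp: disjoint_iff)
  have avg: "avg ?f x = ?f x" if "x \<notin> A \<union> B" for x using that hit_harmonic[of x] by (simp add: avg_add)
  show "?f x \<le> 1"
    by (rule comparison[of "- (A \<union> B)"]) (use off avg assms in \<open>auto simp: avg_const simp flip: avg_add\<close>)
  show "1 \<le> ?f x"
    by (rule comparison[of "- (A \<union> B)"]) (use off avg assms in \<open>auto simp: avg_const\<close>)
qed

text \<open>The event is split by the state of the first exit. Putting the other outside states into
  the forbidden set records that \<open>y\<close> is the first of them.\<close>

lemma hit_exit:
  assumes "x \<in> V" and D: "\<And>a b. a \<in> V \<Longrightarrow> b \<notin> V \<Longrightarrow> q a b > 0 \<Longrightarrow> b \<in> D"
  shows "hit (-V) B x \<le> (\<Sum>y\<in>D. hit {y} (B \<union> (-V - {y})) x)"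
proof -
  have "hit (-V) B x \<le> Pr x (\<lambda>\<omega>. \<exists>y\<in>D. reach {y} (B \<union> (-V - {y})) \<omega>)"
    unfolding hit_def
  proof (rule Pr_sure_mono[OF event_reach])
    show "event (\<lambda>\<omega>. \<exists>y\<in>D. reach {y} (B \<union> (-V - {y})) \<omega>)"
    proof -
      have "{\<omega>. \<exists>y\<in>D. reach {y} (B \<union> (-V - {y})) \<omega>} = (\<Union>y\<in>D. {\<omega>. reach {y} (B \<union> (-V - {y})) \<omega>})" by auto
      then show ?thesis by (simp only:) (intro sets.finite_UN event_reach, simp)
    qed
    fix \<omega> assume \<omega>: "\<omega> 0 = x" "\<And>n. q (\<omega> n) (\<omega> (Suc n)) > 0" "reach (-V) B \<omega>"
    then obtain n0 where n0: "\<omega> n0 \<notin> V" "\<forall>k\<le>n0. \<omega> k \<notin> B" by (auto simp: reach_def)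
    define n where "n = (LEAST n. \<omega> n \<notin> V)"
    have n: "\<omega> n \<notin> V" "n \<le> n0"
      using LeastI[of "\<lambda>n. \<omega> n \<notin> V" n0] Least_le[of "\<lambda>n. \<omega> n \<notin> V" n0] n0 unfolding n_def by blast+
    have before: "\<omega> k \<in> V" if "k < n" for k using not_less_Least that unfolding n_def by blast
    obtain n' where n': "n = Suc n'" using n(1) \<omega>(1) assms(1) by (cases n) auto
    have "\<omega> n \<in> D" using D[of "\<omega> n'" "\<omega> n"] before[of n'] n \<omega>(2)[of n'] n' by auto
    moreover have "reach {\<omega> n} (B \<union> (-V - {\<omega> n})) \<omega>"
      unfolding reach_def using n n0(2) before by (intro exI[of _ n]) (auto simp: le_less)
    ultimately show "\<exists>y\<in>D. reach {y} (B \<union> (-V - {y})) \<omega>" by blast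
  qed
  also have "\<dots> \<le> (\<Sum>y\<in>D. hit {y} (B \<union> (-V - {y})) x)"
    unfolding hit_def by (rule Pr_Bex_le) (auto intro: event_reach)
  finally show ?thesis .
qed

end

lemma measurable_shift: "(\<lambda>\<omega> k. \<omega> (k + n)) \<in> measurable TS TS"
  by (subst (2) TS_def, intro measurable_PiM_single') (auto simp: measurable_coord)

lemma event_shift: "event \<Phi> \<Longrightarrow> event (\<lambda>\<omega>. \<Phi> (\<lambda>k. \<omega> (k + n)))"
  using measurable_sets[OF measurable_shift, of "{\<omega>. \<Phi> \<omega>}" n] by (simp add: vimage_def space_TS)

lemma event_const: "event (\<lambda>_. b)"
  by (cases b) auto

lemma event_Least:
  assumes "\<And>k. event (P k)" shows "event (\<lambda>\<omega>. (LEAST k. P k \<omega>) = (t :: nat))"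
proof -
  have "P k \<in> measurable TS (count_space UNIV)" for k
    using assms[of k] by (simp add: pred_def space_TS)
  then have "(\<lambda>\<omega>. LEAST k. P k \<omega>) \<in> measurable TS (count_space UNIV)" by (rule measurable_Least)
  from measurable_sets[OF this, of "{t}"] show ?thesis by (simp add: vimage_def space_TS)
qed

section \<open>Path-dependent metabasins of a trajectory\<close>

text \<open>The condition on candidate times in the recursion for \<open>chi\<close>. By
  \<open>chi_le\<close> no cut is skipped, so the path-dependent metabasins are the stretches
  between consecutive cuts.\<close>

definition cut :: "nat \<Rightarrow> (nat \<Rightarrow> 's) \<Rightarrow> nat \<Rightarrow> bool" where
  "cut T x k \<longleftrightarrow> x ` {k..T} \<inter> x ` {..<k} = {}"

lemma cut_late: "T < k \<Longrightarrow> cut T x k" by (simp add: cut_def)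

lemma chi_Suc: "chi T x n < chi T x (Suc n)" "cut T x (chi T x (Suc n))"
proof -
  have "chi T x n < max (Suc T) (Suc (chi T x n)) \<and> cut T x (max (Suc T) (Suc (chi T x n)))"
    by (intro conjI cut_late) auto
  from LeastI[of "\<lambda>k. chi T x n < k \<and> cut T x k", OF this]
  show "chi T x n < chi T x (Suc n)" "cut T x (chi T x (Suc n))" by (simp_all add: cut_def)
qed

lemma chi_cut: "cut T x (chi T x n)"
  by (cases n) (simp_all add: chi_Suc(2) del: chi.simps(2), simp add: cut_def)

lemma chi_le: "chi T x n < k \<Longrightarrow> cut T x k \<Longrightarrow> chi T x (Suc n) \<le> k"
  by (auto simp: cut_def intro: Least_le)

lemma chi_strict_mono: "strict_mono (chi T x)"
  unfolding strict_mono_Suc_iff using chi_Suc(1) by blast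

lemma chi_block: "\<exists>n. chi T x n \<le> u \<and> u < chi T x (Suc n)"
proof (induction u)
  case 0 show ?case using chi_Suc(1)[of T x 0] by (intro exI[of _ 0]) (simp del: chi.simps(2) add: chi.simps(1))
next
  case (Suc u)
  then obtain n where n: "chi T x n \<le> u" "u < chi T x (Suc n)" by auto
  show ?case
  proof (cases "Suc u < chi T x (Suc n)")
    case True then show ?thesis using n by (intro exI[of _ n]) simp
  next
    case False
    then have "chi T x (Suc n) = Suc u" using n by simp
    then show ?thesis using chi_Suc(1)[of T x "Suc n"] by (intro exI[of _ "Suc n"]) simp
  qed
qed

lemma upsilon_iff: "n \<le> upsilon T x \<longleftrightarrow> chi T x n \<le> T"
proof -
  let ?S = "{n. chi T x n \<le> T}"
  have "?S \<subseteq> {..T}" using strict_mono_imp_increasing[OF chi_strict_mono] by (auto intro: order_trans)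
  then have fin: "finite ?S" by (rule finite_subset) simp
  have ne: "0 \<in> ?S" by simp
  have u: "upsilon T x = Max ?S" unfolding upsilon_def by (rule cSup_eq_Max[OF fin]) (metis ne empty_iff)
  have "Max ?S \<in> ?S" using Max_in[OF fin] ne by blast
  then have "chi T x n \<le> T" if "n \<le> Max ?S"
    using that strict_mono_less_eq[OF chi_strict_mono, of T x n "Max ?S"] by simp
  moreover have "n \<le> Max ?S" if "chi T x n \<le> T" using fin that by simp
  ultimately show ?thesis unfolding u by blast
qed

text \<open>No state occurs in two blocks, since a cut separates them; hence the \<open>THE\<close>
  in the definition denotes.\<close>

lemma pd_metabasin_of_block:
  assumes "u \<le> T" "chi T x n \<le> u" "u < chi T x (Suc n)"
  shows "pd_metabasin_of T x (x u) = x ` {chi T x n..<chi T x (Suc n)}"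
proof -
  have "(THE n'. n' \<le> upsilon T x \<and> x u \<in> pd_metabasin T x n') = n"
  proof (rule the_equality)
    show "n \<le> upsilon T x \<and> x u \<in> pd_metabasin T x n"
      using assms by (auto simp: upsilon_iff pd_metabasin_def simp del: chi.simps(2))
    fix n' assume n': "n' \<le> upsilon T x \<and> x u \<in> pd_metabasin T x n'"
    then obtain v where v: "x u = x v" "chi T x n' \<le> v" "v < chi T x (Suc n')" "chi T x n' \<le> T"
      by (auto simp: upsilon_iff pd_metabasin_def simp del: chi.simps(2))
    have "chi T x (Suc n') \<le> Suc T" by (rule chi_le) (use v cut_late[of T "Suc T" x] in auto)
    then have "v \<le> T" using v by simp
    have sep: "x a \<noteq> x b" if "a < chi T x k" "chi T x k \<le> b" "b \<le> T" for a b k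
      using chi_cut[of T x k] that unfolding cut_def by force
    have mono: "chi T x a \<le> chi T x b" if "a \<le> b" for a b
      using strict_mono_less_eq[OF chi_strict_mono] that by blast
    show "n' = n"
    proof (rule ccontr)
      assume "n' \<noteq> n"
      then consider "Suc n \<le> n'" | "Suc n' \<le> n" by linarith
      then show False
      proof cases
        case 1 then show ?thesis using mono[OF 1] sep[of u "Suc n" v] v assms \<open>v \<le> T\<close>
          by (simp del: chi.simps(2))
      next
        case 2 then show ?thesis using mono[OF 2] sep[of v "Suc n'" u] v assms
          by (simp del: chi.simps(2))
      qed
    qed
  qed
  then show ?thesis using assms(1) by (simp add: pd_metabasin_of_def pd_metabasin_def del: chi.simps(2))
qed

text \<open>A repeated state rules out a cut between its two visits. This is what claim (a) needs
  from a trajectory.\<close>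

lemma pd_metabasin_of_recurrent:
  assumes "s \<le> t" "t \<le> T" "x s = x t"
  shows "x ` {s..t} \<subseteq> pd_metabasin_of T x (x s)"
proof -
  obtain n where n: "chi T x n \<le> s" "s < chi T x (Suc n)" using chi_block by blast
  have "t < chi T x (Suc n)"
  proof (rule ccontr)
    assume "\<not> ?thesis"
    then have "t \<in> {chi T x (Suc n)..T}" "s \<in> {..<chi T x (Suc n)}"
      using n assms by (simp_all del: chi.simps(2))
    then have "x s \<in> x ` {chi T x (Suc n)..T} \<inter> x ` {..<chi T x (Suc n)}"
      using assms(3) by (metis IntI imageI)
    then show False using chi_cut[of T x "Suc n"] unfolding cut_def by blast
  qed
  then show ?thesis using pd_metabasin_of_block[of s T x n] n assms by (auto simp del: chi.simps(2))
qed

lemma pd_metabasin_of_cut: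
  assumes "cut T x a" "cut T x b" "a \<le> u" "u < b" "u \<le> T"
  shows "pd_metabasin_of T x (x u) \<subseteq> x ` {a..<b}"
proof -
  obtain n where n: "chi T x n \<le> u" "u < chi T x (Suc n)" using chi_block by blast
  have "a \<le> chi T x n"
  proof (rule ccontr)
    assume "\<not> ?thesis"
    then have "chi T x (Suc n) \<le> a" by (intro chi_le) (use assms in auto)
    then show False using n assms by simp
  qed
  moreover have "chi T x (Suc n) \<le> b" by (rule chi_le) (use n assms in auto)
  ultimately show ?thesis using pd_metabasin_of_block[OF assms(5) n] by (auto simp del: chi.simps(2))
qed

lemma chi_cong:
  assumes "\<And>l. l \<le> T \<Longrightarrow> x l = y l" shows "chi T x n = chi T y n"
proof (induction n)
  case (Suc n)
  have "cut T x k = cut T y k" for k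
  proof (cases "k \<le> T")
    case True
    then have "x ` {k..T} = y ` {k..T}" "x ` {..<k} = y ` {..<k}" using assms by (auto intro!: image_cong)
    then show ?thesis by (simp add: cut_def)
  next
    case False then show ?thesis using cut_late[of T k] by auto
  qed
  then show ?case using Suc by (simp add: cut_def)
qed simp

text \<open>The basis of measurability: once the horizon is fixed, finitely many coordinates
  determine the metabasin.\<close>

lemma pd_metabasin_of_cong:
  assumes "\<And>l. l \<le> T \<Longrightarrow> x l = y l" shows "pd_metabasin_of T x s = pd_metabasin_of T y s"
proof (cases "s \<in> x ` {..T}")
  case True
  then obtain u where u: "u \<le> T" "s = x u" by auto
  obtain n where n: "chi T x n \<le> u" "u < chi T x (Suc n)" using chi_block by blast
  have ny: "chi T y n \<le> u" "u < chi T y (Suc n)" using n chi_cong[of T x y] assms by (simp_all del: chi.simps(2))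
  have "chi T x (Suc n) \<le> Suc T" by (rule chi_le) (use n u cut_late[of T "Suc T" x] in auto)
  then have "x ` {chi T x n..<chi T x (Suc n)} = y ` {chi T x n..<chi T x (Suc n)}"
    using assms by (intro image_cong) (auto simp del: chi.simps(2))
  moreover have "chi T x n = chi T y n" "chi T x (Suc n) = chi T y (Suc n)" using chi_cong[of T x y] assms by blast+
  ultimately show ?thesis
    using pd_metabasin_of_block[OF u(1) n] pd_metabasin_of_block[OF u(1) ny] u assms[of u] by (simp del: chi.simps(2))
next
  case False
  then have "s \<notin> y ` {..T}" using assms by auto
  then show ?thesis using False by (simp add: pd_metabasin_of_def)
qed

section \<open>Jump times of trajectories and measurability\<close>

context landscape begin

text \<open>A relational description of the first \<open>K\<close> jump times. It also asserts that
  the jumps exist, which excludes the arbitrary value of \<open>LEAST\<close> in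
  \<open>jump_time\<close>.\<close>

definition jump_seq :: "nat \<Rightarrow> nat \<Rightarrow> (nat \<Rightarrow> nat) \<Rightarrow> (nat \<Rightarrow> 's) \<Rightarrow> bool" where
  "jump_seq i K t x \<longleftrightarrow> t 0 = 0 \<and> (\<forall>j<K. t j < t (Suc j) \<and>
     (\<forall>l\<in>{t j..<t (Suc j)}. agg i (x l) = agg i (x (t j))) \<and> agg i (x (t (Suc j))) \<noteq> agg i (x (t j)))"

lemma jump_time_eq: "jump_seq i K t x \<Longrightarrow> j \<le> K \<Longrightarrow> jump_time i x j = t j"
proof (induction j)
  case (Suc j)
  then have "j < K" and e: "jump_time i x j = t j" by simp_all
  then have t: "t j < t (Suc j)" "\<forall>l\<in>{t j..<t (Suc j)}. agg i (x l) = agg i (x (t j))"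
    "agg i (x (t (Suc j))) \<noteq> agg i (x (t j))"
    using Suc.prems(1) unfolding jump_seq_def by blast+
  have c: "agg i (x l) = agg i (x (t j))" if "t j \<le> l" "l < t (Suc j)" for l
    using t(2) that by (meson atLeastLessThan_iff)
  have "(LEAST k. t j < k \<and> agg i (x k) \<noteq> agg i (x (k - 1))) = t (Suc j)"
  proof (rule Least_equality)
    show "t j < t (Suc j) \<and> agg i (x (t (Suc j))) \<noteq> agg i (x (t (Suc j) - 1))"
      using t(1,3) c[of "t (Suc j) - 1"] by simp
    show "t (Suc j) \<le> k" if "t j < k \<and> agg i (x k) \<noteq> agg i (x (k - 1))" for k
    proof (rule ccontr)
      assume "\<not> ?thesis"
      then have "agg i (x k) = agg i (x (t j))" "agg i (x (k - 1)) = agg i (x (t j))"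
        using that by (auto intro: c)
      then show False using that by simp
    qed
  qed
  then show ?case by (simp add: e)
qed (simp add: jump_seq_def)

definition first_jump :: "nat \<Rightarrow> nat \<Rightarrow> (nat \<Rightarrow> 's) \<Rightarrow> bool" where
  "first_jump i n x \<longleftrightarrow> (\<forall>l<n. agg i (x l) = agg i (x 0)) \<and> agg i (x n) \<noteq> agg i (x 0)"

lemma jump_seq_Suc:
  assumes "first_jump i n x" "jump_seq i K t (\<lambda>k. x (k + n))"
  shows "jump_seq i (Suc K) (case_nat 0 (\<lambda>j. t j + n)) x"
  unfolding jump_seq_def
proof (intro conjI allI impI)
  have n: "0 < n" using assms(1) by (cases n) (auto simp: first_jump_def)
  fix j assume j: "j < Suc K"
  let ?t = "case_nat 0 (\<lambda>j. t j + n)"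
  have "?t j < ?t (Suc j) \<and> (\<forall>l\<in>{?t j..<?t (Suc j)}. agg i (x l) = agg i (x (?t j))) \<and>
    agg i (x (?t (Suc j))) \<noteq> agg i (x (?t j))"
  proof (cases j)
    case 0
    then have e: "?t j = 0" "?t (Suc j) = n" using assms(2) by (simp_all add: jump_seq_def)
    have a: "\<And>l. l < n \<Longrightarrow> agg i (x l) = agg i (x 0)" "agg i (x n) \<noteq> agg i (x 0)"
      using assms(1) unfolding first_jump_def by blast+
    show ?thesis unfolding e using n a(2) by (intro conjI ballI a(1)) simp_all
  next
    case (Suc j')
    then have "j' < K" using j by simp
    then have t: "t j' < t (Suc j')" "\<forall>l\<in>{t j'..<t (Suc j')}. agg i (x (l + n)) = agg i (x (t j' + n))"
      "agg i (x (t (Suc j') + n)) \<noteq> agg i (x (t j' + n))"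
      using assms(2) unfolding jump_seq_def by blast+
    have c: "agg i (x l) = agg i (x (t j' + n))" if "t j' + n \<le> l" "l < t (Suc j') + n" for l
    proof -
      have "t j' \<le> l - n" "l - n < t (Suc j')" "l - n + n = l" using that by arith+
      then show ?thesis using bspec[OF t(2), of "l - n"] by simp
    qed
    have e: "?t j = t j' + n" "?t (Suc j) = t (Suc j') + n" using Suc by simp_all
    show ?thesis unfolding e using t(1,3) by (intro conjI ballI c) simp_all
  qed
  then show "?t j < ?t (Suc j)" "\<forall>l\<in>{?t j..<?t (Suc j)}. agg i (x l) = agg i (x (?t j))"
    "agg i (x (?t (Suc j))) \<noteq> agg i (x (?t j))" by blast+
qed simp

lemma event_jump_time: "event (\<lambda>x. jump_time i x j = t)"
proof (induction j arbitrary: t)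
  case 0 then show ?case by (simp add: event_const)
next
  case (Suc j)
  have "event (\<lambda>x. jump_time i x j < k \<and> agg i (x k) \<noteq> agg i (x (k - 1)))" for k
  proof -
    have "event (\<lambda>x. \<exists>u. jump_time i x j = u \<and> u < k \<and> agg i (x k) \<noteq> agg i (x (k - 1)))"
      by (intro event_ex event_conj Suc event_const event_prefix[of k]) auto
    then show ?thesis by simp
  qed
  then show ?case by (simp add: event_Least)
qed

text \<open>The jump times take countably many values, and for each pair of values the event depends
  on finitely many coordinates.\<close>

lemma event_at_jumps:
  fixes \<Phi> :: "nat \<Rightarrow> nat \<Rightarrow> (nat \<Rightarrow> 's) \<Rightarrow> bool"
  assumes "\<And>u v \<omega> \<omega>'. (\<And>l. l \<le> max u v \<Longrightarrow> \<omega> l = \<omega>' l) \<Longrightarrow> \<Phi> u v \<omega> = \<Phi> u v \<omega>'"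
  shows "event (\<lambda>x. \<Phi> (jump_time i x j) (jump_time i x k) x)"
proof -
  have "event (\<Phi> u v)" for u v by (rule event_prefix[of "max u v"]) (rule assms)
  then have "event (\<lambda>x. \<exists>u v. jump_time i x j = u \<and> jump_time i x k = v \<and> \<Phi> u v x)"
    by (intro event_ex event_conj event_jump_time)
  then show ?thesis by simp
qed

lemma event_covers: "event (covers_strict_basin i K k)"
  unfolding covers_strict_basin_def pd_basin_def agg_chain_def
proof (rule event_at_jumps[where \<Phi> = "\<lambda>u v \<omega>. strict_basin i (agg i (\<omega> u)) \<subseteq> pd_metabasin_of v \<omega> (agg i (\<omega> u))"])
  fix u v and \<omega> \<omega>' :: "nat \<Rightarrow> 's" assume *: "\<And>l. l \<le> max u v \<Longrightarrow> \<omega> l = \<omega>' l"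
  then have "\<omega> u = \<omega>' u" by simp
    moreover have "pd_metabasin_of v \<omega> s = pd_metabasin_of v \<omega>' s" for s
    by (rule pd_metabasin_of_cong) (use * in auto)
  ultimately show "strict_basin i (agg i (\<omega> u)) \<subseteq> pd_metabasin_of v \<omega> (agg i (\<omega> u)) \<longleftrightarrow>
    strict_basin i (agg i (\<omega>' u)) \<subseteq> pd_metabasin_of v \<omega>' (agg i (\<omega>' u))" by simp
qed

lemma event_stays: "event (stays_in_basins i K k)"
proof -
  have "event (\<lambda>x. pd_basin i K x j \<subseteq> basin i (agg_chain i x j))" for j
    unfolding pd_basin_def agg_chain_def
  proof (rule event_at_jumps[where \<Phi> = "\<lambda>u v \<omega>. pd_metabasin_of u \<omega> (agg i (\<omega> v)) \<subseteq> basin i (agg i (\<omega> v))"])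
    fix u v and \<omega> \<omega>' :: "nat \<Rightarrow> 's" assume *: "\<And>l. l \<le> max u v \<Longrightarrow> \<omega> l = \<omega>' l"
    then have "\<omega> v = \<omega>' v" by simp
    moreover have "pd_metabasin_of u \<omega> s = pd_metabasin_of u \<omega>' s" for s
      by (rule pd_metabasin_of_cong) (use * in auto)
    ultimately show "pd_metabasin_of u \<omega> (agg i (\<omega> v)) \<subseteq> basin i (agg i (\<omega> v)) \<longleftrightarrow>
      pd_metabasin_of u \<omega>' (agg i (\<omega>' v)) \<subseteq> basin i (agg i (\<omega>' v))" by simp
  qed
  then show ?thesis
    unfolding stays_in_basins_def imp_conv_disj by (intro event_all event_disj event_const)
qed

end

context landscape_level begin

definition bdry :: "'s \<Rightarrow> 's set" where "bdry m = outer_boundary (basin i m)"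

lemma bdry_adj: "a \<in> basin i m \<Longrightarrow> b \<notin> basin i m \<Longrightarrow> adj a b \<Longrightarrow> b \<in> bdry m"
  by (auto simp: bdry_def outer_boundary_def neighbour_def)

lemma bdry_nonempty: assumes m: "m \<in> agg_minima i" shows "bdry m \<noteq> {}"
proof
  assume e: "bdry m = {}"
  have closed: "b \<in> basin i m" if "a \<in> basin i m" "adj a b" for a b
    using that bdry_adj[of a m b] e by blast
  have mV: "m \<in> basin i m" using self_in_basin m by (simp add: agg_states_eq)
  have "b \<in> basin i m" for b
    using irreducible[of m b] by (induction rule: rtranclp_induct) (use mV closed in auto)
  moreover obtain m' where "m' \<in> agg_minima i" "m' \<noteq> m" using two_agg_minima by blast
  ultimately show False using basin_disjoint[of m m' m'] self_in_basin[of m'] m by (auto simp: agg_states_eq)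
qed

lemma exit_state_le:
  assumes "m \<in> agg_minima i" shows "exit_state i m \<in> bdry m" "y \<in> bdry m \<Longrightarrow> E (exit_state i m) \<le> E y"
  using arg_min_if_finite(1)[of "bdry m" E] arg_min_least[of "bdry m" y E] bdry_nonempty[OF assms]
  by (auto simp: exit_state_def bdry_def)

end

section \<open>Escape from a basin\<close>

text \<open>One inverse temperature is isolated here. The normalisation \<open>Z\<close> cancels in
  the ratios of conductances, and \<open>r\<close> collects the subexponential uncertainty;
  \<open>metropolis_at\<close> supplies both.\<close>

locale metropolis = landscape_level E adj lm i + markov_law q \<mu> P X
  for E :: "'s::finite \<Rightarrow> real" and adj :: "'s \<Rightarrow> 's \<Rightarrow> bool" and lm :: "nat \<Rightarrow> 's" and i :: nat
    and q :: "'s \<Rightarrow> 's \<Rightarrow> real" and \<mu> :: "'s \<Rightarrow> real" and P :: "'s \<Rightarrow> 'w measure" and X :: "nat \<Rightarrow> 'w \<Rightarrow> 's" +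
  fixes \<beta> Z r :: real
  assumes q_adj: "q x y > 0 \<longleftrightarrow> adj x y"
    and Z: "Z > 0" and r_ge: "r \<ge> 1" and \<beta>: "\<beta> > 0"
    and cond_upper: "x \<noteq> y \<Longrightarrow> adj x y \<Longrightarrow> cond x y \<le> Z * exp (- \<beta> * max (E x) (E y)) * r"
    and cond_lower: "x \<noteq> y \<Longrightarrow> adj x y \<Longrightarrow> Z * exp (- \<beta> * max (E x) (E y)) / r \<le> cond x y"
    and q_lower: "x \<noteq> y \<Longrightarrow> adj x y \<Longrightarrow> exp (- \<beta> * max 0 (E y - E x)) / r \<le> q x y"
begin

lemma r: "r > 0" using r_ge by simp

definition N :: real where "N = real (card (UNIV :: 's set))"

lemma N_ge: "N \<ge> 1"
proof -
  have "card (UNIV :: 's set) > 0" by (simp add: card_gt_0_iff)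
  then show ?thesis unfolding N_def by linarith
qed

lemma cond_nonadj: "\<not> adj x y \<Longrightarrow> cond x y = 0"
  using q_adj[of x y] q_nonneg[of x y] by (simp add: cond_def not_less antisym)

lemma cond_le:
  assumes "x \<noteq> y" "adj x y \<Longrightarrow> c \<le> max (E x) (E y)" shows "cond x y \<le> Z * exp (- \<beta> * c) * r"
proof (cases "adj x y")
  case True
  then have "exp (- \<beta> * max (E x) (E y)) \<le> exp (- \<beta> * c)" using assms(2) \<beta> by simp
  then have "Z * exp (- \<beta> * max (E x) (E y)) * r \<le> Z * exp (- \<beta> * c) * r"
    using Z r by (intro mult_right_mono mult_left_mono) auto
  then show ?thesis using cond_upper[OF assms(1) True] by simp
next
  case False
  then show ?thesis using cond_nonadj Z r by simp
qed

lemma cond_ge: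
  assumes "x \<noteq> y" "adj x y" "max (E x) (E y) \<le> c" shows "Z * exp (- \<beta> * c) / r \<le> cond x y"
proof -
  have "exp (- \<beta> * c) \<le> exp (- \<beta> * max (E x) (E y))" using assms(3) \<beta> by simp
  then have "Z * exp (- \<beta> * c) / r \<le> Z * exp (- \<beta> * max (E x) (E y)) / r"
    using Z r by (intro divide_right_mono mult_left_mono) auto
  then show ?thesis using cond_lower[OF assms(1,2)] by simp
qed

lemma conn_rtranclp:
  assumes "conn S x v" "\<And>u v. u \<in> S \<Longrightarrow> v \<in> S \<Longrightarrow> adj u v \<Longrightarrow> u \<noteq> v \<Longrightarrow> R u v"
  shows "R\<^sup>*\<^sup>* x v"
  using assms(1)
proof (induction rule: conn.induct)
  case (conn_step x u v)
  then have "u = v \<or> R u v" using assms(2)[of u v] conn_in by blast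
  then show ?case using conn_step.IH by (auto intro: rtranclp.rtrancl_into_rtrancl)
qed simp

definition C :: real where "C = N ^ 6 * r\<^sup>2"

lemma C_pos: "C > 0" using N_ge r by (simp add: C_def)

text \<open>\<open>hitting_bound\<close> is applied with the ball of states nearer to
  \<open>x\<close> than \<open>y\<close> is. Edges leaving the ball have conductance of level
  \<open>hgt x y\<close>, while \<open>x\<close> and \<open>z\<close> are joined by edges of level
  \<open>hgt x z\<close>. Each of the two comparisons loses a factor \<open>r\<close>, hence
  \<open>C\<close>.\<close>

lemma hit_hgt:
  assumes less: "hgt x z < hgt x y"
  shows "hit {y} {z} x \<le> C * exp (- \<beta> * (hgt x y - hgt x z))"
proof -
  have yz: "y \<noteq> z" using less by auto
  let ?c1 = "Z * exp (- \<beta> * hgt x y) * r" and ?c0 = "Z * exp (- \<beta> * hgt x z) / r"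
  have "hit {y} {z} x * ?c0 \<le> real (card (UNIV :: 's set)) ^ 6 * ?c1"
  proof (rule hitting_bound)
    show "hit {y} {z} z = 0" by (simp add: hit_avoided)
    show "hit {y} {z} b = 1" if "b \<in> {y}" for b using that yz by (simp add: hit_here)
    show "hit {y} {z} a = avg (hit {y} {z}) a" if "a \<notin> {y}" "a \<noteq> z" for a
      using that by (intro hit_harmonic) auto
    show "z \<in> {a. hgt x a < hgt x y}" "{a. hgt x a < hgt x y} \<inter> {y} = {}" using less by auto
    show "cond a b \<le> ?c1" if "a \<in> {a. hgt x a < hgt x y}" "b \<notin> {a. hgt x a < hgt x y}" for a b
    proof (rule cond_le)
      show "a \<noteq> b" using that by auto
      assume "adj a b"
      then show "hgt x y \<le> max (E a) (E b)" using that hgt_ultra[of x b a] hgt_adj[of a b] by auto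
    qed
    show "0 \<le> ?c1" "0 < ?c0" using Z r by simp_all
    show "(\<lambda>a b. ?c0 \<le> cond a b)\<^sup>*\<^sup>* x z"
    proof -
      have "(\<lambda>a b. ?c0 \<le> cond a b)\<^sup>*\<^sup>* x v" if "conn (sub (hgt x z)) x v" for v
        using conn_rtranclp[OF that] cond_ge[of _ _ "hgt x z"] by auto
      then show ?thesis using conn_hgt by blast
    qed
  qed (rule hit_range)+
  then have "hit {y} {z} x * (Z * exp (- \<beta> * hgt x z)) \<le> N ^ 6 * (Z * exp (- \<beta> * hgt x y) * r) * r"
    using r by (simp add: N_def divide_simps)
  then have "Z * (hit {y} {z} x * exp (- \<beta> * hgt x z)) \<le> Z * (C * exp (- \<beta> * hgt x y))"
    by (simp add: C_def power2_eq_square algebra_simps)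
  then have "hit {y} {z} x * exp (- \<beta> * hgt x z) \<le> C * exp (- \<beta> * hgt x y)" using Z by simp
  then have "hit {y} {z} x \<le> C * exp (- \<beta> * hgt x y) / exp (- \<beta> * hgt x z)"
    by (simp add: pos_le_divide_eq)
  also have "\<dots> = C * exp (- \<beta> * (hgt x y - hgt x z))" by (simp add: exp_diff exp_minus right_diff_distrib divide_inverse)
  finally show ?thesis .
qed

lemma bdryI: "a \<in> basin i m \<Longrightarrow> b \<notin> basin i m \<Longrightarrow> q a b > 0 \<Longrightarrow> b \<in> bdry m"
  using bdry_adj q_adj by blast

text \<open>\<open>escape m x\<close> mirrors the sum in \<open>delta_err\<close> up to constants and subexponential factors.\<close>

definition escape :: "'s \<Rightarrow> 's \<Rightarrow> real" where
  "escape m x = (\<Sum>y\<in>bdry m.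
     if hgt x m < hgt x y then C * exp (- \<beta> * (hgt x y - hgt x m))
     else \<Sum>z\<in>{z. E z > hgt x y}. C * exp (- \<beta> * (hgt x z - hgt x y)))"

text \<open>A boundary state higher than the way to \<open>m\<close> is treated by
  \<open>hit_hgt\<close> directly. For a lower one, paths below its height cross \<open>R\<close>; a
  trajectory that avoids \<open>R\<close> must first climb to some \<open>z\<close> above this
  height, and reaching such a \<open>z\<close> before \<open>y\<close> is unlikely.\<close>

lemma hit_exit_le_escape:
  assumes x: "x \<in> basin i m" and R: "R \<subseteq> basin i m"
    and hits: "\<And>y. y \<in> bdry m \<Longrightarrow> hgt x y \<le> hgt x m \<Longrightarrow> \<not> conn (sub (hgt x y) - R) x y"
  shows "hit (- basin i m) (R \<union> {m}) x \<le> escape m x"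
proof -
  let ?V = "basin i m" and ?B = "\<lambda>y. (R \<union> {m}) \<union> (- basin i m - {y})"
  have "hit (- ?V) (R \<union> {m}) x \<le> (\<Sum>y\<in>bdry m. hit {y} (?B y) x)"
    using hit_exit[OF x, of "bdry m" "R \<union> {m}"] bdryI by blast
  also have "\<dots> \<le> escape m x" unfolding escape_def
  proof (intro sum_mono)
    fix y assume y: "y \<in> bdry m"
    then have yV: "y \<notin> ?V" by (simp add: bdry_def outer_boundary_def)
    show "hit {y} (?B y) x \<le> (if hgt x m < hgt x y then C * exp (- \<beta> * (hgt x y - hgt x m))
      else \<Sum>z\<in>{z. E z > hgt x y}. C * exp (- \<beta> * (hgt x z - hgt x y)))"
    proof (cases "hgt x m < hgt x y")
      case True
      have "hit {y} (?B y) x \<le> hit {y} {m} x" by (rule hit_mono) auto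
      then show ?thesis using hit_hgt[OF True] True by simp
    next
      case False
      have "hit {y} (?B y) x \<le> Pr x (\<lambda>\<omega>. \<exists>z\<in>{z. E z > hgt x y}. reach {z} {y} \<omega>)"
        unfolding hit_def
      proof (rule Pr_sure_mono[OF event_reach])
        have "{\<omega>. \<exists>z\<in>{z. E z > hgt x y}. reach {z} {y} \<omega>} = (\<Union>z\<in>{z. E z > hgt x y}. {\<omega>. reach {z} {y} \<omega>})" by auto
        then show "event (\<lambda>\<omega>. \<exists>z\<in>{z. E z > hgt x y}. reach {z} {y} \<omega>)"
          by (simp only:) (intro sets.finite_UN event_reach, simp)
        fix \<omega> assume \<omega>: "\<omega> 0 = x" "\<And>n. 0 < q (\<omega> n) (\<omega> (Suc n))" "reach {y} (?B y) \<omega>"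
        then obtain n0 where n0: "\<omega> n0 = y" "\<forall>k\<le>n0. \<omega> k \<notin> ?B y" by (auto simp: reach_def)
        define n where "n = (LEAST n. \<omega> n = y)"
        have n: "\<omega> n = y" "n \<le> n0"
          using LeastI[of "\<lambda>n. \<omega> n = y" n0] Least_le[of "\<lambda>n. \<omega> n = y" n0] n0 unfolding n_def by blast+
        have before: "\<omega> k \<noteq> y" if "k < n" for k using not_less_Least that unfolding n_def by blast
        have "\<exists>k<n. hgt x y < E (\<omega> k)"
        proof (rule ccontr)
          assume no: "\<not> ?thesis"
          have low: "\<omega> k \<in> sub (hgt x y) - R" if "k \<le> n" for k
          proof -
            have "E (\<omega> k) \<le> hgt x y"
            proof (cases "k = n")
              case True then show ?thesis using n(1) hgt_ge(2)[of y x] by simp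
            next
              case False
              then have "\<not> hgt x y < E (\<omega> k)" using no that by auto
              then show ?thesis by simp
            qed
            moreover have "\<omega> k \<notin> R" using n0(2) that n(2) by auto
            ultimately show ?thesis by simp
          qed
          have "conn (sub (hgt x y) - R) x (\<omega> k)" if "k \<le> n" for k
            using that
          proof (induction k)
            case 0 then show ?case using conn_base low[of 0] \<omega>(1) by auto
          next
            case (Suc k)
            show ?case by (rule conn_step[OF Suc.IH]) (use Suc.prems low[of "Suc k"] \<omega>(2)[of k] q_adj in auto)
          qed
          then show False using hits[OF y] False n(1) by auto
        qed
        then obtain k where k: "k < n" "hgt x y < E (\<omega> k)" by blast
        then have "reach {\<omega> k} {y} \<omega>" unfolding reach_def using before by (intro exI[of _ k]) auto
        then show "\<exists>z\<in>{z. E z > hgt x y}. reach {z} {y} \<omega>" using k by blast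
      qed
      also have "\<dots> \<le> (\<Sum>z\<in>{z. E z > hgt x y}. hit {z} {y} x)"
        unfolding hit_def by (rule Pr_Bex_le) (auto intro: event_reach)
      also have "\<dots> \<le> (\<Sum>z\<in>{z. E z > hgt x y}. C * exp (- \<beta> * (hgt x z - hgt x y)))"
      proof (intro sum_mono hit_hgt)
        fix z assume "z \<in> {z. E z > hgt x y}" then show "hgt x y < hgt x z" using hgt_ge(2)[of z x] by simp
      qed
      finally show ?thesis using False by simp
    qed
  qed
  finally show ?thesis .
qed

text \<open>The proof treats the states in the order of \<open>basin_rank\<close>: a low path to the boundary meets states for which the bound is known.\<close>

lemma escape_bound:
  assumes m: "m \<in> agg_minima i" and \<tau>: "\<And>x. x \<in> basin i m \<Longrightarrow> escape m x \<le> \<tau>" and x: "x \<in> basin i m"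
  shows "hit (- basin i m) {m} x \<le> (real num_min + 2) * \<tau>"
proof -
  let ?V = "basin i m" and ?Q = "hit (- basin i m) {m}"
  have mV: "m \<in> ?V" using self_in_basin m by (simp add: agg_states_eq)
  obtain rk :: "'s \<Rightarrow> nat" where rk: "\<And>x. rk x \<le> num_min"
    "\<And>x. x \<in> ?V \<Longrightarrow> \<exists>R\<subseteq>?V. (R \<subseteq> strict_valley i m \<or> (\<forall>w\<in>R. rk x < rk w)) \<and>
     (\<forall>y\<in>bdry m. hgt x y \<le> hgt x m \<longrightarrow> \<not> conn (sub (hgt x y) - R) x y)"
    using basin_rank[OF m] unfolding bdry_def by blast
  have "0 \<le> ?Q x" by (rule hit_range)
  have \<tau>0: "0 \<le> \<tau>"
  proof -
    have "0 \<le> escape m m" unfolding escape_def using C_pos by (intro sum_nonneg) (auto intro!: sum_nonneg)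
    then show ?thesis using \<tau>[OF mV] by simp
  qed
  have strict: "?Q w \<le> \<tau>" if w: "w \<in> strict_valley i m" for w
  proof -
    have wV: "w \<in> ?V" using strict_valley_basin m w by blast
    have "?Q w \<le> escape m w"
      using hit_exit_le_escape[OF wV, of "{}"] strict_valley_less[OF m w]
      by (fastforce simp: bdry_def outer_boundary_def)
    then show ?thesis using \<tau>[OF wV] by simp
  qed
  \<comment> \<open>An escape before \<open>m\<close> either happens before \<open>R\<close> is met
    or starts anew from a state of \<open>R\<close>. The comparison principle expresses this without
    stopping times.\<close>
  have step: "?Q x \<le> \<tau> + M" if x: "x \<in> ?V" and R: "R \<subseteq> ?V" "\<And>w. w \<in> R \<Longrightarrow> ?Q w \<le> M" and M: "0 \<le> M"
    and "\<forall>y\<in>bdry m. hgt x y \<le> hgt x m \<longrightarrow> \<not> conn (sub (hgt x y) - R) x y" for x R M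
  proof -
    have "?Q x \<le> hit (- ?V) (R \<union> {m}) x + M"
    proof (rule comparison[of "?V - R - {m}"])
      fix a assume a: "a \<in> ?V - R - {m}"
      show "?Q a \<le> avg ?Q a" using hit_harmonic[of a "- ?V" "{m}"] a by simp
      show "avg (\<lambda>x. hit (- ?V) (R \<union> {m}) x + M) a \<le> hit (- ?V) (R \<union> {m}) a + M"
        using hit_harmonic[of a "- ?V" "R \<union> {m}"] a by (simp add: avg_add avg_const)
    next
      fix a assume "a \<notin> ?V - R - {m}"
      then consider "a \<in> R" | "a = m" | "a \<notin> ?V" "a \<notin> R \<union> {m}" using R(1) mV by blast
      then show "?Q a \<le> hit (- ?V) (R \<union> {m}) a + M"
      proof cases
        case 1 then show ?thesis using R(2)[of a] hit_range(1)[of "- ?V" "R \<union> {m}" a] by simp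
      next
        case 2 then show ?thesis using M hit_range(1)[of "- ?V" "R \<union> {m}" a] by (simp add: hit_avoided)
      next
        case 3 then show ?thesis using M hit_range(2)[of "- ?V" "{m}" a] hit_here[of a "- ?V" "R \<union> {m}"] by simp
      qed
    qed auto
    moreover have "hit (- ?V) (R \<union> {m}) x \<le> \<tau>"
      using hit_exit_le_escape[OF x R(1)] \<tau>[OF x] that(5) by fastforce
    ultimately show ?thesis by simp
  qed
  \<comment> \<open>Each increase of the rank costs one \<open>\<tau>\<close>; the passage into the
    strict valley of \<open>m\<close> and the escape from there cost the last two.\<close>
  have "?Q x \<le> (real (num_min - rk x) + 2) * \<tau>" if "x \<in> ?V" for x
    using that
  proof (induction "num_min - rk x" arbitrary: x rule: less_induct)
    case less
    obtain R where R: "R \<subseteq> ?V" "R \<subseteq> strict_valley i m \<or> (\<forall>w\<in>R. rk x < rk w)"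
      "\<forall>y\<in>bdry m. hgt x y \<le> hgt x m \<longrightarrow> \<not> conn (sub (hgt x y) - R) x y" using rk(2)[OF less.prems] by blast
    define M where "M = (real (num_min - rk x) + 1) * \<tau>"
    have "?Q w \<le> M" if w: "w \<in> R" for w
    proof (cases "R \<subseteq> strict_valley i m")
      case True
      then have "?Q w \<le> 1 * \<tau>" using strict w by auto
      also have "\<dots> \<le> M" unfolding M_def using \<tau>0 by (intro mult_right_mono) auto
      finally show ?thesis .
    next
      case False
      then have l: "rk x < rk w" using R(2) w by blast
      then have d: "num_min - rk w < num_min - rk x" using rk(1)[of w] by arith
      then have "?Q w \<le> (real (num_min - rk w) + 2) * \<tau>" using less.hyps[OF d] R(1) w by blast
      also have "\<dots> \<le> M" unfolding M_def using \<tau>0 d by (intro mult_right_mono) auto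
      finally show ?thesis .
    qed
    then have "?Q x \<le> \<tau> + M" using step[OF less.prems R(1) _ _ R(3), of M] \<tau>0 by (simp add: M_def)
    then show ?case by (simp add: M_def algebra_simps)
  qed
  from this[OF x] have "?Q x \<le> (real (num_min - rk x) + 2) * \<tau>" .
  also have "\<dots> \<le> (real num_min + 2) * \<tau>" using \<tau>0 by (intro mult_right_mono) auto
  finally show ?thesis .
qed

text \<open>Since \<open>v\<close> is nearer to \<open>m\<close> than to the boundary, each boundary
  state has the same height from \<open>m\<close> as from \<open>v\<close>. The bound belonging to
  \<open>v\<close> therefore serves for the start in \<open>m\<close>.\<close>

lemma strict_escape:
  assumes m: "m \<in> agg_minima i" and v: "v \<in> strict_valley i m"
  shows "hit (- basin i m) {v} m \<le> escape m v"
proof -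
  let ?V = "basin i m"
  have mV: "m \<in> ?V" using self_in_basin m by (simp add: agg_states_eq)
  have "hit (- ?V) {v} m \<le> (\<Sum>y\<in>bdry m. hit {y} ({v} \<union> (- ?V - {y})) m)"
    using hit_exit[OF mV, of "bdry m" "{v}"] bdryI by blast
  also have "\<dots> \<le> escape m v" unfolding escape_def
  proof (intro sum_mono)
    fix y assume y: "y \<in> bdry m"
    then have less: "hgt v m < hgt v y"
      using strict_valley_less[OF m v] by (auto simp: bdry_def outer_boundary_def)
    then have eq: "hgt m y = hgt v y" using hgt_less_trans[of m v y] hgt_sym[of v m] by simp
    have "hit {y} ({v} \<union> (- ?V - {y})) m \<le> hit {y} {v} m" by (rule hit_mono) auto
    also have "\<dots> \<le> C * exp (- \<beta> * (hgt m y - hgt m v))"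
      by (rule hit_hgt) (use less eq hgt_sym[of v m] in simp)
    finally show "hit {y} ({v} \<union> (- ?V - {y})) m \<le> (if hgt v m < hgt v y then C * exp (- \<beta> * (hgt v y - hgt v m))
     else \<Sum>z\<in>{z. E z > hgt v y}. C * exp (- \<beta> * (hgt v z - hgt v y)))"
      using less eq hgt_sym[of v m] by simp
  qed
  finally show ?thesis .
qed

text \<open>An instance of \<open>exit_bound\<close> whose cut lies at the level of the lowest
  boundary state. By \<open>half\<close> two return probabilities are at least 1/2, which gives the
  4; \<open>N\<^sup>2\<close> bounds the number of edges in the cut, and the two conductance bounds
  give \<open>r\<^sup>2\<close>.\<close>

lemma exit_prob:
  assumes m: "m \<in> agg_minima i" and y: "y \<in> bdry m" and x: "x \<in> basin i m"
    and half: "\<And>x. x \<in> basin i m \<Longrightarrow> hit (- basin i m) {m} x \<le> 1 / 2"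
  shows "exp (- \<beta> * (E y - E (exit_state i m))) / (4 * N\<^sup>2 * r\<^sup>2) \<le> hit {y} (- basin i m - {y}) x"
proof -
  let ?V = "basin i m" and ?e = "E (exit_state i m)"
  let ?f = "hit {m} (- ?V)" and ?g = "hit {y} (- ?V - {y})"
  have mV: "m \<in> ?V" using self_in_basin m by (simp add: agg_states_eq)
  have yV: "y \<notin> ?V" using y by (simp add: bdry_def outer_boundary_def)
  obtain w where w: "w \<in> ?V" "adj w y" "E w < E y" using boundary_above m y unfolding bdry_def by blast
  have f: "1 / 2 \<le> ?f a" if "a \<in> ?V" for a
    using half[OF that] hit_one_of[of "{m}" "- ?V" a] mV by auto
  let ?c1 = "Z * exp (- \<beta> * ?e) * r"
  have "cond w y * ?f w * ?f x \<le> ?g x * (real (card (UNIV :: 's set)) ^ 2 * ?c1)"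
  proof (rule exit_bound[where V = ?V and m = m])
    show "?f m = 1" using mV by (simp add: hit_here)
    show "?f a = 0" if "a \<notin> ?V" for a using that by (simp add: hit_avoided)
    show "?f a = avg ?f a" if "a \<in> ?V" "a \<noteq> m" for a using that by (intro hit_harmonic) auto
    show "?g y = 1" by (simp add: hit_here)
    show "?g a = 0" if "a \<notin> ?V" "a \<noteq> y" for a using that by (simp add: hit_avoided)
    show "?g a = avg ?g a" if "a \<in> ?V" for a using that yV by (intro hit_harmonic) auto
    show "cond a b \<le> ?c1" if "a \<in> ?V" "b \<notin> ?V" for a b
    proof (rule cond_le)
      show "a \<noteq> b" using that by auto
      assume "adj a b"
      then have "b \<in> bdry m" using bdryI that q_adj by blast
      then show "?e \<le> max (E a) (E b)" using exit_state_le(2)[OF m] by (simp add: le_max_iff_disj)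
    qed
    show "0 \<le> ?c1" using Z r by simp
  qed (use mV yV w hit_range in auto)
  moreover have "cond w y * (1 / 2) * (1 / 2) \<le> cond w y * ?f w * ?f x"
    using f[OF w(1)] f[OF x] cond_nonneg[of w y] by (intro mult_mono mult_left_mono) auto
  moreover have "Z * exp (- \<beta> * E y) / r \<le> cond w y"
    by (rule cond_ge) (use w in auto)
  then have "Z * exp (- \<beta> * E y) / r * (1 / 4) \<le> cond w y * (1 / 2) * (1 / 2)" by simp
  ultimately have "Z * exp (- \<beta> * E y) / r * (1 / 4) \<le> ?g x * (N\<^sup>2 * ?c1)"
    unfolding N_def by (meson order_trans)
  then have "Z * exp (- \<beta> * E y) * (1 / 4) \<le> ?g x * (N\<^sup>2 * ?c1) * r" using r by (simp add: divide_simps)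
  then have "Z * (exp (- \<beta> * E y)) \<le> Z * (?g x * (4 * N\<^sup>2 * r\<^sup>2) * exp (- \<beta> * ?e))"
    by (simp add: algebra_simps power2_eq_square)
  then have "exp (- \<beta> * E y) \<le> ?g x * (4 * N\<^sup>2 * r\<^sup>2) * exp (- \<beta> * ?e)" using Z by simp
  then have "exp (- \<beta> * E y) / exp (- \<beta> * ?e) \<le> ?g x * (4 * N\<^sup>2 * r\<^sup>2)" by (simp add: pos_divide_le_eq)
  moreover have "exp (- \<beta> * E y) / exp (- \<beta> * ?e) = exp (- \<beta> * (E y - ?e))"
    by (simp add: exp_diff exp_minus right_diff_distrib divide_inverse)
  ultimately have "exp (- \<beta> * (E y - ?e)) \<le> ?g x * (4 * N\<^sup>2 * r\<^sup>2)" by simp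
  moreover have "0 < 4 * N\<^sup>2 * r\<^sup>2" using N_ge r by simp
  ultimately show ?thesis by (simp only: pos_divide_le_eq)
qed

end

section \<open>Jumps of the aggregated chain\<close>

context landscape_level begin

lemma agg_iff: "s \<in> agg_states i \<Longrightarrow> agg i x = s \<longleftrightarrow> x \<in> basin i s"
  using agg_eq agg_in by metis

lemma jump_seq_mono: "jump_seq i K t \<omega> \<Longrightarrow> a \<le> b \<Longrightarrow> b \<le> K \<Longrightarrow> t a \<le> t b"
proof (induction b)
  case (Suc b)
  show ?case
  proof (cases "a \<le> b")
    case True
    have "b < K" using Suc.prems by simp
    then have "t b < t (Suc b)" using Suc.prems(1) unfolding jump_seq_def by blast
    then show ?thesis using Suc.IH[OF Suc.prems(1) True] Suc.prems by simp
  next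
    case False then show ?thesis using Suc.prems by (simp add: le_Suc_eq)
  qed
qed simp

lemma jump_seq_index:
  assumes "jump_seq i K t \<omega>" "l \<le> t K"
  obtains j where "j \<le> K" "t j \<le> l" "j < K \<Longrightarrow> l < t (Suc j)" "agg i (\<omega> l) = agg i (\<omega> (t j))"
proof -
  let ?S = "{j. j \<le> K \<and> t j \<le> l}"
  define j where "j = Max ?S"
  have fin: "finite ?S" by simp
  have "0 \<in> ?S" using assms by (simp add: jump_seq_def)
  then have "j \<in> ?S" unfolding j_def using Max_in[OF fin] by blast
  then have j: "j \<le> K" "t j \<le> l" by auto
  have less: "l < t (Suc j)" if "j < K"
  proof (rule ccontr)
    assume "\<not> ?thesis"
    then have "Suc j \<in> ?S" using that by simp
    from Max_ge[OF fin this] have "Suc j \<le> j" unfolding j_def .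
    then show False by simp
  qed
  have "agg i (\<omega> l) = agg i (\<omega> (t j))"
  proof (cases "j < K")
    case True
    then have "\<forall>l\<in>{t j..<t (Suc j)}. agg i (\<omega> l) = agg i (\<omega> (t j))"
      using assms(1) unfolding jump_seq_def by blast
    then show ?thesis using j less[OF True] by (meson atLeastLessThan_iff)
  next
    case False then show ?thesis using j assms(2) by simp
  qed
  then show ?thesis using that j less by blast
qed

text \<open>States of different basins are different, so this separation of the aggregated states
  turns the jump time \<open>t a\<close> into a cut.\<close>

definition separated :: "nat \<Rightarrow> (nat \<Rightarrow> nat) \<Rightarrow> (nat \<Rightarrow> 's) \<Rightarrow> nat \<Rightarrow> bool" where
  "separated K t \<omega> a \<longleftrightarrow> (\<forall>j1<a. \<forall>j2\<in>{a..K}. agg i (\<omega> (t j1)) \<noteq> agg i (\<omega> (t j2)))"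

lemma separatedD:
  "separated K t \<omega> a \<Longrightarrow> j1 < a \<Longrightarrow> a \<le> j2 \<Longrightarrow> j2 \<le> K \<Longrightarrow> agg i (\<omega> (t j1)) \<noteq> agg i (\<omega> (t j2))"
  by (simp add: separated_def)

lemma separated_cut:
  assumes "jump_seq i K t \<omega>" "a \<le> K" "separated K t \<omega> a"
  shows "cut (t K) \<omega> (t a)"
proof (rule ccontr)
  assume "\<not> ?thesis"
  then obtain v where "v \<in> \<omega> ` {t a..t K}" "v \<in> \<omega> ` {..<t a}" unfolding cut_def by blast
  then obtain l l' where l: "l < t a" "t a \<le> l'" "l' \<le> t K" "\<omega> l = \<omega> l'" by auto
  obtain j where j: "j \<le> K" "t j \<le> l" "agg i (\<omega> l) = agg i (\<omega> (t j))"
    using jump_seq_index[OF assms(1), of l] l by (metis le_trans less_imp_le_nat)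
  obtain j' where j': "j' \<le> K" "j' < K \<Longrightarrow> l' < t (Suc j')" "agg i (\<omega> l') = agg i (\<omega> (t j'))"
    using jump_seq_index[OF assms(1), of l'] l by metis
  have "j < a"
  proof (rule ccontr)
    assume "\<not> ?thesis" then show False using jump_seq_mono[OF assms(1), of a j] j l by simp
  qed
  moreover have "a \<le> j'"
  proof (rule ccontr)
    assume "\<not> ?thesis" then show False using jump_seq_mono[OF assms(1), of "Suc j'" a] j' assms l by simp
  qed
  ultimately show False using separatedD[OF assms(3), of j j'] j j' l by simp
qed

lemma separated_stays:
  assumes t: "jump_seq i K t \<omega>" and j: "j < K" and s: "separated K t \<omega> j" "separated K t \<omega> (Suc j)"
  shows "pd_basin i K \<omega> j \<subseteq> basin i (agg_chain i \<omega> j)"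
proof -
  let ?s = "agg i (\<omega> (t j))"
  have e: "pd_basin i K \<omega> j = pd_metabasin_of (t K) \<omega> ?s" "agg_chain i \<omega> j = ?s"
    using j by (simp_all add: pd_basin_def agg_chain_def jump_time_eq[OF t])
  show ?thesis
  proof (cases "?s \<in> \<omega> ` {..t K}")
    case True
    then obtain u where u: "u \<le> t K" "?s = \<omega> u" by auto
    have as: "agg i (\<omega> u) = ?s" using u(2) agg_in(1) self_in_basin agg_eq by metis
    obtain j' where j': "j' \<le> K" "t j' \<le> u" "j' < K \<Longrightarrow> u < t (Suc j')" "agg i (\<omega> u) = agg i (\<omega> (t j'))"
      using jump_seq_index[OF t u(1)] by metis
    have "\<not> j' < j" using separatedD[OF s(1), of j' j] j j'(4) as by auto
    moreover have "\<not> j < j'" using separatedD[OF s(2), of j j'] j j'(1,4) as by auto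
    ultimately have "j' = j" by simp
    then have "t j \<le> u" "u < t (Suc j)" using j' j by auto
    then have "pd_metabasin_of (t K) \<omega> ?s \<subseteq> \<omega> ` {t j..<t (Suc j)}"
      unfolding u(2) by (intro pd_metabasin_of_cut separated_cut[OF t] s u(1)) (use j in auto)
    also have "\<dots> \<subseteq> basin i ?s"
    proof
      fix a assume "a \<in> \<omega> ` {t j..<t (Suc j)}"
      moreover have "\<forall>l\<in>{t j..<t (Suc j)}. agg i (\<omega> l) = ?s" using t j unfolding jump_seq_def by blast
      ultimately have "agg i a = ?s" by blast
      then show "a \<in> basin i ?s" using agg_in(2)[of a] by simp
    qed
    finally show ?thesis unfolding e .
  next
    \<comment> \<open>The trajectory may pass through a basin without visiting its label; the
      path-dependent metabasin of the label is then empty by definition.\<close>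
    case False then show ?thesis unfolding e by (simp add: pd_metabasin_of_def)
  qed
qed

text \<open>Equal states at \<open>a\<close> and \<open>b\<close> put the whole stretch between them
  into one path-dependent metabasin.\<close>

definition returns :: "(nat \<Rightarrow> 's) \<Rightarrow> nat \<Rightarrow> nat \<Rightarrow> bool" where
  "returns \<omega> a b \<longleftrightarrow> a \<le> b \<and> \<omega> a = agg i (\<omega> a) \<and> \<omega> b = \<omega> a \<and> strict_basin i (\<omega> a) \<subseteq> \<omega> ` {a..b}"

definition covering :: "nat \<Rightarrow> nat \<Rightarrow> (nat \<Rightarrow> 's) \<Rightarrow> bool" where
  "covering k K \<omega> \<longleftrightarrow> (\<exists>t a b. jump_seq i K t \<omega> \<and> t k \<le> a \<and> b < t (Suc k) \<and> returns \<omega> a b)"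

lemma covering_covers:
  assumes "covering k K \<omega>" "k < K" shows "covers_strict_basin i K k \<omega>"
proof -
  obtain t a b where t: "jump_seq i K t \<omega>" and ab: "t k \<le> a" "b < t (Suc k)" "returns \<omega> a b"
    using assms by (auto simp: covering_def)
  have "a < t (Suc k)" using ab by (simp add: returns_def)
  moreover have "\<forall>l\<in>{t k..<t (Suc k)}. agg i (\<omega> l) = agg i (\<omega> (t k))"
    using t assms(2) unfolding jump_seq_def by blast
  ultimately have s: "agg i (\<omega> a) = agg i (\<omega> (t k))" using ab(1) by (meson atLeastLessThan_iff)
  have "b \<le> t K" using ab(2) jump_seq_mono[OF t, of "Suc k" K] assms(2) by simp
  then have "\<omega> ` {a..b} \<subseteq> pd_metabasin_of (t K) \<omega> (\<omega> a)"
    using pd_metabasin_of_recurrent[of a b "t K" \<omega>] ab(3) by (simp add: returns_def)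
  then have "strict_basin i (\<omega> a) \<subseteq> pd_metabasin_of (t K) \<omega> (\<omega> a)" using ab(3) by (auto simp: returns_def)
  moreover have "\<omega> a = agg i (\<omega> (t k))" using ab(3) s by (simp add: returns_def)
  ultimately show ?thesis using assms(2)
    by (simp add: covers_strict_basin_def pd_basin_def agg_chain_def jump_time_eq[OF t])
qed

lemma returns_shift: "returns (\<lambda>k. \<omega> (k + n)) a b \<Longrightarrow> returns \<omega> (a + n) (b + n)"
proof -
  have "(\<lambda>k. \<omega> (k + n)) ` {a..b} = \<omega> ` {a + n..b + n}"
    by (simp only: image_add_atLeastAtMost'[symmetric] image_image)
  then show "returns (\<lambda>k. \<omega> (k + n)) a b \<Longrightarrow> returns \<omega> (a + n) (b + n)" by (simp add: returns_def)
qed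

lemma covering_Suc:
  assumes "first_jump i n \<omega>" "covering k K (\<lambda>k. \<omega> (k + n))"
  shows "covering (Suc k) (Suc K) \<omega>"
proof -
  obtain t a b where t: "jump_seq i K t (\<lambda>k. \<omega> (k + n))" and ab: "t k \<le> a" "b < t (Suc k)"
    and r: "returns (\<lambda>k. \<omega> (k + n)) a b" using assms(2) by (auto simp: covering_def)
  show ?thesis unfolding covering_def
    by (intro exI[of _ "case_nat 0 (\<lambda>j. t j + n)"] exI[of _ "a + n"] exI[of _ "b + n"] conjI
        jump_seq_Suc assms t returns_shift r) (use ab in simp_all)
qed

end

section \<open>Renewal at successive jumps\<close>

context metropolis begin

definition jump_to :: "'s set \<Rightarrow> nat \<Rightarrow> (nat \<Rightarrow> 's) \<Rightarrow> bool" where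
  "jump_to S n \<omega> \<longleftrightarrow> first_jump i n \<omega> \<and> agg i (\<omega> n) \<in> S"

definition next_jump :: "'s set \<Rightarrow> ((nat \<Rightarrow> 's) \<Rightarrow> bool) \<Rightarrow> (nat \<Rightarrow> 's) \<Rightarrow> bool" where
  "next_jump S \<Psi> \<omega> \<longleftrightarrow> (\<exists>n. jump_to S n \<omega> \<and> \<Psi> (\<lambda>k. \<omega> (k + n)))"

lemma jump_to_cong: "(\<And>l. l \<le> n \<Longrightarrow> \<omega> l = \<omega>' l) \<Longrightarrow> jump_to S n \<omega> = jump_to S n \<omega>'"
  by (simp add: jump_to_def first_jump_def)

lemma event_jump_to: "event (jump_to S n)"
  by (rule event_prefix[of n]) (rule jump_to_cong)

lemma event_next_jump: "event \<Psi> \<Longrightarrow> event (next_jump S \<Psi>)"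
  unfolding next_jump_def by (intro event_ex event_conj event_jump_to event_shift)

text \<open>The strong Markov property at the first jump. Lower bounds multiply, so events over
  several jumps reduce to estimates for one jump.\<close>

lemma next_jump_prob:
  assumes "event \<Psi>" "0 \<le> c" "p \<le> Pr x (\<lambda>\<omega>. \<exists>n. jump_to S n \<omega>)"
    "\<And>x'. agg i x' \<in> S \<Longrightarrow> c \<le> Pr x' \<Psi>"
  shows "p * c \<le> Pr x (next_jump S \<Psi>)"
proof -
  define stop where "stop l \<longleftrightarrow> l \<noteq> [] \<and> jump_to S (length l - 1) (\<lambda>k. l ! k)" for l
  have stop: "stop (pre n \<omega>) \<longleftrightarrow> jump_to S n \<omega>" for n \<omega>
  proof -
    have "pre n \<omega> ! l = \<omega> l" if "l \<le> n" for l using that nth_map_upt[of l "Suc n" 0 \<omega>] by (simp del: upt_Suc)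
    then have "jump_to S n (\<lambda>k. pre n \<omega> ! k) = jump_to S n \<omega>" by (intro jump_to_cong)
    then show ?thesis by (simp add: stop_def del: upt_Suc)
  qed
  have "c * Pr x (\<lambda>\<omega>. \<exists>k. stop (pre k \<omega>)) \<le> Pr x (next_jump S \<Psi>)"
  proof (rule strong_markov[OF event_next_jump[OF assms(1)] assms(2)])
    fix l assume l: "l \<noteq> []" "stop l"
    let ?n = "length l - 1"
    have eq: "app (butlast l) \<omega> k = l ! k" if "k \<le> ?n" "\<omega> 0 = last l" for k \<omega>
      using that l(1) by (auto simp: app_nth nth_butlast last_conv_nth le_less)
    have "c \<le> Pr (last l) \<Psi>"
      using assms(4)[of "last l"] l by (simp add: stop_def jump_to_def last_conv_nth)
    also have "\<dots> \<le> Pr (last l) (\<lambda>\<omega>. next_jump S \<Psi> (app (butlast l) \<omega>))"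
    proof (rule Pr_start_mono[OF assms(1) event_app[OF event_next_jump[OF assms(1)]]])
      fix \<omega> assume \<omega>: "\<omega> 0 = last l" "\<Psi> \<omega>"
      have "jump_to S ?n (app (butlast l) \<omega>)"
        using jump_to_cong[of ?n "app (butlast l) \<omega>" "\<lambda>k. l ! k" S] eq[where \<omega> = \<omega>] \<omega>(1) l by (simp add: stop_def)
      moreover have "(\<lambda>k. app (butlast l) \<omega> (k + ?n)) = \<omega>" by (auto simp: app_nth)
      ultimately show "next_jump S \<Psi> (app (butlast l) \<omega>)"
        using \<omega>(2) unfolding next_jump_def by (intro exI[of _ ?n]) simp
    qed
    finally show "c \<le> Pr (last l) (\<lambda>\<omega>. next_jump S \<Psi> (app (butlast l) \<omega>))" .
  qed
  moreover have "p * c \<le> c * Pr x (\<lambda>\<omega>. \<exists>k. stop (pre k \<omega>))"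
    unfolding stop using assms(2,3) by (simp add: mult.commute mult_left_mono)
  ultimately show ?thesis by simp
qed

lemma basin_not_UNIV: "s \<in> agg_states i \<Longrightarrow> basin i s \<noteq> UNIV"
proof -
  assume s: "s \<in> agg_states i"
  obtain m' where "m' \<in> agg_minima i" "m' \<noteq> s" using two_agg_minima by blast
  then have "m' \<notin> basin i s" using basin_disjoint[of s m' m'] self_in_basin[of m'] s by (auto simp: agg_states_eq)
  then show ?thesis by blast
qed

lemma first_exit_jump:
  assumes "\<omega> 0 \<in> basin i s" "s \<in> agg_states i" "\<omega> n0 \<notin> basin i s"
  obtains n where "first_jump i n \<omega>" "\<omega> n \<notin> basin i s" "n \<le> n0"
proof -
  define n where "n = (LEAST n. \<omega> n \<notin> basin i s)"
  have n: "\<omega> n \<notin> basin i s" "n \<le> n0"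
    using LeastI[of "\<lambda>n. \<omega> n \<notin> basin i s" n0] Least_le[of "\<lambda>n. \<omega> n \<notin> basin i s" n0] assms unfolding n_def by blast+
  have before: "\<omega> k \<in> basin i s" if "k < n" for k using not_less_Least that unfolding n_def by blast
  have "first_jump i n \<omega>" unfolding first_jump_def
    using before n assms by (simp add: agg_iff[OF assms(2)] agg_eq[OF assms(2)])
  then show ?thesis using that n by blast
qed

lemma jump_sure: "Pr x (\<lambda>\<omega>. \<exists>n. jump_to UNIV n \<omega>) = 1"
proof -
  let ?s = "agg i x" and ?V = "basin i (agg i x)"
  have V: "?V \<noteq> UNIV" using basin_not_UNIV agg_in by blast
  \<comment> \<open>With the empty set as competitor, \<open>hit_one_of\<close> says that the basin
    is left almost surely.\<close>
  have "reach {} (- ?V) = (\<lambda>_. False)" by (auto simp: reach_def)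
  then have "hit {} (- ?V) x = 0" by (simp add: hit_def Pr_False)
  moreover have "- ?V \<union> {} \<noteq> {}" using V by blast
  ultimately have "1 \<le> hit (- ?V) {} x" using hit_one_of[of "- ?V" "{}" x] by simp
  also have "\<dots> \<le> Pr x (\<lambda>\<omega>. \<exists>n. jump_to UNIV n \<omega>)" unfolding hit_def
  proof (rule Pr_start_mono[OF event_reach])
    show "event (\<lambda>\<omega>. \<exists>n. jump_to UNIV n \<omega>)" by (intro event_ex event_jump_to)
    fix \<omega> assume \<omega>: "\<omega> 0 = x" "reach (- ?V) {} \<omega>"
    then obtain n0 where "\<omega> n0 \<notin> ?V" by (auto simp: reach_def)
    then obtain n where "first_jump i n \<omega>" using first_exit_jump[of \<omega> ?s n0] \<omega> agg_in by metis
    then show "\<exists>n. jump_to UNIV n \<omega>" by (auto simp: jump_to_def)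
  qed
  finally show ?thesis using Pr_range(2) by (simp add: antisym)
qed

primrec jumps :: "nat \<Rightarrow> (nat \<Rightarrow> 's) \<Rightarrow> bool" where
  "jumps 0 = (\<lambda>_. True)"
| "jumps (Suc K) = next_jump UNIV (jumps K)"

lemma event_jumps: "event (jumps K)"
  by (induction K) (simp_all add: event_next_jump)

lemma jumps_sure: "Pr x (jumps K) = 1"
proof (induction K arbitrary: x)
  case 0 then show ?case by (simp add: Pr_True)
next
  case (Suc K)
  have "1 * 1 \<le> Pr x (next_jump UNIV (jumps K))"
    by (rule next_jump_prob[OF event_jumps]) (use Suc jump_sure in simp_all)
  then show ?case using Pr_range(2)[of x] by (simp add: antisym)
qed

lemma jumps_jump_seq: "jumps K \<omega> \<Longrightarrow> \<exists>t. jump_seq i K t \<omega>"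
proof (induction K arbitrary: \<omega>)
  case 0 then show ?case by (intro exI[of _ "\<lambda>_. 0"]) (simp add: jump_seq_def)
next
  case (Suc K)
  then show ?case unfolding jumps.simps next_jump_def jump_to_def using jump_seq_Suc by blast
qed

text \<open>Claim (a) for the current sojourn. The basin may have been entered anywhere, so the
  stretch that returns begins at some later time \<open>a\<close>.\<close>

definition home :: "(nat \<Rightarrow> 's) \<Rightarrow> bool" where
  "home \<omega> \<longleftrightarrow> (\<exists>a b. (\<forall>l\<le>b. agg i (\<omega> l) = agg i (\<omega> 0)) \<and> returns \<omega> a b)"

lemma event_home: "event home"
  unfolding home_def
proof (intro event_ex)
  fix a b
  show "event (\<lambda>\<omega>. (\<forall>l\<le>b. agg i (\<omega> l) = agg i (\<omega> 0)) \<and> returns \<omega> a b)"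
  proof (rule event_prefix[of "max a b"])
    fix \<omega> \<omega>' :: "nat \<Rightarrow> 's" assume *: "\<And>l. l \<le> max a b \<Longrightarrow> \<omega> l = \<omega>' l"
    then have "\<omega> ` {a..b} = \<omega>' ` {a..b}" "\<omega> a = \<omega>' a" "\<omega> b = \<omega>' b" "\<omega> 0 = \<omega>' 0" by (auto intro!: image_cong)
    moreover have "(\<forall>l\<le>b. agg i (\<omega> l) = agg i (\<omega> 0)) \<longleftrightarrow> (\<forall>l\<le>b. agg i (\<omega>' l) = agg i (\<omega>' 0))" using * by simp
    ultimately show "((\<forall>l\<le>b. agg i (\<omega> l) = agg i (\<omega> 0)) \<and> returns \<omega> a b) \<longleftrightarrow>
      ((\<forall>l\<le>b. agg i (\<omega>' l) = agg i (\<omega>' 0)) \<and> returns \<omega>' a b)" by (simp only: returns_def)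
  qed
qed

text \<open>The first \<open>k\<close> jumps may lead anywhere, since \<open>home\<close> is likely
  from every state. The conjunct \<open>jumps K\<close> guarantees the later jump times, so that the
  horizon is genuine.\<close>

primrec cov :: "nat \<Rightarrow> nat \<Rightarrow> (nat \<Rightarrow> 's) \<Rightarrow> bool" where
  "cov 0 K = (\<lambda>\<omega>. home \<omega> \<and> jumps K \<omega>)"
| "cov (Suc k) K = next_jump UNIV (cov k (K - 1))"

lemma event_cov: "event (cov k K)"
  by (induction k arbitrary: K) (simp_all add: event_next_jump event_conj event_home event_jumps)

lemma cov_covering: "cov k K \<omega> \<Longrightarrow> k < K \<Longrightarrow> covering k K \<omega>"
proof (induction k arbitrary: K \<omega>)
  case 0
  then obtain a b t where ab: "\<forall>l\<le>b. agg i (\<omega> l) = agg i (\<omega> 0)" "returns \<omega> a b" and t: "jump_seq i K t \<omega>"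
    using jumps_jump_seq unfolding cov.simps home_def by blast
  have "t 0 = 0" "agg i (\<omega> (t (Suc 0))) \<noteq> agg i (\<omega> (t 0))"
    using t 0 unfolding jump_seq_def by blast+
  then have "b < t (Suc 0)" using ab(1) by (metis not_le)
  then show ?case unfolding covering_def using t ab \<open>t 0 = 0\<close> by (metis le0)
next
  case (Suc k)
  then obtain n where "first_jump i n \<omega>" "cov k (K - 1) (\<lambda>k. \<omega> (k + n))"
    unfolding cov.simps next_jump_def jump_to_def by blast
  moreover have "k < K - 1" using Suc.prems by simp
  ultimately have "covering (Suc k) (Suc (K - 1)) \<omega>" using Suc.IH covering_Suc by blast
  then show ?case using Suc.prems by simp
qed

lemma cov_prob:
  assumes "0 \<le> c" "\<And>x. c \<le> Pr x home" shows "c \<le> Pr x (cov k K)"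
proof (induction k arbitrary: x K)
  case 0
  then show ?case using assms(2)[of x] Pr_conj_sure[OF event_home event_jumps jumps_sure] by simp
next
  case (Suc k)
  have "1 * c \<le> Pr x (next_jump UNIV (cov k (K - 1)))"
    by (rule next_jump_prob[OF event_cov assms(1)]) (use Suc jump_sure in simp_all)
  then show ?case by simp
qed

lemma stop_prefix:
  assumes "l \<noteq> []" "\<omega> 0 = last l"
  shows "k < length l \<Longrightarrow> app (butlast l) \<omega> k = l ! k"
    and "app (butlast l) \<omega> (k + (length l - 1)) = \<omega> k"
  using assms by (auto simp: app_nth nth_butlast last_conv_nth) (metis One_nat_def Suc_pred length_greater_0_conv less_antisym)

text \<open>A union bound over the strict valley makes the chain visit all of it before leaving.
  Wherever it then is, returning to \<open>m\<close> fails with probability at most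
  \<open>d\<close>.\<close>

lemma visit_return_prob:
  assumes m: "m \<in> agg_minima i" and d: "0 \<le> d" "d \<le> 1"
    and ret: "\<And>x. x \<in> basin i m \<Longrightarrow> hit (- basin i m) {m} x \<le> d"
    and visit: "\<And>v. v \<in> strict_valley i m \<Longrightarrow> hit (- basin i m) {v} m \<le> d"
  defines "W \<equiv> real (card (strict_valley i m))"
  shows "(1 - d) * (1 - W * d) \<le> Pr m (\<lambda>\<omega>. \<exists>b. (\<forall>l\<le>b. \<omega> l \<in> basin i m) \<and> \<omega> b = m \<and> strict_valley i m \<subseteq> \<omega> ` {..b})"
    (is "_ \<le> Pr m ?\<Phi>")
proof -
  let ?V = "basin i m" and ?S = "strict_valley i m"
  have mV: "m \<in> ?V" using self_in_basin m by (simp add: agg_states_eq)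
  have SV: "?S \<subseteq> ?V" using strict_valley_basin m .
  have mS: "m \<in> ?S" using self_strict_valley m .
  have V: "?V \<noteq> UNIV" using basin_not_UNIV m by (simp add: agg_states_eq)
  have ev: "event ?\<Phi>"
  proof (rule event_ex)
    fix b
    show "event (\<lambda>\<omega>. (\<forall>l\<le>b. \<omega> l \<in> ?V) \<and> \<omega> b = m \<and> ?S \<subseteq> \<omega> ` {..b})"
    proof (rule event_prefix[of b])
      fix \<omega> \<omega>' :: "nat \<Rightarrow> 's" assume *: "\<And>l. l \<le> b \<Longrightarrow> \<omega> l = \<omega>' l"
      then have "\<omega> ` {..b} = \<omega>' ` {..b}" by (auto intro!: image_cong)
      then show "((\<forall>l\<le>b. \<omega> l \<in> ?V) \<and> \<omega> b = m \<and> ?S \<subseteq> \<omega> ` {..b}) \<longleftrightarrow>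
        ((\<forall>l\<le>b. \<omega>' l \<in> ?V) \<and> \<omega>' b = m \<and> ?S \<subseteq> \<omega>' ` {..b})" using * by simp
    qed
  qed
  define stop where "stop l \<longleftrightarrow> l \<noteq> [] \<and> set l \<subseteq> ?V \<and> ?S \<subseteq> set l" for l
  have "(1 - d) * Pr m (\<lambda>\<omega>. \<exists>k. stop (pre k \<omega>)) \<le> Pr m ?\<Phi>"
  proof (rule strong_markov[OF ev])
    fix l assume l: "l \<noteq> []" "stop l"
    then have lV: "last l \<in> ?V" by (auto simp: stop_def)
    have "1 - d \<le> hit {m} (- ?V) (last l)"
      using ret[OF lV] hit_one_of[of "{m}" "- ?V" "last l"] mV by auto
    also have "\<dots> \<le> Pr (last l) (\<lambda>\<omega>. ?\<Phi> (app (butlast l) \<omega>))" unfolding hit_def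
    proof (rule Pr_start_mono[OF event_reach event_app[OF ev]])
      fix \<omega> assume \<omega>: "\<omega> 0 = last l" "reach {m} (- ?V) \<omega>"
      then obtain n where n: "\<omega> n = m" "\<forall>k\<le>n. \<omega> k \<in> ?V" by (auto simp: reach_def)
      let ?\<omega> = "app (butlast l) \<omega>" and ?b = "n + (length l - 1)"
      have "?\<omega> k \<in> ?V" if "k \<le> ?b" for k
      proof (cases "k < length l")
        case True then show ?thesis using stop_prefix(1)[of l \<omega>, OF l(1) \<omega>(1) True] l by (auto simp: stop_def)
      next
        case False
        then have "k = (k - (length l - 1)) + (length l - 1)" "k - (length l - 1) \<le> n" using that by auto
        then show ?thesis using stop_prefix(2)[of l \<omega> "k - (length l - 1)", OF l(1) \<omega>(1)] n by metis
      qed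
      moreover have "?\<omega> ?b = m" using stop_prefix(2)[of l \<omega>, OF l(1) \<omega>(1)] n by simp
      moreover have "?S \<subseteq> ?\<omega> ` {..?b}"
      proof
        fix v assume "v \<in> ?S"
        then obtain k where "k < length l" "l ! k = v" using l(2) unfolding stop_def by (metis in_set_conv_nth subsetD)
        then have "?\<omega> k = v" "k \<le> ?b" using stop_prefix(1)[of l \<omega>, OF l(1) \<omega>(1)] by auto
        then show "v \<in> ?\<omega> ` {..?b}" by auto
      qed
      ultimately show "?\<Phi> ?\<omega>" by blast
    qed
    finally show "1 - d \<le> Pr (last l) (\<lambda>\<omega>. ?\<Phi> (app (butlast l) \<omega>))" .
  qed (use d in simp)
  moreover have "1 - W * d \<le> Pr m (\<lambda>\<omega>. \<exists>k. stop (pre k \<omega>))"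
  proof -
    have evn: "event (\<lambda>\<omega>. \<not> reach {v} (- ?V) \<omega>)" for v by (intro event_not event_reach)
    have evb: "event (\<lambda>\<omega>. \<exists>v\<in>?S. \<not> reach {v} (- ?V) \<omega>)"
    proof -
      have "{\<omega>. \<exists>v\<in>?S. \<not> reach {v} (- ?V) \<omega>} = (\<Union>v\<in>?S. {\<omega>. \<not> reach {v} (- ?V) \<omega>})" by auto
      then show ?thesis by (simp only:) (intro sets.finite_UN evn, simp)
    qed
    have "Pr m (\<lambda>\<omega>. \<exists>v\<in>?S. \<not> reach {v} (- ?V) \<omega>) \<le> (\<Sum>v\<in>?S. Pr m (\<lambda>\<omega>. \<not> reach {v} (- ?V) \<omega>))"
      by (rule Pr_Bex_le) (auto intro: evn)
    also have "\<dots> \<le> (\<Sum>v\<in>?S. d)"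
    proof (rule sum_mono)
      fix v assume v: "v \<in> ?S"
      have "hit {v} (- ?V) m = 1 - hit (- ?V) {v} m" using hit_one_of[of "{v}" "- ?V" m] SV v by auto
      then show "Pr m (\<lambda>\<omega>. \<not> reach {v} (- ?V) \<omega>) \<le> d"
        using Pr_not[OF event_reach, of m "{v}" "- ?V"] visit[OF v] by (simp add: hit_def)
    qed
    also have "\<dots> = W * d" by (simp add: W_def)
    finally have "1 - W * d \<le> 1 - Pr m (\<lambda>\<omega>. \<exists>v\<in>?S. \<not> reach {v} (- ?V) \<omega>)" by simp
    also have "\<dots> = Pr m (\<lambda>\<omega>. \<not> (\<exists>v\<in>?S. \<not> reach {v} (- ?V) \<omega>))" using Pr_not[OF evb] by simp
    also have "\<dots> \<le> Pr m (\<lambda>\<omega>. \<exists>k. stop (pre k \<omega>))"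
    proof (rule Pr_mono)
      show "event (\<lambda>\<omega>. \<exists>k. stop (pre k \<omega>))" by (intro event_ex event_pre)
      fix \<omega> assume "\<not> (\<exists>v\<in>?S. \<not> reach {v} (- ?V) \<omega>)"
      then have "\<forall>v\<in>?S. \<exists>n. \<omega> n = v \<and> (\<forall>k\<le>n. \<omega> k \<in> ?V)" unfolding reach_def by auto
      then obtain f where f: "\<And>v. v \<in> ?S \<Longrightarrow> \<omega> (f v) = v \<and> (\<forall>k\<le>f v. \<omega> k \<in> ?V)" by metis
      define n where "n = Max (f ` ?S)"
      have "n \<in> f ` ?S" unfolding n_def by (rule Max_in) (use mS in auto)
      then have "\<forall>k\<le>n. \<omega> k \<in> ?V" using f by auto
      moreover have "?S \<subseteq> \<omega> ` {..n}"
      proof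
        fix v assume v: "v \<in> ?S"
        then have "f v \<le> n" by (simp add: n_def)
        moreover have "v = \<omega> (f v)" using f[OF v] by simp
        ultimately show "v \<in> \<omega> ` {..n}" by (metis atMost_iff image_eqI)
      qed
      ultimately have "stop (pre n \<omega>)" unfolding stop_def
        by (auto simp del: upt_Suc simp: atLeastLessThanSuc_atLeastAtMost atMost_atLeast0)
      then show "\<exists>k. stop (pre k \<omega>)" by blast
    qed
    finally show ?thesis .
  qed
  then have "(1 - d) * (1 - W * d) \<le> (1 - d) * Pr m (\<lambda>\<omega>. \<exists>k. stop (pre k \<omega>))"
    using d by (intro mult_left_mono) auto
  ultimately show ?thesis by simp
qed

end

context landscape_level begin

text \<open>From any state of a basin the chain is likely to visit the minimum before it leaves, so
  the cost of an exit is the energy above the lowest boundary state. That state stands for the whole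
  basin.\<close>

definition pot :: "'s \<Rightarrow> real" where
  "pot s = (if s \<in> unassigned i then E s else E (exit_state i s))"

definition link :: "'s \<Rightarrow> 's \<Rightarrow> bool" where
  "link a s \<longleftrightarrow> a \<in> agg_states i \<and> s \<in> agg_states i \<and> a \<noteq> s \<and> (\<exists>x\<in>basin i a. \<exists>y\<in>basin i s. adj x y)"

primrec climbs :: "'s \<Rightarrow> 's list \<Rightarrow> real" where
  "climbs a [] = 0"
| "climbs a (s # ss) = max 0 (pot s - pot a) + climbs s ss"

primrec links :: "'s \<Rightarrow> 's list \<Rightarrow> bool" where
  "links a [] = True"
| "links a (s # ss) = (link a s \<and> links s ss)"

end

context metropolis begin

text \<open>Three stages may fail: reaching \<open>m\<close> with \<open>d\<close>, visiting the
  strict valley with \<open>W * d\<close>, and returning with \<open>d\<close>. A non-assigned state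
  is at home at time 0.\<close>

lemma home_prob:
  assumes d: "0 \<le> d" "d \<le> 1"
    and ret: "\<And>m x. m \<in> agg_minima i \<Longrightarrow> x \<in> basin i m \<Longrightarrow> hit (- basin i m) {m} x \<le> d"
    and visit: "\<And>m v. m \<in> agg_minima i \<Longrightarrow> v \<in> strict_valley i m \<Longrightarrow> hit (- basin i m) {v} m \<le> d"
    and W: "\<And>m. m \<in> agg_minima i \<Longrightarrow> real (card (strict_valley i m)) \<le> W" "W * d \<le> 1" "0 \<le> W"
  shows "1 - (W + 2) * d \<le> Pr x home"
proof (cases "agg i x \<in> unassigned i")
  case True
  then have x: "x = agg i x" using agg_in(2)[of x] basin_unassigned by auto
  have "Pr x (\<lambda>_. True) \<le> Pr x home"
  proof (rule Pr_start_mono[OF event_const event_home])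
    fix \<omega> :: "nat \<Rightarrow> 's" assume "\<omega> 0 = x"
    then have "returns \<omega> 0 0" using x True by (simp add: returns_def strict_basin_def)
    then show "home \<omega>" unfolding home_def by (intro exI[of _ 0]) simp
  qed
  moreover have "0 \<le> (W + 2) * d" using d W by simp
  ultimately show ?thesis by (simp add: Pr_True)
next
  case False
  define m where "m = agg i x"
  have m: "m \<in> agg_minima i" and xV: "x \<in> basin i m"
    using False agg_in[of x] by (auto simp: m_def agg_states_eq)
  have ms: "m \<in> agg_states i" using m by (simp add: agg_states_eq)
  let ?V = "basin i m" and ?S = "strict_valley i m"
  have mV: "m \<in> ?V" using self_in_basin ms .
  have SB: "strict_basin i m = ?S" using m by (simp add: strict_basin_def agg_minima_def)
  let ?\<Phi> = "\<lambda>\<omega> :: nat \<Rightarrow> 's. \<exists>b. (\<forall>l\<le>b. \<omega> l \<in> ?V) \<and> \<omega> b = m \<and> ?S \<subseteq> \<omega> ` {..b}"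
  have ev: "event ?\<Phi>"
  proof (rule event_ex)
    fix b
    show "event (\<lambda>\<omega>. (\<forall>l\<le>b. \<omega> l \<in> ?V) \<and> \<omega> b = m \<and> ?S \<subseteq> \<omega> ` {..b})"
    proof (rule event_prefix[of b])
      fix \<omega> \<omega>' :: "nat \<Rightarrow> 's" assume *: "\<And>l. l \<le> b \<Longrightarrow> \<omega> l = \<omega>' l"
      then have "\<omega> ` {..b} = \<omega>' ` {..b}" by (auto intro!: image_cong)
      then show "((\<forall>l\<le>b. \<omega> l \<in> ?V) \<and> \<omega> b = m \<and> ?S \<subseteq> \<omega> ` {..b}) \<longleftrightarrow>
        ((\<forall>l\<le>b. \<omega>' l \<in> ?V) \<and> \<omega>' b = m \<and> ?S \<subseteq> \<omega>' ` {..b})" using * by simp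
    qed
  qed
  define w where "w = real (card ?S)"
  have w: "w \<le> W" "w * d \<le> 1" "0 \<le> w"
    using W(1)[OF m] W(2) mult_right_mono[of w W d] d by (auto simp: w_def)
  define c where "c = (1 - d) * (1 - w * d)"
  have c: "0 \<le> c" "c \<le> Pr m ?\<Phi>"
    using d w visit_return_prob[OF m d ret[OF m] visit[OF m]] by (simp_all add: c_def w_def)
  define stop where "stop l \<longleftrightarrow> l \<noteq> [] \<and> set l \<subseteq> ?V \<and> last l = m" for l
  have "c * Pr x (\<lambda>\<omega>. \<exists>k. stop (pre k \<omega>)) \<le> Pr x home"
  proof (rule strong_markov[OF event_home c(1)])
    fix l assume l: "l \<noteq> []" "stop l"
    then have lm: "last l = m" and lV: "set l \<subseteq> ?V" by (auto simp: stop_def)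
    have "c \<le> Pr (last l) ?\<Phi>" using c lm by simp
    also have "\<dots> \<le> Pr (last l) (\<lambda>\<omega>. home (app (butlast l) \<omega>))"
    proof (rule Pr_start_mono[OF ev event_app[OF event_home]])
      fix \<omega> assume \<omega>: "\<omega> 0 = last l" "?\<Phi> \<omega>"
      from \<omega>(2) obtain b where "(\<forall>l\<le>b. \<omega> l \<in> ?V) \<and> \<omega> b = m \<and> ?S \<subseteq> \<omega> ` {..b}" ..
      then have b: "\<forall>l\<le>b. \<omega> l \<in> ?V" "\<omega> b = m" "?S \<subseteq> \<omega> ` {..b}" by simp_all
      let ?\<omega> = "app (butlast l) \<omega>" and ?a = "length l - 1"
      have inV: "?\<omega> k \<in> ?V" if "k \<le> b + ?a" for k
      proof (cases "k < length l")
        case True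
        then have "l ! k \<in> ?V" using lV nth_mem by blast
        then show ?thesis using stop_prefix(1)[of l \<omega>, OF l(1) \<omega>(1) True] by simp
      next
        case False
        then have "k - ?a + ?a = k" "k - ?a \<le> b" using that by auto
        then have "?\<omega> k = \<omega> (k - ?a)" using stop_prefix(2)[of l \<omega> "k - ?a", OF l(1) \<omega>(1)] by simp
        then show ?thesis using b(1) \<open>k - ?a \<le> b\<close> by simp
      qed
      then have "\<forall>k\<le>b + ?a. agg i (?\<omega> k) = agg i (?\<omega> 0)" using agg_eq[OF ms] by simp
      moreover have "returns ?\<omega> ?a (b + ?a)" unfolding returns_def
      proof (intro conjI)
        show a: "?\<omega> ?a = agg i (?\<omega> ?a)"
          using stop_prefix(2)[of l \<omega> 0, OF l(1) \<omega>(1)] \<omega>(1) lm agg_eq[OF ms mV] by simp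
        have am: "?\<omega> ?a = m" using stop_prefix(2)[of l \<omega> 0, OF l(1) \<omega>(1)] \<omega>(1) lm by simp
        then show "?\<omega> (b + ?a) = ?\<omega> ?a" using stop_prefix(2)[of l \<omega> b, OF l(1) \<omega>(1)] b(2) by simp
        show "strict_basin i (?\<omega> ?a) \<subseteq> ?\<omega> ` {?a..b + ?a}" unfolding am SB
        proof
          fix v assume "v \<in> ?S"
          then obtain k where "k \<le> b" "\<omega> k = v" using b(3) by auto
          then have "?\<omega> (k + ?a) = v" "k + ?a \<in> {?a..b + ?a}"
            using stop_prefix(2)[of l \<omega> k, OF l(1) \<omega>(1)] by auto
          then show "v \<in> ?\<omega> ` {?a..b + ?a}" by blast
        qed
      qed simp
      ultimately show "home ?\<omega>" unfolding home_def by blast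
    qed
    finally show "c \<le> Pr (last l) (\<lambda>\<omega>. home (app (butlast l) \<omega>))" .
  qed
  moreover have "1 - d \<le> Pr x (\<lambda>\<omega>. \<exists>k. stop (pre k \<omega>))"
  proof -
    have V: "?V \<noteq> UNIV" using basin_not_UNIV ms .
    have "1 - d \<le> hit {m} (- ?V) x"
      using ret[OF m xV] hit_one_of[of "{m}" "- ?V" x] mV by auto
    also have "\<dots> \<le> Pr x (\<lambda>\<omega>. \<exists>k. stop (pre k \<omega>))" unfolding hit_def
    proof (rule Pr_mono)
      show "event (\<lambda>\<omega>. \<exists>k. stop (pre k \<omega>))" by (intro event_ex event_pre)
      fix \<omega> assume "reach {m} (- ?V) \<omega>"
      then obtain n where "\<omega> n = m" "\<forall>k\<le>n. \<omega> k \<in> ?V" by (auto simp: reach_def)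
      then have "stop (pre n \<omega>)" by (auto simp: stop_def)
      then show "\<exists>k. stop (pre k \<omega>)" by blast
    qed
    finally show ?thesis .
  qed
  then have "c * (1 - d) \<le> c * Pr x (\<lambda>\<omega>. \<exists>k. stop (pre k \<omega>))" using c by (intro mult_left_mono)
  moreover have "1 - (W + 2) * d \<le> c * (1 - d)"
  proof -
    have "1 - 2 * d \<le> (1 - d) * (1 - d)" by (simp add: algebra_simps)
    then have "(1 - 2 * d) * (1 - w * d) \<le> (1 - d) * (1 - d) * (1 - w * d)"
      using w by (intro mult_right_mono) auto
    moreover have "1 - (W + 2) * d \<le> (1 - 2 * d) * (1 - w * d)"
    proof -
      have "(1 - 2 * d) * (1 - w * d) = 1 - (w + 2) * d + 2 * (w * (d * d))" by (simp add: algebra_simps)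
      moreover have "(w + 2) * d \<le> (W + 2) * d" using w d by (intro mult_right_mono) auto
      moreover have "0 \<le> w * (d * d)" using w d by simp
      ultimately show ?thesis by linarith
    qed
    ultimately show ?thesis by (simp add: c_def mult.commute mult.left_commute)
  qed
  ultimately show ?thesis by linarith
qed

section \<open>Prescribed paths of the aggregated chain\<close>

primrec follow :: "'s list \<Rightarrow> (nat \<Rightarrow> 's) \<Rightarrow> bool" where
  "follow [] = (\<lambda>_. True)"
| "follow (s # ss) = next_jump {s} (follow ss)"

lemma event_follow: "event (follow ss)"
  by (induction ss) (simp_all add: event_next_jump)

lemma follow_jump_seq:
  assumes "follow ss \<omega>"
  shows "\<exists>t. jump_seq i (length ss) t \<omega> \<and> (\<forall>j\<le>length ss. agg i (\<omega> (t j)) = (agg i (\<omega> 0) # ss) ! j)"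
  using assms
proof (induction ss arbitrary: \<omega>)
  case Nil then show ?case by (intro exI[of _ "\<lambda>_. 0"]) (simp add: jump_seq_def)
next
  case (Cons s ss)
  then obtain n where n: "first_jump i n \<omega>" "agg i (\<omega> n) = s" "follow ss (\<lambda>k. \<omega> (k + n))"
    by (auto simp: next_jump_def jump_to_def)
  obtain t where t: "jump_seq i (length ss) t (\<lambda>k. \<omega> (k + n))"
    "\<forall>j\<le>length ss. agg i (\<omega> (t j + n)) = (agg i (\<omega> (0 + n)) # ss) ! j"
    using Cons.IH[OF n(3)] by auto
  let ?t = "case_nat 0 (\<lambda>j. t j + n)"
  have "agg i (\<omega> (?t j)) = (agg i (\<omega> 0) # s # ss) ! j" if "j \<le> length (s # ss)" for j
    using that t(2) n(2) by (cases j) auto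
  then show ?case using jump_seq_Suc[OF n(1) t(1)] by (intro exI[of _ ?t]) simp
qed

definition \<kappa> :: real where "\<kappa> = 1 / (4 * N\<^sup>2 * r\<^sup>2)"

lemma \<kappa>_pos: "\<kappa> > 0" using N_ge r by (simp add: \<kappa>_def)

text \<open>From a non-assigned state one transition suffices, and it goes downhill when it enters
  the basin of a minimum. From such a basin, \<open>s\<close> is a boundary state and
  \<open>exit_prob\<close> applies.\<close>

lemma link_prob:
  assumes l: "link a s" and x: "x \<in> basin i a"
    and half: "\<And>m x. m \<in> agg_minima i \<Longrightarrow> x \<in> basin i m \<Longrightarrow> hit (- basin i m) {m} x \<le> 1 / 2"
  shows "\<kappa> * exp (- \<beta> * max 0 (pot s - pot a)) \<le> Pr x (\<lambda>\<omega>. \<exists>n. jump_to {s} n \<omega>)"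
proof -
  have as: "a \<in> agg_states i" "s \<in> agg_states i" "a \<noteq> s" using l by (auto simp: link_def)
  obtain u y where uy: "u \<in> basin i a" "y \<in> basin i s" "adj u y" using l by (auto simp: link_def)
  have ev: "event (\<lambda>\<omega>. \<exists>n. jump_to {s} n \<omega>)" by (intro event_ex event_jump_to)
  have yV: "y \<notin> basin i a" using basin_disjoint as uy by blast
  show ?thesis
  proof (cases "a \<in> unassigned i")
    case True
    then have xa: "x = a" "u = a" using x uy basin_unassigned by auto
    have ne: "a \<noteq> y" using yV xa uy(1) by blast
    have up: "max 0 (E y - E a) \<le> max 0 (pot s - pot a)"
    proof (cases "s \<in> unassigned i")
      case True2: True
      then show ?thesis using uy basin_unassigned True by (simp add: pot_def)
    next
      case False
      then have "E y < E a"
        using unassigned_above_basin[OF True, of s y] as uy xa adj_sym by (auto simp: agg_states_eq)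
      then show ?thesis by simp
    qed
    have "\<kappa> \<le> 1 / r"
    proof -
      have "1 \<le> N\<^sup>2" using N_ge by simp
      moreover have "r \<le> r\<^sup>2" using r_ge by (simp add: power2_eq_square)
      ultimately have "1 * r \<le> N\<^sup>2 * r\<^sup>2" using r by (intro mult_mono) auto
      then have "r \<le> 4 * N\<^sup>2 * r\<^sup>2" using r by simp
      moreover have "0 < 4 * N\<^sup>2 * r\<^sup>2 * r" using N_ge r by simp
      ultimately show ?thesis unfolding \<kappa>_def by (intro divide_left_mono) simp_all
    qed
    then have "\<kappa> * exp (- \<beta> * max 0 (pot s - pot a)) \<le> 1 / r * exp (- \<beta> * max 0 (E y - E a))"
      using up \<beta> \<kappa>_pos r by (intro mult_mono) auto
    also have "\<dots> \<le> q a y" using q_lower[OF ne] uy xa by simp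
    also have "\<dots> = Pr a (\<lambda>\<omega>. \<omega> 1 = y)"
    proof -
      have "Pr a (\<lambda>\<omega>. \<omega> 1 = y) = (\<Sum>z\<in>UNIV. q a z * Pr z (\<lambda>\<omega>. \<omega> 0 = y))"
        using first_step[OF event_coord, of a 1 y] by simp
      also have "\<dots> = (\<Sum>z\<in>UNIV. (if z = y then q a z else 0))"
      proof (intro sum.cong refl)
        fix z
        have "Pr z (\<lambda>\<omega>. \<omega> 0 = y) \<le> Pr z (\<lambda>_. False)" if "z \<noteq> y"
          by (rule Pr_start_mono[OF event_coord event_const]) (use that in auto)
        then show "q a z * Pr z (\<lambda>\<omega>. \<omega> 0 = y) = (if z = y then q a z else 0)"
          using Pr_start[of z] Pr_range(1)[of z "\<lambda>\<omega>. \<omega> 0 = y"] by (cases "z = y") (auto simp: Pr_False)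
      qed
      also have "\<dots> = q a y" by simp
      finally show ?thesis by simp
    qed
    also have "\<dots> \<le> Pr a (\<lambda>\<omega>. \<exists>n. jump_to {s} n \<omega>)"
    proof (rule Pr_start_mono[OF event_coord ev])
      fix \<omega> :: "nat \<Rightarrow> 's" assume "\<omega> 0 = a" "\<omega> 1 = y"
      moreover have "agg i y = s" "agg i a = a" using agg_eq[OF as(2) uy(2)] agg_eq[OF as(1), of a] uy(1) xa by simp_all
      ultimately have "jump_to {s} 1 \<omega>" using as(3) by (simp add: jump_to_def first_jump_def)
      then show "\<exists>n. jump_to {s} n \<omega>" by blast
    qed
    finally show ?thesis using xa by simp
  next
    case False
    then have a: "a \<in> agg_minima i" using as by (auto simp: agg_states_eq)
    have yb: "y \<in> bdry a" using bdryI[OF uy(1) yV] uy q_adj by blast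
    then have yu: "y \<in> unassigned i" using boundary_unassigned[OF a] by (auto simp: bdry_def)
    then have "y \<in> agg_states i" "y \<in> basin i y" using basin_unassigned[OF yu] by (simp_all add: agg_states_eq)
    then have sy: "s = y" using basin_disjoint[OF as(2) _ uy(2)] by blast
    have "pot s = E y" "pot a = E (exit_state i a)" using yu False sy by (simp_all add: pot_def)
    then have "max 0 (pot s - pot a) = E y - E (exit_state i a)" using exit_state_le(2)[OF a yb] by simp
    then have "\<kappa> * exp (- \<beta> * max 0 (pot s - pot a)) = exp (- \<beta> * (E y - E (exit_state i a))) / (4 * N\<^sup>2 * r\<^sup>2)"
      by (simp add: \<kappa>_def)
    also have "\<dots> \<le> hit {y} (- basin i a - {y}) x" by (rule exit_prob[OF a yb x half[OF a]])
    also have "\<dots> \<le> Pr x (\<lambda>\<omega>. \<exists>n. jump_to {s} n \<omega>)" unfolding hit_def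
    proof (rule Pr_start_mono[OF event_reach ev])
      fix \<omega> assume \<omega>: "\<omega> 0 = x" "reach {y} (- basin i a - {y}) \<omega>"
      then obtain n0 where n0: "\<omega> n0 = y" "\<forall>k\<le>n0. \<omega> k \<in> basin i a \<or> \<omega> k = y" by (auto simp: reach_def)
      have "\<omega> 0 \<in> basin i a" "\<omega> n0 \<notin> basin i a" using \<omega>(1) x n0(1) yV by simp_all
      then obtain n where n: "first_jump i n \<omega>" "\<omega> n \<notin> basin i a" "n \<le> n0"
        using first_exit_jump[OF _ as(1)] by blast
      then have "\<omega> n = y" using n0 by blast
      then have "jump_to {s} n \<omega>" using n agg_eq[OF as(2) uy(2)] by (simp add: jump_to_def)
      then show "\<exists>n. jump_to {s} n \<omega>" by blast
    qed
    finally show ?thesis .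
  qed
qed

lemma follow_prob:
  assumes "links a ss" "x \<in> basin i a"
    and half: "\<And>m x. m \<in> agg_minima i \<Longrightarrow> x \<in> basin i m \<Longrightarrow> hit (- basin i m) {m} x \<le> 1 / 2"
  shows "\<kappa> ^ length ss * exp (- \<beta> * climbs a ss) \<le> Pr x (follow ss)"
  using assms(1,2)
proof (induction ss arbitrary: a x)
  case Nil then show ?case by (simp add: Pr_True)
next
  case (Cons s ss)
  then have l: "link a s" "links s ss" by auto
  have "(\<kappa> * exp (- \<beta> * max 0 (pot s - pot a))) * (\<kappa> ^ length ss * exp (- \<beta> * climbs s ss)) \<le> Pr x (next_jump {s} (follow ss))"
  proof (rule next_jump_prob[OF event_follow])
    show "0 \<le> \<kappa> ^ length ss * exp (- \<beta> * climbs s ss)" using \<kappa>_pos by simp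
    show "\<kappa> * exp (- \<beta> * max 0 (pot s - pot a)) \<le> Pr x (\<lambda>\<omega>. \<exists>n. jump_to {s} n \<omega>)"
      using link_prob[OF l(1) Cons.prems(2) half] .
    show "\<kappa> ^ length ss * exp (- \<beta> * climbs s ss) \<le> Pr x' (follow ss)" if "agg i x' \<in> {s}" for x'
      using Cons.IH[OF l(2), of x'] that agg_in(2)[of x'] by simp
  qed
  moreover have "(\<kappa> * exp (- \<beta> * max 0 (pot s - pot a))) * (\<kappa> ^ length ss * exp (- \<beta> * climbs s ss)) =
    \<kappa> ^ length (s # ss) * exp (- \<beta> * climbs a (s # ss))"
  proof -
    have "exp (- \<beta> * climbs a (s # ss)) = exp (- \<beta> * max 0 (pot s - pot a)) * exp (- \<beta> * climbs s ss)"
      by (subst exp_add[symmetric]) (simp add: algebra_simps)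
    then show ?thesis by (simp add: mult_ac)
  qed
  ultimately show ?case unfolding follow.simps by (simp only:)
qed

text \<open>Never returning to \<open>a\<close> separates index 0 from all later ones, however the
  path behaves among these.\<close>

lemma follow_stays_first:
  assumes "follow ss \<omega>" "\<omega> 0 \<in> basin i a" "a \<in> agg_states i" "a \<notin> set ss" "ss \<noteq> []"
  shows "stays_in_basins i (length ss) 1 \<omega>"
proof -
  obtain t where t: "jump_seq i (length ss) t \<omega>" "\<And>j. j \<le> length ss \<Longrightarrow> agg i (\<omega> (t j)) = (a # ss) ! j"
    using follow_jump_seq[OF assms(1)] agg_eq[OF assms(3,2)] by auto
  have "separated (length ss) t \<omega> (Suc 0)" unfolding separated_def
  proof (intro allI ballI impI)
    fix j1 j2 :: nat assume "j1 < Suc 0" "j2 \<in> {Suc 0..length ss}"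
    then have "j1 = 0" "(a # ss) ! j2 \<in> set ss" by (auto simp: nth_Cons')
    then show "agg i (\<omega> (t j1)) \<noteq> agg i (\<omega> (t j2))" using t(2)[of j1] t(2)[of j2] \<open>j2 \<in> _\<close> assms(4) by auto
  qed
  moreover have "separated (length ss) t \<omega> 0" by (simp add: separated_def)
  ultimately show ?thesis using separated_stays[OF t(1), of 0] assms(5) by (simp add: stays_in_basins_def)
qed

lemma follow_stays_all:
  assumes "follow ss \<omega>" "\<omega> 0 \<in> basin i a" "a \<in> agg_states i" "distinct (a # ss)"
  shows "stays_in_basins i (length ss) (length ss) \<omega>"
proof -
  obtain t where t: "jump_seq i (length ss) t \<omega>" "\<And>j. j \<le> length ss \<Longrightarrow> agg i (\<omega> (t j)) = (a # ss) ! j"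
    using follow_jump_seq[OF assms(1)] agg_eq[OF assms(3,2)] by auto
  have "separated (length ss) t \<omega> j" for j unfolding separated_def
  proof (intro allI ballI impI)
    fix j1 j2 assume j: "j1 < j" "j2 \<in> {j..length ss}"
    then have "(a # ss) ! j1 \<noteq> (a # ss) ! j2" using assms(4) by (subst nth_eq_iff_index_eq) auto
    then show "agg i (\<omega> (t j1)) \<noteq> agg i (\<omega> (t j2))" using t(2)[of j1] t(2)[of j2] j by auto
  qed
  then show ?thesis using separated_stays[OF t(1)] by (simp add: stays_in_basins_def)
qed

end

section \<open>Cheap paths of the aggregated chain\<close>

context landscape_level begin

lemma link_sym: "link a s \<Longrightarrow> link s a"
  unfolding link_def using adj_sym by blast

lemma linkI: "a \<in> agg_states i \<Longrightarrow> x \<in> basin i a \<Longrightarrow> adj x y \<Longrightarrow> agg i y \<noteq> a \<Longrightarrow> link a (agg i y)"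
  unfolding link_def using agg_in by blast

lemma link_minimum:
  assumes "link a s" "a \<in> agg_minima i" shows "s \<in> bdry a" "s \<in> unassigned i"
proof -
  obtain x y where xy: "x \<in> basin i a" "y \<in> basin i s" "adj x y" "a \<noteq> s" "a \<in> agg_states i" "s \<in> agg_states i"
    using assms by (auto simp: link_def)
  have "y \<notin> basin i a" using basin_disjoint xy by blast
  then have yb: "y \<in> bdry a" using bdry_adj xy by blast
  then have yu: "y \<in> unassigned i" using boundary_unassigned assms(2) by (auto simp: bdry_def)
  then have "y \<in> basin i y" "y \<in> agg_states i" by (simp_all add: basin_unassigned agg_states_eq)
  then have "s = y" using basin_disjoint xy by blast
  then show "s \<in> bdry a" "s \<in> unassigned i" using yb yu by simp_all
qed

lemma minimum_not_unassigned: "a \<in> agg_minima i \<Longrightarrow> a \<notin> unassigned i"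
  by (simp add: agg_minima_def)

lemma pot_unassigned: "n \<in> unassigned i \<Longrightarrow> pot n = E n"
  by (simp add: pot_def)

lemma pot_minimum: "a \<in> agg_minima i \<Longrightarrow> pot a = E (exit_state i a)"
  by (simp add: pot_def minimum_not_unassigned)

lemma link_pot:
  assumes "link n a" "a \<in> agg_minima i" shows "pot a \<le> pot n"
  using link_minimum[OF link_sym[OF assms(1)] assms(2)] exit_state_le(2)[OF assms(2), of n] assms(2)
  by (simp add: pot_minimum pot_unassigned)

lemma agg_state_cases: "s \<in> agg_states i \<Longrightarrow> s \<in> agg_minima i \<or> s \<in> unassigned i"
  by (auto simp: agg_states_eq)

lemma agg_unassigned: "y \<in> unassigned i \<Longrightarrow> agg i y = y"
  by (rule agg_eq) (simp_all add: agg_states_eq basin_unassigned)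

text \<open>The moves that climb by at most \<epsilon>. Entering the basin of a minimum climbs by
  nothing, by \<open>link_pot\<close>.\<close>

definition low :: "real \<Rightarrow> 's \<Rightarrow> 's set" where
  "low \<epsilon> a = {s. link a s \<and> pot s \<le> pot a + \<epsilon>}"

lemma low_agg:
  assumes "n \<in> unassigned i" "adj n y" "agg i y \<noteq> n" "E y \<le> E n + \<epsilon>" "0 \<le> \<epsilon>"
  shows "agg i y \<in> low \<epsilon> n"
proof -
  have l: "link n (agg i y)" using linkI[of n n y] assms by (simp add: agg_states_eq basin_unassigned)
  have "pot (agg i y) \<le> E n + \<epsilon>"
  proof (cases "agg i y \<in> unassigned i")
    case True
    then have "agg i y = y" using agg_in(2)[of y] basin_unassigned by auto
    then show ?thesis using True assms by (simp add: pot_unassigned)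
  next
    case False
    then have "agg i y \<in> agg_minima i" using agg_in(1)[of y] agg_state_cases by blast
    then show ?thesis using link_pot[OF l] assms by (simp add: pot_unassigned)
  qed
  then show ?thesis using l assms by (simp add: low_def pot_unassigned)
qed

lemma low_irrefl: "a \<notin> low \<epsilon> a"
  by (simp add: low_def link_def)

lemma eta2_le_low:
  assumes a: "a \<in> agg_minima i" shows "eta2 i \<epsilon> \<le> card (low \<epsilon> a)"
proof -
  have "eta2 i \<epsilon> \<le> card {s \<in> outer_boundary (basin i a). E s \<le> E (exit_state i a) + \<epsilon>}"
    unfolding eta2_def using a by (intro Min_le) auto
  also have "\<dots> \<le> card (low \<epsilon> a)"
  proof (rule card_mono)
    show "{s \<in> outer_boundary (basin i a). E s \<le> E (exit_state i a) + \<epsilon>} \<subseteq> low \<epsilon> a"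
    proof safe
      fix s assume s: "s \<in> outer_boundary (basin i a)" "E s \<le> E (exit_state i a) + \<epsilon>"
      then have su: "s \<in> unassigned i" using boundary_unassigned[OF a] by blast
      obtain x where x: "x \<in> basin i a" "adj x s" using boundary_above[OF a s(1)] by blast
      have "link a (agg i s)" using linkI[of a x s] a x agg_unassigned[OF su] minimum_not_unassigned[OF a] su
        by (auto simp: agg_states_eq)
      then show "s \<in> low \<epsilon> a" using s agg_unassigned[OF su] by (simp add: low_def pot_minimum a pot_unassigned su)
    qed
  qed simp
  finally show ?thesis .
qed

text \<open>The summand 1 is \<open>n\<close> itself: adjacency is reflexive, so \<open>n\<close>
  counts in \<open>eta3\<close>, but it is no move.\<close>

lemma eta3_le_low:
  assumes n: "n \<in> unassigned i" and "0 \<le> \<epsilon>" shows "eta3 i \<epsilon> \<le> card (low \<epsilon> n) + 1"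
proof -
  let ?S = "{s \<in> agg_states i. \<exists>x\<in>basin i s \<inter> nbhd n. E x \<le> E n + \<epsilon>}"
  have "eta3 i \<epsilon> \<le> card ?S" unfolding eta3_def using n by (intro Min_le) auto
  also have "\<dots> \<le> card (insert n (low \<epsilon> n))"
  proof (rule card_mono)
    show "?S \<subseteq> insert n (low \<epsilon> n)"
    proof
      fix s assume "s \<in> ?S"
      then obtain x where x: "s \<in> agg_states i" "x \<in> basin i s" "adj n x" "E x \<le> E n + \<epsilon>" by (auto simp: nbhd_def)
      then have "agg i x = s" using agg_eq by blast
      then show "s \<in> insert n (low \<epsilon> n)" using low_agg[OF n x(3) _ x(4) assms(2)] by auto
    qed
  qed simp
  also have "\<dots> = card (low \<epsilon> n) + 1" using low_irrefl by (simp add: card_insert_if)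
  finally show ?thesis .
qed

text \<open>\<open>eta1\<close> removes one basin that meets the neighbourhood of \<open>n\<close>.
  The basin of \<open>m\<close> is removed if it does so, otherwise that of \<open>n\<close> itself;
  of the at least two states that remain, one differs from \<open>n\<close>.\<close>

lemma eta1_escape:
  assumes n: "n \<in> unassigned i" and "0 \<le> \<epsilon>" and two: "2 \<le> eta1 i \<epsilon>" and m: "m \<in> agg_states i"
  shows "\<exists>s\<in>low \<epsilon> n. s \<noteq> m"
proof -
  have key: "\<exists>x. adj n x \<and> x \<notin> basin i r \<and> x \<noteq> n \<and> E x \<le> E n + \<epsilon>"
    if r: "r \<in> agg_states i" "basin i r \<inter> nbhd n \<noteq> {}" for r
  proof -
    let ?F = "\<lambda>(n, r). card {s \<in> nbhd n - basin i r. E s \<le> E n + \<epsilon>}"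
    let ?T = "{s \<in> nbhd n - basin i r. E s \<le> E n + \<epsilon>}"
    let ?C = "{card {s \<in> nbhd n - basin i r. E s \<le> E n + \<epsilon>} | n r.
       n \<in> unassigned i \<and> r \<in> agg_states i \<and> basin i r \<inter> nbhd n \<noteq> {}}"
    have "?C \<subseteq> range ?F" by auto
    then have "finite ?C" by (rule finite_subset) simp
    moreover have "card ?T \<in> ?C" using n r by blast
    ultimately have "eta1 i \<epsilon> \<le> card ?T" unfolding eta1_def by (rule Min_le)
    then have "\<not> ?T \<subseteq> {n}" using two card_mono[of "{n}" ?T] by auto
    then show ?thesis by (auto simp: nbhd_def)
  qed
  obtain r where r: "r \<in> agg_states i" "basin i r \<inter> nbhd n \<noteq> {}"
    and rm: "\<And>x. adj n x \<Longrightarrow> x \<notin> basin i r \<Longrightarrow> x \<notin> basin i m"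
  proof (cases "basin i m \<inter> nbhd n = {}")
    case False then show ?thesis using that m by blast
  next
    case True
    have "n \<in> basin i n \<inter> nbhd n" using basin_unassigned[OF n] adj_refl by (simp add: nbhd_def)
    then show ?thesis using that[of n] n True by (auto simp: agg_states_eq nbhd_def)
  qed
  obtain x where x: "adj n x" "x \<notin> basin i r" "x \<noteq> n" "E x \<le> E n + \<epsilon>" using key[OF r] by blast
  have "agg i x \<noteq> n" using agg_in(2)[of x] basin_unassigned[OF n] x by auto
  then have "agg i x \<in> low \<epsilon> n" using low_agg[OF n x(1) _ x(4) assms(2)] by blast
  moreover have "agg i x \<noteq> m" using rm[OF x(1,2)] agg_in(2)[of x] by auto
  ultimately show ?thesis by blast
qed

primrec lows :: "real \<Rightarrow> 's \<Rightarrow> 's list \<Rightarrow> bool" where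
  "lows \<epsilon> a [] = True"
| "lows \<epsilon> a (s # ss) = (s \<in> low \<epsilon> a \<and> lows \<epsilon> s ss)"

lemma lows_append: "lows \<epsilon> a (ss @ ts) \<longleftrightarrow> lows \<epsilon> a ss \<and> lows \<epsilon> (last (a # ss)) ts"
  by (induction ss arbitrary: a) auto

lemma links_append: "links a (ss @ ts) \<longleftrightarrow> links a ss \<and> links (last (a # ss)) ts"
  by (induction ss arbitrary: a) auto

lemma climbs_append: "climbs a (ss @ ts) = climbs a ss + climbs (last (a # ss)) ts"
  by (induction ss arbitrary: a) auto

lemma lows_links: "lows \<epsilon> a ss \<Longrightarrow> links a ss"
  by (induction ss arbitrary: a) (auto simp: low_def)

lemma lows_climbs: "0 \<le> \<epsilon> \<Longrightarrow> lows \<epsilon> a ss \<Longrightarrow> climbs a ss \<le> real (length ss) * \<epsilon>"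
proof (induction ss arbitrary: a)
  case (Cons s ss)
  then have "climbs s ss \<le> real (length ss) * \<epsilon>" "max 0 (pot s - pot a) \<le> \<epsilon>" by (auto simp: low_def)
  moreover have "real (length (s # ss)) * \<epsilon> = \<epsilon> + real (length ss) * \<epsilon>" by (simp add: distrib_right)
  ultimately show ?case unfolding climbs.simps by linarith
qed simp

lemma lows_in: "lows \<epsilon> a ss \<Longrightarrow> a \<in> agg_states i \<Longrightarrow> set ss \<subseteq> agg_states i"
  by (induction ss arbitrary: a) (auto simp: low_def link_def)

text \<open>Claim (b) for one index forbids only the return to \<open>m\<close>, so other states may
  be repeated and one low move away from \<open>m\<close> suffices at each state.\<close>

lemma avoiding_path:
  assumes "0 \<le> \<epsilon>" "m \<in> agg_states i" "2 \<le> eta1 i \<epsilon>" "2 \<le> eta2 i \<epsilon>" "a \<in> agg_states i"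
  shows "\<exists>ss. length ss = K \<and> lows \<epsilon> a ss \<and> m \<notin> set ss"
  using assms(5)
proof (induction K arbitrary: a)
  case (Suc K)
  have "\<exists>s\<in>low \<epsilon> a. s \<noteq> m"
  proof (cases "a \<in> unassigned i")
    case True then show ?thesis using eta1_escape assms by blast
  next
    case False
    then have "a \<in> agg_minima i" using Suc.prems agg_state_cases by blast
    then have "2 \<le> card (low \<epsilon> a)" using eta2_le_low[of a \<epsilon>] assms by simp
    then have "\<not> low \<epsilon> a \<subseteq> {m}" using card_mono[of "{m}" "low \<epsilon> a"] by auto
    then show ?thesis by blast
  qed
  then obtain s where s: "s \<in> low \<epsilon> a" "s \<noteq> m" by blast
  then have "s \<in> agg_states i" by (auto simp: low_def link_def)
  then obtain ss where "length ss = K" "lows \<epsilon> s ss" "m \<notin> set ss" using Suc.IH by blast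
  then show ?case using s by (intro exI[of _ "s # ss"]) auto
qed simp

text \<open>This supplies the minimum needed for the rotation. Energies decrease strictly along the
  non-assigned states, so nothing is repeated.\<close>

lemma descending_path:
  assumes "n \<in> unassigned i" "0 \<le> \<epsilon>"
  shows "\<exists>ss. lows \<epsilon> n ss \<and> distinct (n # ss) \<and> set ss \<inter> agg_minima i \<noteq> {} \<and>
    (\<forall>s\<in>set ss. s \<in> unassigned i \<longrightarrow> E s < E n)"
  using assms(1)
proof (induction "card {s. E s < E n}" arbitrary: n rule: less_induct)
  case less
  obtain y where y: "adj n y" "E y < E n" using unassigned_downhill[OF less.prems] by blast
  let ?s = "agg i y"
  have "y \<noteq> n" using y by auto
  then have sn: "?s \<noteq> n" using agg_in(2)[of y] basin_unassigned[OF less.prems] by auto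
  have low: "?s \<in> low \<epsilon> n" by (rule low_agg[OF less.prems y(1) sn]) (use y assms in auto)
  show ?case
  proof (cases "?s \<in> agg_minima i")
    case True
    then show ?thesis using low sn minimum_not_unassigned by (intro exI[of _ "[?s]"]) auto
  next
    case False
    then have su: "?s \<in> unassigned i" using agg_in(1)[of y] agg_state_cases by blast
    then have sy: "?s = y" using agg_in(2)[of y] basin_unassigned by auto
    have "{s. E s < E y} \<subset> {s. E s < E n}" using y by auto
    then have "card {s. E s < E y} < card {s. E s < E n}" by (intro psubset_card_mono) auto
    then obtain ss where ss: "lows \<epsilon> y ss" "distinct (y # ss)" "set ss \<inter> agg_minima i \<noteq> {}"
      "\<forall>s\<in>set ss. s \<in> unassigned i \<longrightarrow> E s < E y" using less.hyps[of y] su sy by auto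
    have "n \<notin> set ss" using ss(4) less.prems y by force
    then show ?thesis using ss low sy y \<open>y \<noteq> n\<close> by (intro exI[of _ "y # ss"]) force
  qed
qed

text \<open>Walking back a move with increment \<open>D \<le> \<epsilon>\<close> costs
  \<open>max 0 (- D)\<close>, at most \<open>\<epsilon> - D\<close>, and the increments
  telescope.\<close>

lemma reversed_path:
  assumes "0 \<le> \<epsilon>" "lows \<epsilon> a vs"
  shows "links (last (a # vs)) (tl (rev (a # vs)))"
    and "climbs (last (a # vs)) (tl (rev (a # vs))) \<le> pot a - pot (last (a # vs)) + real (length vs) * \<epsilon>"
proof -
  have "links (last (a # vs)) (tl (rev (a # vs))) \<and>
    climbs (last (a # vs)) (tl (rev (a # vs))) \<le> pot a - pot (last (a # vs)) + real (length vs) * \<epsilon>"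
    using assms(2)
  proof (induction vs rule: rev_induct)
    case (snoc z vs)
    let ?y = "last (a # vs)"
    have z: "lows \<epsilon> a vs" "link ?y z" "pot z \<le> pot ?y + \<epsilon>" using snoc.prems by (auto simp: lows_append low_def)
    have "rev (a # vs) = ?y # tl (rev (a # vs))" by (metis hd_Cons_tl hd_rev list.discI rev_is_Nil_conv)
    then have e: "tl (rev (a # vs @ [z])) = ?y # tl (rev (a # vs))" by simp
    have l: "last (a # vs @ [z]) = z" by simp
    have "max 0 (pot ?y - pot z) \<le> pot ?y - pot z + \<epsilon>" using z(3) assms(1) by auto
    then show ?case unfolding e l using snoc.IH[OF z(1)] link_sym[OF z(2)]
      by (auto simp: algebra_simps simp del: rev.simps)
  qed simp
  then show "links (last (a # vs)) (tl (rev (a # vs)))"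
    "climbs (last (a # vs)) (tl (rev (a # vs))) \<le> pot a - pot (last (a # vs)) + real (length vs) * \<epsilon>" by auto
qed

text \<open>While the path has fewer than \<open>K - 1\<close> moves, its other states are too few
  to contain all low moves from the last one.\<close>

lemma extend_path:
  assumes low: "\<And>a. a \<in> agg_states i \<Longrightarrow> K \<le> card (low \<epsilon> a) + 1"
    and v: "v \<in> agg_states i" "lows \<epsilon> v ss" "distinct (v # ss)" "length ss < K"
  shows "\<exists>ts. lows \<epsilon> v (ss @ ts) \<and> distinct (v # ss @ ts) \<and> length (ss @ ts) = K - 1"
  using v
proof (induction "K - length ss" arbitrary: ss rule: less_induct)
  case less
  show ?case
  proof (cases "length ss = K - 1")
    case True then show ?thesis using less.prems by (intro exI[of _ "[]"]) simp
  next
    case False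
    let ?e = "last (v # ss)"
    have "?e \<in> agg_states i" using lows_in[OF less.prems(2,1)] less.prems(1) by (cases "ss = []") auto
    then have "K - 1 \<le> card (low \<epsilon> ?e)" using low by fastforce
    moreover have "card (set (v # ss) - {?e}) = length ss"
    proof -
      have "?e \<in> set (v # ss)" by (rule last_in_set) simp
      then show ?thesis using distinct_card[OF less.prems(3)] card_Diff_singleton[of ?e "set (v # ss)"] by simp
    qed
    ultimately have "card (set (v # ss) - {?e}) < card (low \<epsilon> ?e)" using False less.prems(4) by simp
    then have "\<not> low \<epsilon> ?e \<subseteq> set (v # ss) - {?e}" using card_mono[of "set (v # ss) - {?e}"] by (metis List.finite_set finite_Diff leD)
    then obtain u where u: "u \<in> low \<epsilon> ?e" "u \<notin> set (v # ss)" using low_irrefl by blast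
    have "\<exists>ts. lows \<epsilon> v ((ss @ [u]) @ ts) \<and> distinct (v # (ss @ [u]) @ ts) \<and> length ((ss @ [u]) @ ts) = K - 1"
      by (rule less.hyps) (use less.prems u False in \<open>auto simp: lows_append\<close>)
    then obtain ts where "lows \<epsilon> v ((ss @ [u]) @ ts) \<and> distinct (v # (ss @ [u]) @ ts) \<and> length ((ss @ [u]) @ ts) = K - 1" ..
    then show ?thesis by (intro exI[of _ "u # ts"]) simp
  qed
qed

text \<open>A path that is stuck in its last vertex \<open>z\<close> has all its vertices as neighbours of \<open>z\<close>. Reversing the
  part after the predecessor of a minimum \<open>a\<close> makes \<open>a\<close> the last vertex, and there a fresh neighbour is left.\<close>

lemma rotated_path:
  assumes \<epsilon>: "0 \<le> \<epsilon>" and lowm: "\<And>a. a \<in> agg_minima i \<Longrightarrow> K \<le> card (low \<epsilon> a)"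
    and lown: "\<And>a. a \<in> agg_states i \<Longrightarrow> K \<le> card (low \<epsilon> a) + 1"
    and v: "v \<in> agg_states i" "lows \<epsilon> v ss" "distinct (v # ss)" "set ss \<inter> agg_minima i \<noteq> {}"
    and K: "length ss = K - 1"
  shows "\<exists>ts. length ts = K \<and> links v ts \<and> distinct (v # ts) \<and> climbs v ts \<le> real K * \<epsilon>"
proof -
  let ?z = "last (v # ss)"
  have ss: "ss \<noteq> []" using v(4) by auto
  then have K1: "1 < K" using K by (cases ss) auto
  have as: "set ss \<subseteq> agg_states i" using lows_in v by blast
  have zs: "?z \<in> agg_states i" using as ss by auto
  have fresh: "card (set (v # ss) - {b}) = K - 1" if "b \<in> set (v # ss)" for b
    using that v(3) K by (subst card_Diff_singleton) (auto simp: card_insert_if distinct_card)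
  show ?thesis
  proof (cases "low \<epsilon> ?z \<subseteq> set (v # ss)")
    case False
    then obtain u where u: "u \<in> low \<epsilon> ?z" "u \<notin> set (v # ss)" by blast
    then have l: "lows \<epsilon> v (ss @ [u])" using v by (simp add: lows_append)
    show ?thesis
    proof (intro exI[of _ "ss @ [u]"] conjI)
      show "length (ss @ [u]) = K" using K K1 by simp
      then show "climbs v (ss @ [u]) \<le> real K * \<epsilon>" using lows_climbs[OF \<epsilon> l] by metis
      show "links v (ss @ [u])" using lows_links[OF l] .
      show "distinct (v # ss @ [u])" using v(3) u by auto
    qed
  next
    case True
    then have sub: "low \<epsilon> ?z \<subseteq> set (v # ss) - {?z}" using low_irrefl by blast
    have cz: "card (set (v # ss) - {?z}) = K - 1" by (rule fresh) (use ss in auto)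
    have c1: "card (low \<epsilon> ?z) \<le> K - 1" using card_mono[OF _ sub] cz by simp
    have zn: "?z \<notin> agg_minima i" using lowm[of ?z] c1 K1 by auto
    have "card (low \<epsilon> ?z) = K - 1" using c1 lown[OF zs] by simp
    then have all: "low \<epsilon> ?z = set (v # ss) - {?z}" using card_subset_eq[OF _ sub] cz by simp
    obtain a where a: "a \<in> set ss" "a \<in> agg_minima i" using v(4) by blast
    then obtain us vs where e: "ss = us @ a # vs" by (meson split_list)
    have vs: "vs \<noteq> []" using zn a e by auto
    then have z: "?z = last (a # vs)" using e by simp
    let ?w = "last (v # us)"
    have lus: "lows \<epsilon> v us" and wa: "a \<in> low \<epsilon> ?w" and lvs: "lows \<epsilon> a vs"
      using v(2) unfolding e lows_append by auto
    have "?w \<noteq> ?z" using v(3) vs unfolding e by (cases "us = []") (auto dest: last_in_set)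
    then have wz: "?w \<in> low \<epsilon> ?z" unfolding all using e by (cases "us = []") auto
    have "\<not> low \<epsilon> a \<subseteq> set (v # ss) - {a}"
      using card_mono[of "set (v # ss) - {a}" "low \<epsilon> a"] lowm[OF a(2)] fresh[of a] a K1 by auto
    then obtain u where u: "u \<in> low \<epsilon> a" "u \<notin> set (v # ss)" using low_irrefl by blast
    define R where "R = tl (rev (a # vs))"
    have rev: "rev (a # vs) = ?z # R" unfolding R_def z
      by (metis hd_Cons_tl hd_rev list.discI rev_is_Nil_conv)
    have R: "links ?z R" "climbs ?z R \<le> pot a - pot ?z + real (length vs) * \<epsilon>"
      using reversed_path[OF \<epsilon> lvs] unfolding R_def z by auto
    have lastR: "last (?z # R) = a" using rev by (metis last_rev list.sel(1) list.discI)
    let ?ts = "us @ (?z # R) @ [u]"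
    \<comment> \<open>The move to \<open>?z\<close> and the reversed stretch contribute
      \<open>pot ?z - pot ?w\<close> and \<open>pot a - pot ?z\<close>. By this inequality their sum
      is at most 0, which leaves one \<epsilon> per move.\<close>
    have aw: "pot a \<le> pot ?w" using wa a(2) link_pot by (auto simp: low_def)
    show ?thesis
    proof (intro exI[of _ ?ts] conjI)
      have "length (?z # R) = Suc (length vs)" using rev by (metis length_rev length_Cons)
      then show "length ?ts = K" using K K1 e by simp
      show "distinct (v # ?ts)"
        unfolding rev[symmetric] unfolding e using v(3)[unfolded e] u(2)[unfolded e] by auto
      show "links v ?ts"
        using lows_links[OF lus] R(1) link_sym[of ?z ?w] wz u(1) lastR
        by (auto simp: links_append low_def simp del: last.simps)
      have "climbs v ?ts = climbs v us + (max 0 (pot ?z - pot ?w) + climbs ?z R) + max 0 (pot u - pot a)"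
        using lastR by (simp add: climbs_append del: last.simps)
      moreover have "climbs v us \<le> real (length us) * \<epsilon>" using lows_climbs[OF \<epsilon> lus] .
      moreover have "max 0 (pot ?z - pot ?w) \<le> pot ?z - pot ?w + \<epsilon>" using wz \<epsilon> by (auto simp: low_def)
      moreover have "max 0 (pot u - pot a) \<le> \<epsilon>" using u(1) \<epsilon> by (auto simp: low_def)
      ultimately have "climbs v ?ts \<le> real (length us) * \<epsilon> + \<epsilon> + real (length vs) * \<epsilon> + \<epsilon>" using R(2) aw by linarith
      also have "\<dots> = real (length us + length vs + 2) * \<epsilon>" by (simp add: algebra_simps)
      also have "length us + length vs + 2 = K" using K K1 e by simp
      finally show "climbs v ?ts \<le> real K * \<epsilon>" .
    qed
  qed
qed

text \<open>The path of MB2 climbs \<open>hgt ?e b - E ?e\<close> in total, and MB1 with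
  \<open>boundary_hgt\<close> bounds this by \<epsilon>. Until it enters the basin of
  \<open>b\<close> it meets no other valley, so its states are non-assigned and the path is one of
  the aggregated chain.\<close>

lemma uphill_path:
  assumes mb: "has_metabasins i \<epsilon>" and \<epsilon>: "0 \<le> \<epsilon>" and a: "a \<in> agg_minima i"
  shows "\<exists>ss. lows \<epsilon> a ss \<and> distinct (a # ss) \<and> set ss \<inter> agg_minima i \<noteq> {}"
proof -
  let ?e = "exit_state i a"
  have eb: "?e \<in> bdry a" using exit_state_le(1)[OF a] .
  then have eu: "?e \<in> unassigned i" using boundary_unassigned[OF a] by (auto simp: bdry_def)
  have "MB1 i \<epsilon> a" "MB2 i a" using mb a by (auto simp: has_metabasins_def)
  then obtain b g where b: "b \<in> agg_minima i" "b \<noteq> a" and g: "uphill_downhill_path ?e b g"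
    and avoid: "\<And>n. n \<in> agg_minima i \<Longrightarrow> n \<noteq> b \<Longrightarrow> set g \<inter> basin i n = {}"
    unfolding MB2_def by fastforce
  have gp: "g \<in> paths ?e b" and climb: "climb g = hgt ?e b - E ?e"
    using g by (auto simp: uphill_downhill_path_def minimal_path_iff hgt_def)
  have "hgt a b \<le> (SUP b\<in>agg_minima i - {a}. E (ess_saddle a b))"
    unfolding hgt_def using b by (intro cSUP_upper) auto
  then have "hgt a b \<le> E ?e + \<epsilon>" using \<open>MB1 i \<epsilon> a\<close> by (simp add: MB1_def)
  moreover have "hgt ?e a = E ?e" using boundary_hgt[OF a] eb by (simp add: bdry_def)
  ultimately have climb_le: "climb g \<le> \<epsilon>" using climb hgt_ultra[of ?e b a] \<epsilon> by (auto simp: max_def split: if_splits)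
  have step: "E (g ! Suc l) \<le> E (g ! l) + \<epsilon>" if "Suc l < length g" for l
  proof -
    have "max 0 (E (g ! Suc l) - E (g ! (Suc l - 1))) \<le> climb g"
      unfolding climb_def by (rule member_le_sum) (use that in auto)
    then show ?thesis using climb_le by simp
  qed
  have bg: "b \<in> set g \<inter> basin i b" using gp self_in_basin b by (auto simp: paths_def agg_states_eq)
  then obtain us x vs where gs: "g = us @ x # vs" "x \<in> basin i b" "\<forall>u\<in>set us. u \<notin> basin i b"
    using split_list_first_prop[of g "\<lambda>u. u \<in> basin i b"] by blast
  have uu: "u \<in> unassigned i" if "u \<in> set us" for u
  proof (rule ccontr)
    assume "u \<notin> unassigned i"
    then have "agg i u \<in> agg_minima i"
      using agg_in[of u] agg_state_cases[of "agg i u"] basin_unassigned by fastforce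
    then have "agg i u = b" using avoid[of "agg i u"] agg_in(2)[of u] that gs(1) by auto
    then show False using gs(3) that agg_in(2)[of u] by auto
  qed
  have "us \<noteq> []"
  proof
    assume "us = []"
    then have "?e \<in> basin i b" using gs gp by (auto simp: paths_def)
    then show False using unassigned_not_basin[OF eu b(1)] by simp
  qed
  then have us: "us = ?e # tl us" using gp gs(1) by (cases us) (auto simp: paths_def)
  have adjg: "adj (g ! l) (g ! Suc l)" if "Suc l < length g" for l
    using gp that by (auto simp: paths_def successively_conv_nth)
  have lus: "lows \<epsilon> (hd us) (tl us)"
  proof -
    have "lows \<epsilon> (us ! k) (take l (drop (Suc k) us))" if "k + l < length us" for k l
      using that
    proof (induction l arbitrary: k)
      case (Suc l)
      let ?y = "us ! Suc k"
      have k: "Suc k < length us" using Suc.prems by simp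
      then have gk: "g ! k = us ! k" "g ! Suc k = ?y" "Suc k < length g" using gs(1) by (auto simp: nth_append)
      have un: "us ! k \<in> unassigned i" "?y \<in> unassigned i" using uu k by auto
      have ne: "?y \<noteq> us ! k" using gp k gs(1) by (auto simp: paths_def nth_eq_iff_index_eq)
      have "agg i ?y \<in> low \<epsilon> (us ! k)"
        by (rule low_agg[OF un(1)]) (use adjg[OF gk(3)] step[OF gk(3)] gk agg_unassigned[OF un(2)] ne \<epsilon> in simp_all)
      then have "?y \<in> low \<epsilon> (us ! k)" using agg_unassigned[OF un(2)] by simp
      moreover have "drop (Suc k) us = ?y # drop (Suc (Suc k)) us" using k by (simp add: Cons_nth_drop_Suc)
      ultimately show ?case using Suc.IH[of "Suc k"] Suc.prems by simp
    qed simp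
    from this[of 0 "length us - 1"] show ?thesis using \<open>us \<noteq> []\<close> by (cases us) auto
  qed
  have lb: "b \<in> low \<epsilon> (last us)"
  proof -
    have lu: "last us \<in> unassigned i" using uu \<open>us \<noteq> []\<close> by simp
    have "adj (last us) x" using gp gs(1) \<open>us \<noteq> []\<close> by (auto simp: paths_def successively_append_iff)
    moreover have "agg i x = b" using agg_eq[of b x] gs(2) b by (simp add: agg_states_eq)
    moreover have "b \<noteq> last us" using lu minimum_not_unassigned[OF b(1)] by auto
    ultimately have "link (last us) b" using linkI[of "last us" "last us" x] lu
      by (simp add: agg_states_eq basin_unassigned)
    then show ?thesis using link_pot[OF _ b(1)] \<epsilon> by (fastforce simp: low_def)
  qed
  have le: "?e \<in> low \<epsilon> a"
  proof -
    obtain y where "y \<in> basin i a" "adj y ?e" using boundary_above[OF a] eb by (auto simp: bdry_def)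
    moreover have "?e \<noteq> a" using eu minimum_not_unassigned[OF a] by auto
    ultimately have "link a ?e" using linkI[of a y ?e] a agg_unassigned[OF eu] by (simp add: agg_states_eq)
    then show ?thesis using pot_minimum[OF a] pot_unassigned[OF eu] \<epsilon> by (simp add: low_def)
  qed
  have "lows \<epsilon> a (us @ [b])"
  proof -
    have "last (a # us) = last us" using \<open>us \<noteq> []\<close> by simp
    moreover have "lows \<epsilon> a us" using lus le us by (metis list.sel(1) lows.simps(2))
    ultimately show ?thesis using lb by (simp add: lows_append del: last.simps)
  qed
  moreover have "distinct (a # us @ [b])"
    using gp gs(1) uu b minimum_not_unassigned[OF a] minimum_not_unassigned[OF b(1)] by (auto simp: paths_def)
  ultimately show ?thesis using b by (intro exI[of _ "us @ [b]"]) auto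
qed

text \<open>The start is chosen to pass through a minimum, which the rotation needs in case the
  greedy extension is stuck before the last move. A start that is already long enough is
  cut.\<close>

lemma self_avoiding_path:
  assumes mb: "has_metabasins i \<epsilon>" and \<epsilon>: "0 \<le> \<epsilon>" and v: "v \<in> agg_states i" and K: "1 \<le> K"
    and eta: "K \<le> eta2 i \<epsilon>" "K \<le> eta3 i \<epsilon>"
  shows "\<exists>ts. length ts = K \<and> links v ts \<and> distinct (v # ts) \<and> climbs v ts \<le> real K * \<epsilon>"
proof -
  have lowm: "K \<le> card (low \<epsilon> a)" if "a \<in> agg_minima i" for a
    using eta2_le_low[OF that, of \<epsilon>] eta by simp
  have lown: "K \<le> card (low \<epsilon> a) + 1" if "a \<in> agg_states i" for a
    using lowm[of a] eta3_le_low[of a \<epsilon>] eta \<epsilon> agg_state_cases[OF that] by fastforce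
  obtain ss where ss: "lows \<epsilon> v ss" "distinct (v # ss)" "set ss \<inter> agg_minima i \<noteq> {}"
    using uphill_path[OF mb \<epsilon>, of v] descending_path[of v \<epsilon>] \<epsilon> agg_state_cases[OF v] by blast
  show ?thesis
  proof (cases "length ss < K")
    case False
    have s: "ss = take K ss @ drop K ss" by simp
    have l: "lows \<epsilon> v (take K ss)" using ss(1) lows_append[of \<epsilon> v "take K ss" "drop K ss"] by simp
    have "length (take K ss) = K" using False by simp
    then have "climbs v (take K ss) \<le> real K * \<epsilon>" using lows_climbs[OF \<epsilon> l] by metis
    moreover have "distinct (v # take K ss)" using ss(2) by (auto dest: in_set_takeD)
    ultimately show ?thesis using lows_links[OF l] False by (intro exI[of _ "take K ss"]) simp
  next
    case True
    obtain ts where ts: "lows \<epsilon> v (ss @ ts)" "distinct (v # ss @ ts)" "length (ss @ ts) = K - 1"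
      using extend_path[OF lown v ss(1,2) True] by blast
    have "set (ss @ ts) \<inter> agg_minima i \<noteq> {}" using ss(3) by auto
    then show ?thesis using rotated_path[OF \<epsilon> lowm lown v ts(1,2) _ ts(3)] by blast
  qed
qed

end

section \<open>The given chains as approximate Metropolis chains\<close>

locale metabasin_setting = metastable_chain E adj p sd \<gamma> + landscape_level E adj lm i
  for E :: "'s::finite \<Rightarrow> real" and adj :: "'s \<Rightarrow> 's \<Rightarrow> bool" and p :: "real \<Rightarrow> 's \<Rightarrow> 's \<Rightarrow> real"
    and sd :: "real \<Rightarrow> 's \<Rightarrow> real" and \<gamma> :: "real \<Rightarrow> real" and lm :: "nat \<Rightarrow> 's" and i :: nat +
  fixes P :: "real \<Rightarrow> 's \<Rightarrow> 'w measure" and X :: "real \<Rightarrow> nat \<Rightarrow> 'w \<Rightarrow> 's"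
  assumes process: "\<beta> > 0 \<Longrightarrow> markov_chain_from (p \<beta>) x (P \<beta> x) (X \<beta>)"
begin

lemma card_ge: "real CARD('s) \<ge> 1"
proof -
  have "card (UNIV :: 's set) > 0" by (simp add: card_gt_0_iff)
  then show ?thesis by linarith
qed

lemma sd_pos: assumes \<beta>: "\<beta> > 0" shows "sd \<beta> x > 0"
proof -
  have "\<exists>s. sd \<beta> s > 0"
  proof (rule ccontr)
    assume "\<not> ?thesis"
    then have "(\<Sum>s\<in>UNIV. sd \<beta> s) = 0" using sd_nonneg[OF \<beta>] by (intro sum.neutral) (auto simp: not_less antisym)
    then show False using sd_sum[OF \<beta>] by simp
  qed
  then obtain s where s: "sd \<beta> s > 0" by blast
  show ?thesis using metastable_chain_axioms[THEN metastable_chain.irreducible, of s x]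
  proof (induction rule: rtranclp_induct)
    case (step y z)
    have "sd \<beta> z * p \<beta> z y > 0"
      using detailed_balance[OF \<beta>, of y z] step adj_iff[OF \<beta>, of y z] by (metis mult_pos_pos)
    then show ?case using sd_nonneg[OF \<beta>, of z] by (metis less_eq_real_def mult_zero_left)
  qed (rule s)
qed

text \<open>The stationary distribution relative to the Gibbs factor. It need not be constant, but
  detailed balance lets it change along an edge by at most the factor in
  \<open>weight_edge\<close>.\<close>

definition weight :: "real \<Rightarrow> 's \<Rightarrow> real" where "weight \<beta> x = sd \<beta> x * exp (\<beta> * E x)"

lemma weight_pos: "\<beta> > 0 \<Longrightarrow> weight \<beta> x > 0"
  by (simp add: weight_def sd_pos)

lemma weight_edge:
  assumes \<beta>: "\<beta> > 0" and a: "adj x y"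
  shows "weight \<beta> x \<le> weight \<beta> y * exp (2 * \<beta> * (\<gamma> \<beta> / real CARD('s)))"
proof (cases "x = y")
  case True
  have "0 \<le> 2 * \<beta> * (\<gamma> \<beta> / real CARD('s))" using \<beta> \<gamma>_pos[OF \<beta>] card_ge by simp
  then have "1 \<le> exp (2 * \<beta> * (\<gamma> \<beta> / real CARD('s)))" by simp
  then show ?thesis using True weight_pos[OF \<beta>, of y] by simp
next
  case False
  define g where "g = \<gamma> \<beta> / real CARD('s)"
  let ?u = "- \<beta> * (max 0 (E y - E x) + g)" and ?v = "- \<beta> * (max 0 (E x - E y) - g)"
  have "sd \<beta> x * exp ?u \<le> sd \<beta> x * p \<beta> x y"
    unfolding g_def using p_lower[OF \<beta> False a] sd_nonneg[OF \<beta>] by (intro mult_left_mono)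
  also have "\<dots> = sd \<beta> y * p \<beta> y x" by (rule detailed_balance[OF \<beta>])
  also have "\<dots> \<le> sd \<beta> y * exp ?v"
    unfolding g_def using p_upper[OF \<beta> _ adj_sym[OF a], of] False sd_nonneg[OF \<beta>] by (intro mult_left_mono) auto
  finally have "sd \<beta> x * exp ?u * exp (\<beta> * E x - ?u) \<le> sd \<beta> y * exp ?v * exp (\<beta> * E x - ?u)" by (intro mult_right_mono) auto
  moreover have "exp ?u * exp (\<beta> * E x - ?u) = exp (\<beta> * E x)" by (simp flip: exp_add)
  moreover have "exp ?v * exp (\<beta> * E x - ?u) = exp (\<beta> * E y) * exp (2 * \<beta> * g)"
  proof -
    have "?v + (\<beta> * E x - ?u) = \<beta> * E y + 2 * \<beta> * g" by (auto simp: max_def algebra_simps)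
    then show ?thesis by (metis exp_add)
  qed
  ultimately show ?thesis unfolding weight_def g_def by (simp only: mult.assoc)
qed

text \<open>A self-avoiding path has at most \<open>CARD('s) - 1\<close> edges. The division of
  \<open>\<gamma> \<beta>\<close> by the number of states keeps the accumulated factor below
  \<open>exp (2 * \<beta> * \<gamma> \<beta>)\<close>.\<close>

lemma weight_le:
  assumes \<beta>: "\<beta> > 0"
  shows "weight \<beta> x \<le> weight \<beta> y * exp (2 * \<beta> * (\<gamma> \<beta> / real CARD('s)) * (real CARD('s) - 1))"
proof -
  define g where "g = 2 * \<beta> * (\<gamma> \<beta> / real CARD('s))"
  have g0: "0 \<le> g" using \<beta> \<gamma>_pos[OF \<beta>] card_ge by (simp add: g_def)
  have *: "weight \<beta> (hd l) \<le> weight \<beta> (last l) * exp (g * (real (length l) - 1))"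
    if "successively adj l" "l \<noteq> []" for l
    using that
  proof (induction l)
    case (Cons a l)
    show ?case
    proof (cases "l = []")
      case True then show ?thesis by simp
    next
      case False
      then have "weight \<beta> a \<le> weight \<beta> (hd l) * exp g" using Cons weight_edge[OF \<beta>, of a "hd l", folded g_def]
        by (auto simp: successively_Cons)
      also have "\<dots> \<le> weight \<beta> (last l) * exp (g * (real (length l) - 1)) * exp g"
        using Cons False by (intro mult_right_mono) (auto simp: successively_Cons)
      also have "\<dots> = weight \<beta> (last (a # l)) * exp (g * (real (length (a # l)) - 1))"
        using False by (simp add: mult.assoc flip: exp_add) (simp add: algebra_simps)
      finally show ?thesis by simp
    qed
  qed simp
  obtain l where l: "l \<in> paths x y" using paths_nonempty by blast
  have "length l = card (set l)" using l by (simp add: paths_def distinct_card)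
  also have "\<dots> \<le> card (UNIV :: 's set)" by (rule card_mono) auto
  finally have len: "real (length l) \<le> real CARD('s)" by simp
  have "weight \<beta> x \<le> weight \<beta> y * exp (g * (real (length l) - 1))" using *[of l] l by (auto simp: paths_def)
  also have "\<dots> \<le> weight \<beta> y * exp (g * (real CARD('s) - 1))"
    using len g0 weight_pos[OF \<beta>, of y] by (intro mult_left_mono) (auto intro: mult_left_mono)
  finally show ?thesis unfolding g_def .
qed

text \<open>\<open>lm 1\<close> is an arbitrary reference state. The comparison of weights leaves
  two shares \<open>\<beta> * \<gamma> \<beta> / CARD('s)\<close> of the exponent of
  \<open>r\<close>, and the error of \<open>p\<close> takes one of them.\<close>

lemma metropolis_at:
  assumes \<beta>: "\<beta> > 0"
  shows "metropolis E adj lm i (p \<beta>) (sd \<beta>) (P \<beta>) (X \<beta>) \<beta> (weight \<beta> (lm 1)) (exp (2 * \<beta> * \<gamma> \<beta>))"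
proof -
  let ?q = "p \<beta>" and ?\<mu> = "sd \<beta>" and ?r = "exp (2 * \<beta> * \<gamma> \<beta>)" and ?Z = "weight \<beta> (lm 1)"
  define g where "g = \<gamma> \<beta> / real CARD('s)"
  have g: "0 < g" "g * real CARD('s) = \<gamma> \<beta>" using \<gamma>_pos[OF \<beta>] card_ge by (auto simp: g_def)
  have Z: "0 < ?Z" using weight_pos[OF \<beta>] .
  interpret R: rev_chain ?q ?\<mu>
  proof
    show "(\<lambda>x y. 0 < ?q x y)\<^sup>*\<^sup>* x y" for x y
    proof -
      have "(\<lambda>x y. 0 < ?q x y) = adj" using adj_iff[OF \<beta>] by (intro ext) simp
      then show ?thesis using metastable_chain_axioms[THEN metastable_chain.irreducible, of x y] by simp
    qed
  qed (rule p_nonneg[OF \<beta>] p_sum[OF \<beta>] sd_pos[OF \<beta>] detailed_balance[OF \<beta>])+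
  interpret L: markov_law ?q ?\<mu> "P \<beta>" "X \<beta>"
    by unfold_locales (rule process[OF \<beta>])
  have c: "R.cond x y = weight \<beta> x * exp (- \<beta> * E x) * ?q x y" for x y
    by (simp add: R.cond_def weight_def mult.assoc exp_minus)
  have expn: "exp (2 * \<beta> * (\<gamma> \<beta> / real CARD('s)) * (real CARD('s) - 1)) * exp (\<beta> * g) \<le> ?r"
  proof -
    have "2 * \<beta> * (\<gamma> \<beta> / real CARD('s)) * (real CARD('s) - 1) + \<beta> * g = 2 * \<beta> * (g * real CARD('s)) - \<beta> * g" by (simp add: g_def[symmetric] algebra_simps)
    also have "\<dots> \<le> 2 * \<beta> * \<gamma> \<beta>" using g \<beta> by simp
    finally show ?thesis by (simp flip: exp_add)
  qed
  show ?thesis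
  proof unfold_locales
    show "(?q x y > 0) = adj x y" for x y using adj_iff[OF \<beta>] by simp
    show "0 < ?Z" by (rule Z)
    show "1 \<le> ?r" using \<beta> \<gamma>_pos[OF \<beta>] by simp
    show "0 < \<beta>" by (rule \<beta>)
    fix x y assume xy: "x \<noteq> y" "adj x y"
    have m: "- \<beta> * E x + - \<beta> * (max 0 (E y - E x) - g) = - \<beta> * max (E x) (E y) + \<beta> * g"
       "- \<beta> * E x + - \<beta> * (max 0 (E y - E x) + g) = - \<beta> * max (E x) (E y) - \<beta> * g"
      by (auto simp: max_def algebra_simps)
    have w: "weight \<beta> x \<le> ?Z * exp (2 * \<beta> * (\<gamma> \<beta> / real CARD('s)) * (real CARD('s) - 1))"
      "?Z \<le> weight \<beta> x * exp (2 * \<beta> * (\<gamma> \<beta> / real CARD('s)) * (real CARD('s) - 1))" using weight_le[OF \<beta>] by blast+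
    have "R.cond x y \<le> weight \<beta> x * exp (- \<beta> * E x) * exp (- \<beta> * (max 0 (E y - E x) - g))"
      unfolding c g_def using p_upper[OF \<beta> xy] weight_pos[OF \<beta>, of x] by (intro mult_left_mono) auto
    also have "\<dots> = weight \<beta> x * (exp (- \<beta> * max (E x) (E y)) * exp (\<beta> * g))"
      unfolding mult.assoc exp_add[symmetric] m(1) ..
    also have "\<dots> \<le> (?Z * exp (2 * \<beta> * (\<gamma> \<beta> / real CARD('s)) * (real CARD('s) - 1))) * (exp (- \<beta> * max (E x) (E y)) * exp (\<beta> * g))"
      using w by (intro mult_right_mono) auto
    also have "\<dots> = ?Z * exp (- \<beta> * max (E x) (E y)) * (exp (2 * \<beta> * (\<gamma> \<beta> / real CARD('s)) * (real CARD('s) - 1)) * exp (\<beta> * g))"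
      by simp
    also have "\<dots> \<le> ?Z * exp (- \<beta> * max (E x) (E y)) * ?r"
      using expn Z by (intro mult_left_mono) auto
    finally show "R.cond x y \<le> ?Z * exp (- \<beta> * max (E x) (E y)) * ?r" .
    have low: "weight \<beta> x * (exp (- \<beta> * max (E x) (E y)) * exp (- \<beta> * g)) \<le> R.cond x y"
    proof -
      have "weight \<beta> x * exp (- \<beta> * E x) * exp (- \<beta> * (max 0 (E y - E x) + g)) \<le> R.cond x y"
        unfolding c g_def using p_lower[OF \<beta> xy] weight_pos[OF \<beta>, of x] by (intro mult_left_mono) auto
      moreover have "exp (- \<beta> * E x) * exp (- \<beta> * (max 0 (E y - E x) + g)) = exp (- \<beta> * max (E x) (E y)) * exp (- \<beta> * g)"
        unfolding exp_add[symmetric] m(2) by simp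
      ultimately show ?thesis by (simp add: mult.assoc)
    qed
    have "?Z * exp (- \<beta> * max (E x) (E y)) \<le> (weight \<beta> x * exp (2 * \<beta> * (\<gamma> \<beta> / real CARD('s)) * (real CARD('s) - 1))) * exp (- \<beta> * max (E x) (E y))"
      using w by (intro mult_right_mono) auto
    also have "\<dots> = weight \<beta> x * (exp (- \<beta> * max (E x) (E y)) * exp (- \<beta> * g)) * (exp (2 * \<beta> * (\<gamma> \<beta> / real CARD('s)) * (real CARD('s) - 1)) * exp (\<beta> * g))"
      by (simp add: exp_minus)
    also have "\<dots> \<le> R.cond x y * ?r"
      using low expn weight_pos[OF \<beta>, of x] R.cond_nonneg by (intro mult_mono) auto
    finally show "?Z * exp (- \<beta> * max (E x) (E y)) / ?r \<le> R.cond x y" by (simp add: pos_divide_le_eq)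
    have "g \<le> \<gamma> \<beta>" using g card_ge mult_left_mono[of 1 "real CARD('s)" g] by simp
    then have "\<beta> * g \<le> \<beta> * (2 * \<gamma> \<beta>)" using \<beta> \<gamma>_pos[OF \<beta>] by (intro mult_left_mono) auto
    then have "exp (- \<beta> * max 0 (E y - E x)) / ?r \<le> exp (- \<beta> * (max 0 (E y - E x) + g))"
      by (simp add: algebra_simps flip: exp_diff)
    then show "exp (- \<beta> * max 0 (E y - E x)) / ?r \<le> ?q x y" using p_lower[OF \<beta> xy] unfolding g_def by simp
  qed
qed

section \<open>Asymptotics of the error terms\<close>

lemma E_hgt: "E (ess_saddle x y) = hgt x y" by (simp add: hgt_def)

lemma card_nbhd_ge: "real (MAX r. card (nbhd r)) \<ge> 1"
proof -
  have "lm 1 \<in> nbhd (lm 1)" using adj_refl by (simp add: nbhd_def)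
  then have "1 \<le> card (nbhd (lm 1))" by (metis One_nat_def Suc_leI card_gt_0_iff empty_iff finite)
  also have "\<dots> \<le> (MAX r. card (nbhd r))" by (rule Max_ge) auto
  finally show ?thesis by simp
qed

lemma err_const_ge: "err_const \<gamma> \<beta> \<ge> 1"
proof -
  have "1 * 1 * 1 \<le> real CARD('s) * real (MAX r. card (nbhd r)) * (real CARD('s) * exp (- \<beta> * (Min {E a - E b | a b. a \<noteq> b \<and> E a > E b} - 2 * \<gamma> \<beta>)) + 1)"
    using card_ge card_nbhd_ge by (intro mult_mono) auto
  then show ?thesis by (simp add: err_const_def)
qed

lemma err_nonneg: "err \<gamma> x y z \<beta> \<ge> 0"
  using err_const_ge[of \<beta>] by (simp add: err_def)

lemma err_tilde_nonneg: "err_tilde \<gamma> i x a y \<beta> \<ge> 0"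
  unfolding err_tilde_def using err_nonneg by (auto intro!: add_nonneg_nonneg sum_nonneg)

text \<open>The left factor \<open>exp (4 * \<beta> * \<gamma> \<beta>)\<close> is the
  \<open>r\<^sup>2\<close> in \<open>C\<close>. Of the 7 in \<open>err\<close>, 3 are left, and
  \<open>err_const\<close> is at least 1.\<close>

lemma err_lower:
  "exp (4 * \<beta> * \<gamma> \<beta>) * exp (- \<beta> * (hgt x z - hgt x y)) \<le> exp (- 3 * \<beta> * \<gamma> \<beta>) * err \<gamma> x y z \<beta>"
proof -
  have "exp (4 * \<beta> * \<gamma> \<beta>) * exp (- \<beta> * (hgt x z - hgt x y)) = exp (- 3 * \<beta> * \<gamma> \<beta>) * (1 * exp (- \<beta> * (hgt x z - hgt x y - 7 * \<gamma> \<beta>)))"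
    by (simp flip: exp_add) (simp add: algebra_simps)
  also have "\<dots> \<le> exp (- 3 * \<beta> * \<gamma> \<beta>) * err \<gamma> x y z \<beta>"
    unfolding err_def E_hgt using err_const_ge by (intro mult_left_mono mult_right_mono) auto
  finally show ?thesis .
qed

text \<open>Once \<open>2 * \<gamma> \<beta>\<close> is below the smallest energy gap, the
  exponential in \<open>err_const\<close> is at most 1.\<close>

lemma err_const_bounded: "\<exists>B. \<forall>\<^sub>F \<beta> in at_top. err_const \<gamma> \<beta> \<le> B"
proof -
  let ?D = "{E a - E b | a b. a \<noteq> b \<and> E a > E b}"
  have "?D \<subseteq> (\<lambda>(a, b). E a - E b) ` UNIV" by auto
  then have fin: "finite ?D" by (rule finite_subset) simp
  obtain m where m: "m \<in> agg_minima i" using two_agg_minima by blast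
  obtain m' where "m' \<noteq> m" using two_agg_minima by blast
  then have "E m \<noteq> E m'" using E_inj by (auto dest: injD)
  then consider "E m < E m'" | "E m' < E m" by linarith
  then have ne: "?D \<noteq> {}"
  proof cases
    case 1
    then have "E m' - E m \<in> ?D" using \<open>m' \<noteq> m\<close> by blast
    then show ?thesis by blast
  next
    case 2
    then have "E m - E m' \<in> ?D" using \<open>m' \<noteq> m\<close> by blast
    then show ?thesis by blast
  qed
  have "Min ?D > 0" using fin ne by (subst Min_gr_iff) auto
  then have "\<forall>\<^sub>F \<beta> in at_top. \<gamma> \<beta> < Min ?D / 2" using \<gamma>_tendsto by (intro order_tendstoD(2)) auto
  then have "\<forall>\<^sub>F \<beta> in at_top. err_const \<gamma> \<beta> \<le> real CARD('s) * real (MAX r. card (nbhd r)) * (real CARD('s) * 1 + 1)"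
    using eventually_gt_at_top[of 0]
  proof eventually_elim
    case (elim \<beta>)
    then have "exp (- \<beta> * (Min ?D - 2 * \<gamma> \<beta>)) \<le> 1" by simp
    then show ?case unfolding err_const_def by (intro mult_left_mono add_right_mono) auto
  qed
  then show ?thesis by blast
qed

lemma exp_decay: "D > 0 \<Longrightarrow> ((\<lambda>\<beta>. exp (- \<beta> * D)) \<longlongrightarrow> 0) at_top" for D :: real
  by real_asymp

lemma err_tendsto:
  assumes "hgt x y < hgt x z" shows "((\<lambda>\<beta>. err \<gamma> x y z \<beta>) \<longlongrightarrow> 0) at_top"
proof -
  define D where "D = hgt x z - hgt x y"
  have D: "D > 0" using assms by (simp add: D_def)
  obtain B where B: "\<forall>\<^sub>F \<beta> in at_top. err_const \<gamma> \<beta> \<le> B" using err_const_bounded by blast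
  have "\<forall>\<^sub>F \<beta> in at_top. \<gamma> \<beta> < D / 14" using \<gamma>_tendsto D by (intro order_tendstoD(2)) auto
  with B eventually_gt_at_top[of 0] have "\<forall>\<^sub>F \<beta> in at_top. err \<gamma> x y z \<beta> \<le> B * exp (- \<beta> * (D / 2))"
  proof eventually_elim
    case (elim \<beta>)
    have "D / 2 \<le> D - 7 * \<gamma> \<beta>" using elim by simp
    then have "exp (- \<beta> * (D - 7 * \<gamma> \<beta>)) \<le> exp (- \<beta> * (D / 2))" using elim(2) by simp
    then show ?case unfolding err_def E_hgt D_def[symmetric] using elim err_const_ge[of \<beta>]
      by (intro mult_mono) auto
  qed
  moreover have "((\<lambda>\<beta>. B * exp (- \<beta> * (D / 2))) \<longlongrightarrow> 0) at_top"
    using tendsto_mult_right_zero[OF exp_decay[of "D / 2"]] D by simp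
  ultimately show ?thesis
    by (rule tendsto_sandwich[OF always_eventually[OF allI[OF err_nonneg]] _ tendsto_const])
qed

text \<open>Every exponent contains a positive difference of heights: a state above
  \<open>hgt x y\<close> is higher to reach from \<open>x\<close>, and from the strict valley the
  boundary is higher to reach than \<open>a\<close>.\<close>

lemma err_tilde_tendsto:
  assumes a: "a \<in> agg_minima i" and y: "y \<in> outer_boundary (basin i a)"
  shows "((\<lambda>\<beta>. err_tilde \<gamma> i x a y \<beta>) \<longlongrightarrow> 0) at_top"
proof (cases "hgt x a < hgt x y")
  case True
  then show ?thesis using err_tendsto by (simp add: err_tilde_def E_hgt)
next
  case False
  have "((\<lambda>\<beta>. (\<Sum>z\<in>{z. E z > hgt x y}. err \<gamma> x y z \<beta>) + (\<Sum>z\<in>strict_valley i a. err \<gamma> z a y \<beta>)) \<longlongrightarrow> 0 + 0) at_top"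
  proof (intro tendsto_add tendsto_null_sum err_tendsto)
    show "hgt x y < hgt x z" if "z \<in> {z. hgt x y < E z}" for z using that hgt_ge(2)[of z x] by simp
    show "hgt z a < hgt z y" if "z \<in> strict_valley i a" for z
      using strict_valley_less[OF a that] y by (simp add: outer_boundary_def)
  qed
  then show ?thesis using False by (simp add: err_tilde_def E_hgt)
qed

lemma delta_err_ge:
  "x \<in> basin i a \<Longrightarrow> (\<Sum>y\<in>outer_boundary (basin i a). err_tilde \<gamma> i x a y \<beta>) \<le> delta_err \<gamma> i a \<beta>"
  unfolding delta_err_def by (rule Max_ge) auto

lemma max_delta_err_ge: "a \<in> agg_minima i \<Longrightarrow> delta_err \<gamma> i a \<beta> \<le> max_delta_err \<gamma> i \<beta>"
  unfolding max_delta_err_def by (rule Max_ge) auto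

lemma max_delta_err_nonneg: "0 \<le> max_delta_err \<gamma> i \<beta>"
proof -
  obtain a where a: "a \<in> agg_minima i" using two_agg_minima by blast
  then have "a \<in> basin i a" using self_in_basin by (simp add: agg_states_eq)
  have "0 \<le> (\<Sum>y\<in>outer_boundary (basin i a). err_tilde \<gamma> i a a y \<beta>)" by (intro sum_nonneg err_tilde_nonneg)
  then show ?thesis using delta_err_ge[OF \<open>a \<in> basin i a\<close>, of \<beta>] max_delta_err_ge[OF a, of \<beta>] by linarith
qed

lemma max_delta_err_small:
  assumes "c > 0" shows "\<forall>\<^sub>F \<beta> in at_top. max_delta_err \<gamma> i \<beta> \<le> c"
proof -
  have "\<forall>\<^sub>F \<beta> in at_top. (\<Sum>y\<in>outer_boundary (basin i a). err_tilde \<gamma> i x a y \<beta>) \<le> c"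
    if "a \<in> agg_minima i" for a x
  proof -
    have "((\<lambda>\<beta>. \<Sum>y\<in>outer_boundary (basin i a). err_tilde \<gamma> i x a y \<beta>) \<longlongrightarrow> 0) at_top"
      by (intro tendsto_null_sum err_tilde_tendsto that)
    then have "\<forall>\<^sub>F \<beta> in at_top. (\<Sum>y\<in>outer_boundary (basin i a). err_tilde \<gamma> i x a y \<beta>) < c"
      using assms by (rule order_tendstoD(2))
    then show ?thesis by (rule eventually_mono) simp
  qed
  then have "\<forall>\<^sub>F \<beta> in at_top. \<forall>a\<in>agg_minima i. \<forall>x\<in>basin i a.
      (\<Sum>y\<in>outer_boundary (basin i a). err_tilde \<gamma> i x a y \<beta>) \<le> c"
    by (intro eventually_ball_finite ballI) auto
  then show ?thesis
  proof (rule eventually_mono)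
    fix \<beta> assume *: "\<forall>a\<in>agg_minima i. \<forall>x\<in>basin i a. (\<Sum>y\<in>outer_boundary (basin i a). err_tilde \<gamma> i x a y \<beta>) \<le> c"
    have "delta_err \<gamma> i a \<beta> \<le> c" if a: "a \<in> agg_minima i" for a
    proof -
      have "basin i a \<noteq> {}" using self_in_basin[of a] a by (auto simp: agg_states_eq)
      then show ?thesis unfolding delta_err_def using * a by (subst Max_le_iff) auto
    qed
    moreover have "agg_minima i \<noteq> {}" using two_agg_minima by blast
    ultimately show "max_delta_err \<gamma> i \<beta> \<le> c" unfolding max_delta_err_def by (subst Max_le_iff) auto
  qed
qed

lemma escape_le_delta:
  assumes \<beta>: "\<beta> > 0" and a: "a \<in> agg_minima i" and x: "x \<in> basin i a"
  shows "metropolis.escape E adj lm i \<beta> (exp (2 * \<beta> * \<gamma> \<beta>)) a x \<le> real CARD('s) ^ 6 * exp (- 3 * \<beta> * \<gamma> \<beta>) * max_delta_err \<gamma> i \<beta>"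
proof -
  interpret M: metropolis E adj lm i "p \<beta>" "sd \<beta>" "P \<beta>" "X \<beta>" \<beta> "weight \<beta> (lm 1)" "exp (2 * \<beta> * \<gamma> \<beta>)"
    by (rule metropolis_at[OF \<beta>])
  let ?\<rho> = "real CARD('s) ^ 6 * exp (- 3 * \<beta> * \<gamma> \<beta>)"
  have C: "M.C = real CARD('s) ^ 6 * exp (4 * \<beta> * \<gamma> \<beta>)"
    unfolding M.C_def M.N_def by (simp add: power2_eq_square flip: exp_add)
  have cost: "M.C * exp (- \<beta> * (hgt u w - hgt u v)) \<le> ?\<rho> * err \<gamma> u v w \<beta>" for u v w
    unfolding C using mult_left_mono[OF err_lower[of \<beta> u w v], of "(real CARD('s)) ^ 6"] by (simp only: mult.assoc) simp
  have "M.escape a x \<le> (\<Sum>y\<in>bdry a. ?\<rho> * err_tilde \<gamma> i x a y \<beta>)"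
    unfolding M.escape_def
  proof (rule sum_mono)
    fix y
    show "(if hgt x a < hgt x y then M.C * exp (- \<beta> * (hgt x y - hgt x a))
          else \<Sum>z\<in>{z. E z > hgt x y}. M.C * exp (- \<beta> * (hgt x z - hgt x y))) \<le> ?\<rho> * err_tilde \<gamma> i x a y \<beta>"
    proof (cases "hgt x a < hgt x y")
      case True then show ?thesis using cost[where u = x and v = a and w = y] by (simp only: err_tilde_def E_hgt if_True simp_thms)
    next
      case False
      have "(\<Sum>z\<in>{z. E z > hgt x y}. M.C * exp (- \<beta> * (hgt x z - hgt x y))) \<le> (\<Sum>z\<in>{z. E z > hgt x y}. ?\<rho> * err \<gamma> x y z \<beta>)"
        by (intro sum_mono cost)
      also have "\<dots> = ?\<rho> * (\<Sum>z\<in>{z. E z > hgt x y}. err \<gamma> x y z \<beta>)" by (rule sum_distrib_left[symmetric])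
      also have "\<dots> \<le> ?\<rho> * err_tilde \<gamma> i x a y \<beta>"
        using False by (intro mult_left_mono) (auto simp: err_tilde_def E_hgt intro!: sum_nonneg err_nonneg)
      finally show ?thesis using False by simp
    qed
  qed
  also have "\<dots> = ?\<rho> * (\<Sum>y\<in>outer_boundary (basin i a). err_tilde \<gamma> i x a y \<beta>)"
    by (simp only: sum_distrib_left bdry_def)
  also have "\<dots> \<le> ?\<rho> * max_delta_err \<gamma> i \<beta>"
    using delta_err_ge[OF x, of \<beta>] max_delta_err_ge[OF a, of \<beta>] by (intro mult_left_mono) auto
  finally show ?thesis .
qed

lemma eventually_subexponential:
  assumes "M > 0" "\<epsilon> > 0" shows "\<forall>\<^sub>F \<beta> in at_top. M * exp (4 * \<beta> * \<gamma> \<beta>) \<le> exp (\<beta> * \<epsilon>)"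
proof -
  have "\<forall>\<^sub>F \<beta> in at_top. \<gamma> \<beta> < \<epsilon> / 8" using \<gamma>_tendsto assms by (intro order_tendstoD(2)) auto
  moreover have "\<forall>\<^sub>F \<beta> in at_top. M \<le> exp (\<beta> * (\<epsilon> / 2))" using assms by real_asymp
  ultimately show ?thesis using eventually_gt_at_top[of 0]
  proof eventually_elim
    case (elim \<beta>)
    then have "exp (4 * \<beta> * \<gamma> \<beta>) \<le> exp (\<beta> * (\<epsilon> / 2))" by simp
    then have "M * exp (4 * \<beta> * \<gamma> \<beta>) \<le> exp (\<beta> * (\<epsilon> / 2)) * exp (\<beta> * (\<epsilon> / 2))"
      using elim assms by (intro mult_mono) auto
    also have "\<dots> = exp (\<beta> * \<epsilon>)" by (simp flip: exp_add)
    finally show ?case .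
  qed
qed

section \<open>Probabilities at one large inverse temperature\<close>

context
  fixes \<beta> :: real
  assumes \<beta>: "\<beta> > 0" and large: "(real num_min + 2) * real CARD('s) ^ 6 \<le> exp (3 * \<beta> * \<gamma> \<beta>)"
begin

interpretation M: metropolis E adj lm i "p \<beta>" "sd \<beta>" "P \<beta>" "X \<beta>" \<beta> "weight \<beta> (lm 1)" "exp (2 * \<beta> * \<gamma> \<beta>)"
  by (rule metropolis_at[OF \<beta>])

text \<open>\<open>escape_bound\<close> contributes \<open>num_min + 2\<close> and \<open>C\<close>
  contributes \<open>CARD('s) ^ 6\<close>; by \<open>large\<close> the spare factor
  \<open>exp (3 * \<beta> * \<gamma> \<beta>)\<close> absorbs both.\<close>

lemma return_prob:
  assumes "m \<in> agg_minima i" "x \<in> basin i m" shows "M.hit (- basin i m) {m} x \<le> max_delta_err \<gamma> i \<beta>"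
proof -
  have "M.hit (- basin i m) {m} x \<le> (real num_min + 2) * (real CARD('s) ^ 6 * exp (- 3 * \<beta> * \<gamma> \<beta>) * max_delta_err \<gamma> i \<beta>)"
    using escape_le_delta[OF \<beta> assms(1)] assms by (intro M.escape_bound)
  also have "\<dots> = (real num_min + 2) * real CARD('s) ^ 6 * (exp (- 3 * \<beta> * \<gamma> \<beta>) * max_delta_err \<gamma> i \<beta>)"
    by (simp only: mult.assoc)
  also have "\<dots> \<le> exp (3 * \<beta> * \<gamma> \<beta>) * (exp (- 3 * \<beta> * \<gamma> \<beta>) * max_delta_err \<gamma> i \<beta>)"
    using large max_delta_err_nonneg by (intro mult_right_mono mult_nonneg_nonneg) auto
  also have "\<dots> = max_delta_err \<gamma> i \<beta>" by (simp add: mult.assoc[symmetric] flip: exp_add)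
  finally show ?thesis .
qed

lemma visit_prob:
  assumes m: "m \<in> agg_minima i" and v: "v \<in> strict_valley i m"
  shows "M.hit (- basin i m) {v} m \<le> max_delta_err \<gamma> i \<beta>"
proof -
  have "M.hit (- basin i m) {v} m \<le> M.escape m v" using M.strict_escape[OF m v] .
  also have "\<dots> \<le> real CARD('s) ^ 6 * (exp (- 3 * \<beta> * \<gamma> \<beta>) * max_delta_err \<gamma> i \<beta>)"
    using escape_le_delta[OF \<beta> m] strict_valley_basin[OF m] v by (auto simp: mult.assoc)
  also have "\<dots> \<le> exp (3 * \<beta> * \<gamma> \<beta>) * (exp (- 3 * \<beta> * \<gamma> \<beta>) * max_delta_err \<gamma> i \<beta>)"
  proof (rule mult_right_mono)
    have "1 * real CARD('s) ^ 6 \<le> (real num_min + 2) * real CARD('s) ^ 6" by (intro mult_right_mono) auto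
    then show "real CARD('s) ^ 6 \<le> exp (3 * \<beta> * \<gamma> \<beta>)" using large by linarith
  qed (use max_delta_err_nonneg in simp)
  also have "\<dots> = max_delta_err \<gamma> i \<beta>" by (simp add: mult.assoc[symmetric] flip: exp_add)
  finally show ?thesis .
qed

lemma covers_prob:
  assumes W: "\<And>m. m \<in> agg_minima i \<Longrightarrow> real (card (strict_valley i m)) \<le> W" "0 \<le> W"
    and small: "(W + 2) * max_delta_err \<gamma> i \<beta> \<le> 1" and "k < K"
  shows "1 - (W + 2) * max_delta_err \<gamma> i \<beta> \<le>
    measure (P \<beta> x) {\<omega> \<in> space (P \<beta> x). covers_strict_basin i K k (\<lambda>n. X \<beta> n \<omega>)}"
proof -
  let ?d = "max_delta_err \<gamma> i \<beta>"
  have d: "0 \<le> ?d" by (rule max_delta_err_nonneg)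
  then have Wd: "0 \<le> W * ?d" using W by simp
  have split: "(W + 2) * ?d = W * ?d + 2 * ?d" by (simp add: distrib_right)
  have "1 - (W + 2) * ?d \<le> M.Pr y M.home" for y
  proof (rule M.home_prob[OF d])
    show "?d \<le> 1" "W * ?d \<le> 1" using small d Wd unfolding split by linarith+
  qed (use return_prob visit_prob W in auto)
  then have "1 - (W + 2) * ?d \<le> M.Pr x (M.cov k K)" using small by (intro M.cov_prob) auto
  also have "\<dots> \<le> M.Pr x (covers_strict_basin i K k)"
    using M.cov_covering covering_covers \<open>k < K\<close> by (intro M.Pr_mono event_covers) blast
  finally show ?thesis unfolding M.Pr_eq[OF event_covers] .
qed

text \<open>Per step the path has \<open>M.\<kappa> * exp (- \<beta> * \<epsilon>)\<close>, while
  \<open>c * exp (- 2 * \<beta> * \<epsilon>)\<close> is asked for. The surplus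
  \<open>exp (\<beta> * \<epsilon>)\<close> exceeds \<open>c / M.\<kappa>\<close> for any fixed
  \<open>c\<close> once \<beta> is large.\<close>

lemma stays_prob:
  assumes small: "max_delta_err \<gamma> i \<beta> \<le> 1 / 2" and a: "a \<in> agg_states i"
    and ss: "links a ss" "climbs a ss \<le> real (length ss) * \<epsilon>"
    and c: "0 \<le> c" "c * (4 * (real CARD('s))\<^sup>2 * exp (4 * \<beta> * \<gamma> \<beta>)) \<le> exp (\<beta> * \<epsilon>)"
    and stays: "\<And>\<omega>. M.follow ss \<omega> \<Longrightarrow> \<omega> 0 = a \<Longrightarrow> stays_in_basins i (length ss) k \<omega>"
  shows "(c * exp (- 2 * \<beta> * \<epsilon>)) ^ length ss \<le>
    measure (P \<beta> a) {\<omega> \<in> space (P \<beta> a). stays_in_basins i (length ss) k (\<lambda>n. X \<beta> n \<omega>)}"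
proof -
  let ?D = "4 * (real CARD('s))\<^sup>2 * exp (4 * \<beta> * \<gamma> \<beta>)"
  have D: "?D > 0" using card_ge by simp
  have \<kappa>: "M.\<kappa> = 1 / ?D" unfolding M.\<kappa>_def M.N_def by (simp add: power2_eq_square flip: exp_add)
  have "c * exp (- 2 * \<beta> * \<epsilon>) * ?D = c * ?D * exp (- 2 * \<beta> * \<epsilon>)" by (simp only: mult_ac)
  also have "\<dots> \<le> exp (\<beta> * \<epsilon>) * exp (- 2 * \<beta> * \<epsilon>)" using c(2) by (intro mult_right_mono) auto
  also have "\<dots> = exp (- \<beta> * \<epsilon>)" by (simp flip: exp_add)
  finally have "c * exp (- 2 * \<beta> * \<epsilon>) \<le> M.\<kappa> * exp (- \<beta> * \<epsilon>)" using D unfolding \<kappa> by (simp add: pos_le_divide_eq)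
  then have "(c * exp (- 2 * \<beta> * \<epsilon>)) ^ length ss \<le> (M.\<kappa> * exp (- \<beta> * \<epsilon>)) ^ length ss"
    using c(1) by (intro power_mono) auto
  also have "\<dots> = M.\<kappa> ^ length ss * exp (- \<beta> * (real (length ss) * \<epsilon>))"
    by (simp add: power_mult_distrib exp_of_nat_mult[symmetric] mult_ac)
  also have "\<dots> \<le> M.\<kappa> ^ length ss * exp (- \<beta> * climbs a ss)"
    using ss(2) \<beta> M.\<kappa>_pos by (intro mult_left_mono) auto
  also have "\<dots> \<le> M.Pr a (M.follow ss)"
    by (rule M.follow_prob[OF ss(1) self_in_basin[OF a] order_trans[OF return_prob small]])
  also have "\<dots> \<le> M.Pr a (stays_in_basins i (length ss) k)"
    using stays by (intro M.Pr_start_mono M.event_follow event_stays)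
  finally show ?thesis unfolding M.Pr_eq[OF event_stays] .
qed

lemma stays_first_prob:
  assumes "max_delta_err \<gamma> i \<beta> \<le> 1 / 2" "a \<in> agg_states i" "0 \<le> \<epsilon>" "2 \<le> eta1 i \<epsilon>" "2 \<le> eta2 i \<epsilon>" "1 \<le> K"
    and "0 \<le> c" "c * (4 * (real CARD('s))\<^sup>2 * exp (4 * \<beta> * \<gamma> \<beta>)) \<le> exp (\<beta> * \<epsilon>)"
  shows "(c * exp (- 2 * \<beta> * \<epsilon>)) ^ K \<le>
    measure (P \<beta> a) {\<omega> \<in> space (P \<beta> a). stays_in_basins i K 1 (\<lambda>n. X \<beta> n \<omega>)}"
proof -
  obtain ss where ss: "length ss = K" "lows \<epsilon> a ss" "a \<notin> set ss"
    using avoiding_path[of \<epsilon> a a K] assms by blast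
  have "ss \<noteq> []" using ss(1) assms(6) by auto
  show ?thesis unfolding ss(1)[symmetric]
  proof (rule stays_prob[OF assms(1,2) lows_links[OF ss(2)] lows_climbs[OF assms(3) ss(2)] assms(7,8)])
    show "stays_in_basins i (length ss) 1 \<omega>" if "M.follow ss \<omega>" "\<omega> 0 = a" for \<omega>
      using M.follow_stays_first[OF that(1) _ assms(2) ss(3) \<open>ss \<noteq> []\<close>] self_in_basin[OF assms(2)] that(2) by simp
  qed
qed

lemma stays_all_prob:
  assumes "max_delta_err \<gamma> i \<beta> \<le> 1 / 2" "a \<in> agg_states i" "has_metabasins i \<epsilon>" "0 \<le> \<epsilon>" "1 \<le> K"
    and "K \<le> eta2 i \<epsilon>" "K \<le> eta3 i \<epsilon>"
    and "0 \<le> c" "c * (4 * (real CARD('s))\<^sup>2 * exp (4 * \<beta> * \<gamma> \<beta>)) \<le> exp (\<beta> * \<epsilon>)"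
  shows "(c * exp (- 2 * \<beta> * \<epsilon>)) ^ K \<le>
    measure (P \<beta> a) {\<omega> \<in> space (P \<beta> a). stays_in_basins i K K (\<lambda>n. X \<beta> n \<omega>)}"
proof -
  obtain ss where ss: "length ss = K" "links a ss" "distinct (a # ss)" "climbs a ss \<le> real K * \<epsilon>"
    using self_avoiding_path[OF assms(3,4,2,5-7)] by blast
  have "climbs a ss \<le> real (length ss) * \<epsilon>" using ss by simp
  then show ?thesis unfolding ss(1)[symmetric]
  proof (rule stays_prob[OF assms(1,2) ss(2) _ assms(8,9)])
    show "stays_in_basins i (length ss) (length ss) \<omega>" if "M.follow ss \<omega>" "\<omega> 0 = a" for \<omega>
      using M.follow_stays_all[OF that(1) _ assms(2) ss(3)] self_in_basin[OF assms(2)] that(2) by simp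
  qed
qed

end

lemma eventually_large: "\<forall>\<^sub>F \<beta> in at_top. (real num_min + 2) * real CARD('s) ^ 6 \<le> exp (3 * \<beta> * \<gamma> \<beta>)"
proof -
  have "filterlim (\<lambda>\<beta>. exp (3 * (\<beta> * \<gamma> \<beta>))) at_top at_top"
    by (intro filterlim_compose[OF exp_at_top] filterlim_tendsto_pos_mult_at_top[OF tendsto_const _ \<beta>\<gamma>_tendsto]) simp
  then show ?thesis by (simp add: filterlim_at_top mult.assoc)
qed

end

section \<open>A common threshold for \<beta> and the three claims\<close>

theorem theorem3p17:
  fixes E :: "'s::finite \<Rightarrow> real"
    and adj :: "'s \<Rightarrow> 's \<Rightarrow> bool"
    and p :: "real \<Rightarrow> 's \<Rightarrow> 's \<Rightarrow> real"
    and sd :: "real \<Rightarrow> 's \<Rightarrow> real"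
    and \<gamma> :: "real \<Rightarrow> real"
    and lm :: "nat \<Rightarrow> 's"
    and P :: "real \<Rightarrow> 's \<Rightarrow> 'w measure"
    and X :: "real \<Rightarrow> nat \<Rightarrow> 'w \<Rightarrow> 's"
    and \<epsilon> :: real
    and \<delta> :: "real \<Rightarrow> real"
    and i K \<eta>1 \<eta>2 \<eta>3 :: nat
  assumes chain: "metastable_chain E adj p sd \<gamma>"
    and labelling: "landscape.scoppola_labelling E adj lm"
    and process: "\<forall>\<beta>>0. \<forall>x. markov_chain_from (p \<beta>) x (P \<beta> x) (X \<beta>)"
    and eps: "\<epsilon> > 0"
    and metabasins: "landscape.has_metabasins E adj lm i \<epsilon>"
    and eta1: "\<eta>1 = landscape.eta1 E adj lm i \<epsilon>"
    and eta2: "\<eta>2 = landscape.eta2 E adj lm i \<epsilon>"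
    and eta3: "\<eta>3 = landscape.eta3 E adj lm i \<epsilon>"
    and K: "K \<ge> 1"
    and delta: "\<forall>\<beta>>0. 0 < \<delta> \<beta> \<and>
        \<delta> \<beta> \<le> ((min (real \<eta>1) (real \<eta>2 - 1) - 1) * exp (- 2 * \<beta> * \<epsilon>)) ^ K"
  shows "\<forall>k<K. \<forall>m0\<in>landscape.agg_states E adj lm i. \<exists>\<beta>0>0. \<forall>\<beta>\<ge>\<beta>0.
      measure (P \<beta> m0)
          {\<omega> \<in> space (P \<beta> m0). landscape.covers_strict_basin E adj lm i K k (\<lambda>n. X \<beta> n \<omega>)}
        \<ge> 1 - (real (MAX a\<in>landscape.agg_minima E adj lm i.
                      card (landscape.strict_valley E adj lm i a)) + 2)
              * landscape.max_delta_err E adj lm \<gamma> i \<beta>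
      \<and>
      (min (real \<eta>1) (real \<eta>2 - 1) - 1 > 0 \<longrightarrow>
        measure (P \<beta> m0)
            {\<omega> \<in> space (P \<beta> m0). landscape.stays_in_basins E adj lm i K k (\<lambda>n. X \<beta> n \<omega>)}
          \<ge> 1 - real k * (landscape.max_delta_err E adj lm \<gamma> i \<beta> + (1 - \<delta> \<beta>)))
      \<and>
      (min \<eta>2 \<eta>3 > K - 1 \<longrightarrow>
        measure (P \<beta> m0)
            {\<omega> \<in> space (P \<beta> m0). landscape.stays_in_basins E adj lm i K K (\<lambda>n. X \<beta> n \<omega>)}
          \<ge> (\<Prod>l<K. real (min \<eta>2 \<eta>3) - real l)
              * (1 - landscape.max_delta_err E adj lm \<gamma> i \<beta>) ^ (K - 1)
              * exp (- 2 * real K * \<epsilon> * \<beta>))"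
proof -
  interpret C: metastable_chain E adj p sd \<gamma> by (rule chain)
  interpret L: landscape E adj lm .
  have mb: "1 \<le> i" "i < L.num_min" using metabasins by (auto simp: L.has_metabasins_def)
  interpret S: metabasin_setting E adj p sd \<gamma> lm i P X
  proof unfold_locales
    show "inj E" by (rule C.E_inj)
    show "adj\<^sup>*\<^sup>* r s" for r s by (rule C.irreducible)
    show "adj s s" for s by (rule C.adj_refl)
    show "adj s r" if "adj r s" for r s using that C.adj_sym by blast
    show "bij_betw lm {1..L.num_min} L.local_minima" using labelling by (simp add: L.scoppola_labelling_def)
    show "markov_chain_from (p \<beta>) x (P \<beta> x) (X \<beta>)" if "\<beta> > 0" for \<beta> x using process that by blast
  qed (fact mb)+
  define d where "d = L.max_delta_err \<gamma> i"
  define W where "W = real (MAX a\<in>L.agg_minima i. card (L.strict_valley i a))"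
  define c where "c = min (real \<eta>1) (real \<eta>2 - 1) - 1"
  define B where "B = (\<Prod>l<K. real (min \<eta>2 \<eta>3) - real l)"
  \<comment> \<open>One constant for both path estimates: it dominates \<open>c\<close> from (b) and
    the falling product \<open>B\<close> from (c), and being at least 1 it is at most its own
    \<open>K\<close>-th power.\<close>
  define M where "M = max 1 (max c B)"
  have W: "real (card (L.strict_valley i m)) \<le> W" if "m \<in> L.agg_minima i" for m
    unfolding W_def of_nat_le_iff using that by (intro Max_ge) auto
  have W0: "0 \<le> W" by (simp add: W_def)
  have M: "1 \<le> M" "c \<le> M" "B \<le> M" by (auto simp: M_def)
  have d0: "0 \<le> d \<beta>" for \<beta> unfolding d_def by (rule S.max_delta_err_nonneg)
  have "\<forall>\<^sub>F \<beta> in at_top. c * exp (- 2 * \<beta> * \<epsilon>) \<le> 1 / 2" using eps by real_asymp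
  moreover have "\<forall>\<^sub>F \<beta> in at_top. d \<beta> \<le> 1 / 2" "\<forall>\<^sub>F \<beta> in at_top. d \<beta> \<le> 1 / (W + 2)"
    unfolding d_def using W0 by (intro S.max_delta_err_small; simp)+
  moreover have "\<forall>\<^sub>F \<beta> in at_top. M * (4 * (real CARD('s))\<^sup>2) * exp (4 * \<beta> * \<gamma> \<beta>) \<le> exp (\<beta> * \<epsilon>)"
    using S.card_ge M eps by (intro S.eventually_subexponential mult_pos_pos) auto
  ultimately have "\<forall>\<^sub>F \<beta> in at_top. \<beta> > 0 \<and> (real L.num_min + 2) * real CARD('s) ^ 6 \<le> exp (3 * \<beta> * \<gamma> \<beta>) \<and>
    c * exp (- 2 * \<beta> * \<epsilon>) \<le> 1 / 2 \<and> d \<beta> \<le> 1 / 2 \<and> d \<beta> \<le> 1 / (W + 2) \<and>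
    M * (4 * (real CARD('s))\<^sup>2) * exp (4 * \<beta> * \<gamma> \<beta>) \<le> exp (\<beta> * \<epsilon>)"
    using S.eventually_large eventually_gt_at_top[of "0 :: real"] by eventually_elim blast
  then obtain \<beta>1 where \<beta>1: "\<And>\<beta>. \<beta>1 \<le> \<beta> \<Longrightarrow> \<beta> > 0 \<and> (real L.num_min + 2) * real CARD('s) ^ 6 \<le> exp (3 * \<beta> * \<gamma> \<beta>) \<and>
    c * exp (- 2 * \<beta> * \<epsilon>) \<le> 1 / 2 \<and> d \<beta> \<le> 1 / 2 \<and> d \<beta> \<le> 1 / (W + 2) \<and>
    M * (4 * (real CARD('s))\<^sup>2) * exp (4 * \<beta> * \<gamma> \<beta>) \<le> exp (\<beta> * \<epsilon>)"
    unfolding eventually_at_top_linorder by blast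
  have cover: "1 - (W + 2) * d \<beta> \<le> measure (P \<beta> a) {\<omega> \<in> space (P \<beta> a). L.covers_strict_basin i K k (\<lambda>n. X \<beta> n \<omega>)}"
    if "\<beta>1 \<le> \<beta>" "k < K" for \<beta> k a
  proof -
    have "(W + 2) * d \<beta> \<le> 1" using \<beta>1[OF that(1)] W0 by (simp add: pos_le_divide_eq mult.commute)
    then show ?thesis using \<beta>1[OF that(1)] that(2) W W0 unfolding d_def by (intro S.covers_prob) auto
  qed
  have rate: "e * (4 * (real CARD('s))\<^sup>2 * exp (4 * \<beta> * \<gamma> \<beta>)) \<le> exp (\<beta> * \<epsilon>)" if "\<beta>1 \<le> \<beta>" "e \<le> M" for \<beta> e
  proof -
    have "e * (4 * (real CARD('s))\<^sup>2 * exp (4 * \<beta> * \<gamma> \<beta>)) \<le> M * (4 * (real CARD('s))\<^sup>2 * exp (4 * \<beta> * \<gamma> \<beta>))"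
      using that(2) by (intro mult_right_mono) auto
    also have "\<dots> = M * (4 * (real CARD('s))\<^sup>2) * exp (4 * \<beta> * \<gamma> \<beta>)" by (simp only: mult.assoc)
    also have "\<dots> \<le> exp (\<beta> * \<epsilon>)" using \<beta>1[OF that(1)] by blast
    finally show ?thesis .
  qed
  have first: "1 - real k * (d \<beta> + (1 - \<delta> \<beta>)) \<le>
      measure (P \<beta> a) {\<omega> \<in> space (P \<beta> a). L.stays_in_basins i K k (\<lambda>n. X \<beta> n \<omega>)}"
    if \<beta>: "\<beta>1 \<le> \<beta>" and a: "a \<in> L.agg_states i" and c: "c > 0" for \<beta> k a
  proof -
    have pos: "\<beta> > 0" using \<beta>1[OF \<beta>] by blast
    have \<delta>: "\<delta> \<beta> \<le> (c * exp (- 2 * \<beta> * \<epsilon>)) ^ K" using delta pos by (simp add: c_def)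
    consider "k = 0" | "k = 1" | "2 \<le> k" by linarith
    then show ?thesis
    proof cases
      case 1
      have "prob_space (P \<beta> a)" using S.process[OF pos, of a] by (simp add: markov_chain_from_def)
      then show ?thesis using 1 by (simp add: L.stays_in_basins_def prob_space.prob_space)
    next
      case 2
      have "1 < real \<eta>1" "2 < real \<eta>2" using c by (auto simp: c_def)
      then have eta: "2 \<le> \<eta>1" "2 \<le> \<eta>2" by linarith+
      \<comment> \<open>For \<open>k = 1\<close> the claimed bound is
        \<open>\<delta> \<beta> - d \<beta>\<close>, hence at most
        \<open>\<delta> \<beta>\<close>.\<close>
      have "1 - real k * (d \<beta> + (1 - \<delta> \<beta>)) \<le> (c * exp (- 2 * \<beta> * \<epsilon>)) ^ K" using 2 \<delta> d0[of \<beta>] by simp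
      also have "\<dots> \<le> measure (P \<beta> a) {\<omega> \<in> space (P \<beta> a). L.stays_in_basins i K 1 (\<lambda>n. X \<beta> n \<omega>)}"
        using \<beta>1[OF \<beta>] a eps eta K c rate[OF \<beta> M(2)] unfolding d_def eta1 eta2
        by (intro S.stays_first_prob) auto
      finally show ?thesis using 2 by simp
    next
      case 3
      have "(c * exp (- 2 * \<beta> * \<epsilon>)) ^ K \<le> (c * exp (- 2 * \<beta> * \<epsilon>)) ^ 1"
        using \<beta>1[OF \<beta>] c K by (intro power_decreasing) auto
      then have "\<delta> \<beta> \<le> 1 / 2" using \<delta> \<beta>1[OF \<beta>] by (simp only: power_one_right) linarith
      \<comment> \<open>As \<open>\<delta> \<beta>\<close> is at most 1/2, two of the
        \<open>k\<close> summands already make the claimed bound at most 0.\<close>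
      then have "2 * (1 / 2) \<le> real k * (d \<beta> + (1 - \<delta> \<beta>))" using 3 d0[of \<beta>] by (intro mult_mono) auto
      then show ?thesis using measure_nonneg[of "P \<beta> a" "{\<omega> \<in> space (P \<beta> a). L.stays_in_basins i K k (\<lambda>n. X \<beta> n \<omega>)}"] by linarith
    qed
  qed
  have all: "B * (1 - d \<beta>) ^ (K - 1) * exp (- 2 * real K * \<epsilon> * \<beta>) \<le>
      measure (P \<beta> a) {\<omega> \<in> space (P \<beta> a). L.stays_in_basins i K K (\<lambda>n. X \<beta> n \<omega>)}"
    if \<beta>: "\<beta>1 \<le> \<beta>" and a: "a \<in> L.agg_states i" and \<eta>: "min \<eta>2 \<eta>3 > K - 1" for \<beta> a
  proof -
    have eta: "K \<le> \<eta>2" "K \<le> \<eta>3" using \<eta> by auto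
    have B: "0 \<le> B" unfolding B_def using eta by (intro prod_nonneg) auto
    have "(1 - d \<beta>) ^ (K - 1) \<le> 1" using \<beta>1[OF \<beta>] d0[of \<beta>] by (intro power_le_one) auto
    then have "B * (1 - d \<beta>) ^ (K - 1) \<le> M * 1" using B M \<beta>1[OF \<beta>] by (intro mult_mono) auto
    also have "\<dots> \<le> M ^ K" using power_increasing[of 1 K M] M K by simp
    finally have "B * (1 - d \<beta>) ^ (K - 1) * exp (- 2 * real K * \<epsilon> * \<beta>) \<le> M ^ K * exp (real K * (- 2 * \<beta> * \<epsilon>))"
      by (simp add: mult_ac)
    also have "\<dots> = (M * exp (- 2 * \<beta> * \<epsilon>)) ^ K" by (simp only: exp_of_nat_mult power_mult_distrib)
    also have "\<dots> \<le> measure (P \<beta> a) {\<omega> \<in> space (P \<beta> a). L.stays_in_basins i K K (\<lambda>n. X \<beta> n \<omega>)}"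
      using \<beta>1[OF \<beta>] a eps eta K metabasins M(1) rate[OF \<beta> order_refl] unfolding d_def eta2 eta3
      by (intro S.stays_all_prob) auto
    finally show ?thesis .
  qed
  \<comment> \<open>The eventual conditions contain \<open>\<beta> > 0\<close> and hold at
    \<open>\<beta>1\<close> itself.\<close>
  have "\<beta>1 > 0" using \<beta>1[of \<beta>1] by simp
  then show ?thesis
    using cover first all unfolding W_def d_def c_def B_def by (intro ballI allI impI exI[of _ \<beta>1] conjI) auto
qed

end
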